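(* Let $n\ge 1$, $A\in\mathbb{R}^{n\times n}$, $B\in\mathbb{R}^{n\times 1}$, $K\in\mathbb{R}^{1\times n}$. Consider the coupled ODE–string system $$\dot X(t)=AX(t)+Bu(1,t),\quad u_{tt}(x,t)=c^2u_{xx}(x,t),\quad u(0,t)=KX(t),\quad u_x(1,t)=-c_0u_t(1,t),$$ for $x\in[0,1]$, $t\ge 0$, with a given speed $c>0$, a viscous damping $c_0>0$ and initial conditions $X(0)=X^0$, $u(\cdot,0)=u^0$, $u_t(\cdot,0)=v^0$, where $(X^0,u^0,v^0)\in\mathcal{D}(T)$. Define $\tilde B=\frac{1}{2c}B\begin{bmatrix}1 & -1\end{bmatrix}\in\mathbb{R}^{n\times 2}$. Assume that there exist symmetric positive definite matrices $P_0\in\mathbb{R}^{(n+2)\times(n+2)}$ and $S,R\in\mathbb{R}^{2\times 2}$ such that the following LMI holds: $$\Psi_0=\mathrm{He}\left(Z_0^\top P_0F_0\right)-c\tilde R_0+c\left(H_0^\top(S+R)H_0-G_0^\top SG_0\right)\prec 0,$$ where $$F_0=\begin{bmatrix}I_{n+2} & 0_{n+2,2}\end{bmatrix},\quad \mathcal{N}_0=\begin{bmatrix}A+BK & \tilde B & 0_{n,2}\end{bmatrix},\quad \tilde R_0=\mathrm{diag}(0_n,R,0_2),$$ $$g=\begin{bmatrix}0 & 1 \\ 1+cc_0 & 0\end{bmatrix},\qquad h=\begin{bmatrix}1-cc_0 & 0 \\ 0 & -1\end{bmatrix},$$ $$G_0=\begin{bmatrix}0_{2,n+2} & g\end{bmatrix}+\begin{bmatrix}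 K \\ 0_{1,n} \end{bmatrix}\mathcal{N}_0,\qquad H_0=\begin{bmatrix}0_{2,n+2} & h\end{bmatrix}+\begin{bmatrix} 0_{1,n} \\ K \end{bmatrix}\mathcal{N}_0,\qquad Z_0=\begin{bmatrix} \mathcal{N}_0 \\ c(H_0-G_0) \end{bmatrix}.$$ Then there exists a unique solution to the system and it is exponentially stable in the sense of $\|\cdot\|_{\mathcal{H}}$, i.e. there exist $\gamma\ge 1$ and $\delta>0$ such that the following estimate holds for $t>0$: $$\|(X(t),u(t),u_t(t))\|_{\mathcal{H}}^2\le\gamma e^{-\delta t}\|(X^0,u^0,v^0)\|_{\mathcal{H}}^2 .$$
   Context: $L^2=L^2([0,1];\mathbb{R})$ with norm $\|z\|^2=\int_0^1|z(x)|^2dx$, and $H^m$ denotes the usual Sobolev space on $[0,1]$ ($H^0=L^2$). $\mathcal{H}=\mathbb{R}^n\times H^1\times L^2$ with norm $\|(X,u,v)\|_{\mathcal{H}}^2=|X|_n^2+\|u\|^2+c^2\|u_x\|^2+\|v\|^2$, where $|\cdot|_n$ is the Euclidean norm on $\mathbb{R}^n$. $T:\mathcal{D}(T)\to\mathcal{H}$ is the linear unbounded operator $T(X,u,v)=(AX+Bu(1),\,v,\,c^2u_{xx})$ modelling the system, with domain $\mathcal{D}(T)=\{(X,u,v)\in\mathbb{R}^n\times H^2\times H^1:\ u(0)=KX,\ u_x(1)=-c_0v(1)\}$. $\mathrm{He}(M)=M+M^\top$; $\mathrm{diag}$ is the block-diagonal matrix; $0_{p,q}$ is the $p\times q$ zero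 matrix, $0_p=0_{p,p}$, $I_p$ is the identity of size $p$; $M\prec 0$ means symmetric negative definite. *)

theory Defs
  imports "HOL-Analysis.Analysis"
begin

section \<open>Block matrices and definiteness\<close>

definition hcat :: "real^'a^'m \<Rightarrow> real^'b^'m \<Rightarrow> real^('a + 'b)^'m" where
  "hcat M N = (\<chi> i j. case j of Inl a \<Rightarrow> M $ i $ a | Inr b \<Rightarrow> N $ i $ b)"

definition vcat :: "real^'k^'a \<Rightarrow> real^'k^'b \<Rightarrow> real^'k^('a + 'b)" where
  "vcat M N = (\<chi> i. case i of Inl a \<Rightarrow> M $ a | Inr b \<Rightarrow> N $ b)"

definition bdiag :: "real^'a^'m \<Rightarrow> real^'b^'k \<Rightarrow> real^('a + 'b)^('m + 'k)" where
  "bdiag M N = vcat (hcat M 0) (hcat 0 N)"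

definition He :: "real^'a^'a \<Rightarrow> real^'a^'a" where
  "He M = M + transpose M"

definition sym_pos_def :: "real^'a^'a \<Rightarrow> bool" where
  "sym_pos_def M \<longleftrightarrow> transpose M = M \<and> (\<forall>x. x \<noteq> 0 \<longrightarrow> x \<bullet> (M *v x) > 0)"

definition sym_neg_def :: "real^'a^'a \<Rightarrow> bool" where
  "sym_neg_def M \<longleftrightarrow> transpose M = M \<and> (\<forall>x. x \<noteq> 0 \<longrightarrow> x \<bullet> (M *v x) < 0)"

section \<open>The matrices of the linear matrix inequality\<close>

definition B_tilde :: "real \<Rightarrow> real^1^'n \<Rightarrow> real^2^'n" where
  "B_tilde c B = (1 / (2 * c)) *\<^sub>R (B ** (vector [vector [1, -1]] :: real^2^1))"

definition g_mat :: "real \<Rightarrow> real \<Rightarrow> real^2^2" where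
  "g_mat c c0 = vector [vector [0, 1], vector [1 + c * c0, 0]]"

definition h_mat :: "real \<Rightarrow> real \<Rightarrow> real^2^2" where
  "h_mat c c0 = vector [vector [1 - c * c0, 0], vector [0, -1]]"

definition F0 :: "real^(('n::finite + 2) + 2)^('n + 2)" where
  "F0 = hcat (mat 1) 0"

definition N0 :: "real \<Rightarrow> real^'n^'n \<Rightarrow> real^1^'n \<Rightarrow> real^'n^1
    \<Rightarrow> real^(('n + 2) + 2)^'n" where
  "N0 c A B K = hcat (hcat (A + B ** K) (B_tilde c B)) 0"

definition R_tilde0 :: "real^2^2 \<Rightarrow> real^(('n::finite + 2) + 2)^(('n + 2) + 2)" where
  "R_tilde0 R = bdiag (bdiag (0 :: real^'n^'n) R) (0 :: real^2^2)"

definition G0 :: "real \<Rightarrow> real \<Rightarrow> real^'n^'n \<Rightarrow> real^1^'n \<Rightarrow> real^'n^1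
    \<Rightarrow> real^(('n + 2) + 2)^2" where
  "G0 c c0 A B K = hcat 0 (g_mat c c0) + (vector [row 1 K, 0] :: real^'n^2) ** N0 c A B K"

definition H0 :: "real \<Rightarrow> real \<Rightarrow> real^'n^'n \<Rightarrow> real^1^'n \<Rightarrow> real^'n^1
    \<Rightarrow> real^(('n + 2) + 2)^2" where
  "H0 c c0 A B K = hcat 0 (h_mat c c0) + (vector [0, row 1 K] :: real^'n^2) ** N0 c A B K"

definition Z0 :: "real \<Rightarrow> real \<Rightarrow> real^'n^'n \<Rightarrow> real^1^'n \<Rightarrow> real^'n^1
    \<Rightarrow> real^(('n + 2) + 2)^('n + 2)" where
  "Z0 c c0 A B K = vcat (N0 c A B K) (c *\<^sub>R (H0 c c0 A B K - G0 c c0 A B K))"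

definition Psi0 :: "real \<Rightarrow> real \<Rightarrow> real^'n^'n \<Rightarrow> real^1^'n \<Rightarrow> real^'n^1
    \<Rightarrow> real^('n + 2)^('n + 2) \<Rightarrow> real^2^2 \<Rightarrow> real^2^2
    \<Rightarrow> real^(('n + 2) + 2)^(('n + 2) + 2)" where
  "Psi0 c c0 A B K P0 S R =
     He (transpose (Z0 c c0 A B K) ** P0 ** F0)
     - c *\<^sub>R R_tilde0 R
     + c *\<^sub>R (transpose (H0 c c0 A B K) ** (S + R) ** H0 c c0 A B K
             - transpose (G0 c c0 A B K) ** S ** G0 c c0 A B K)"

section \<open>Sobolev spaces on the unit interval\<close>

text \<open>
  Elements of $L^2$ and $H^m$ are represented by functions on the reals; only the almost everywhere
  class of the restriction to $[0,1]$ matters. No quotient is formed: equality of classes is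
  expressed by a vanishing norm of the difference.
\<close>

definition L2 :: "(real \<Rightarrow> real) set" where
  "L2 = {f. f \<in> borel_measurable (lebesgue_on {0..1}) \<and>
            integrable (lebesgue_on {0..1}) (\<lambda>x. (f x)\<^sup>2)}"

definition normL2 :: "(real \<Rightarrow> real) \<Rightarrow> real" where
  "normL2 f = sqrt (\<integral>x. (f x)\<^sup>2 \<partial>lebesgue_on {0..1})"

text \<open>Test functions of class $C^1$ with compact support in the open interval $(0,1)$, each given
  together with its derivative.\<close>

definition test_function :: "(real \<Rightarrow> real) \<Rightarrow> (real \<Rightarrow> real) \<Rightarrow> bool" where
  "test_function \<phi> \<phi>' \<longleftrightarrow>
     (\<forall>x. (\<phi> has_real_derivative \<phi>' x) (at x)) \<and> continuous_on UNIV \<phi>' \<and>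
     (\<exists>a b. 0 < a \<and> a \<le> b \<and> b < 1 \<and> (\<forall>x. x \<notin> {a..b} \<longrightarrow> \<phi> x = 0))"

definition weak_deriv :: "(real \<Rightarrow> real) \<Rightarrow> (real \<Rightarrow> real) \<Rightarrow> bool" where
  "weak_deriv f f' \<longleftrightarrow> f \<in> L2 \<and> f' \<in> L2 \<and>
     (\<forall>\<phi> \<phi>'. test_function \<phi> \<phi>' \<longrightarrow>
        (\<integral>x. f x * \<phi>' x \<partial>lebesgue_on {0..1}) = - (\<integral>x. f' x * \<phi> x \<partial>lebesgue_on {0..1}))"

primrec Hsob :: "nat \<Rightarrow> (real \<Rightarrow> real) set" where
  "Hsob 0 = L2"
| "Hsob (Suc m) = {f. \<exists>f' \<in> Hsob m. weak_deriv f f'}"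

definition wderiv :: "(real \<Rightarrow> real) \<Rightarrow> real \<Rightarrow> real" where
  "wderiv f = (SOME f'. weak_deriv f f')"

text \<open>Point values of an $H^1$ function are those of its continuous representative on $[0,1]$.\<close>

definition cont_rep :: "(real \<Rightarrow> real) \<Rightarrow> real \<Rightarrow> real" where
  "cont_rep f = (SOME w. continuous_on {0..1} w \<and> (AE x in lebesgue_on {0..1}. w x = f x))"

section \<open>State space and system operator\<close>

type_synonym 'n state = "(real^'n) \<times> (real \<Rightarrow> real) \<times> (real \<Rightarrow> real)"

definition st_add :: "'n::finite state \<Rightarrow> 'n state \<Rightarrow> 'n state" where
  "st_add = (\<lambda>(X, u, v) (Y, w, y). (X + Y, \<lambda>x. u x + w x, \<lambda>x. v x + y x))"

definition st_scale :: "real \<Rightarrow> 'n::finite state \<Rightarrow> 'n state" where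
  "st_scale r = (\<lambda>(X, u, v). (r *\<^sub>R X, \<lambda>x. r * u x, \<lambda>x. r * v x))"

definition st_diff :: "'n::finite state \<Rightarrow> 'n state \<Rightarrow> 'n state" where
  "st_diff z w = st_add z (st_scale (-1) w)"

definition H_space :: "'n::finite state set" where
  "H_space = {(X, u, v). u \<in> Hsob 1 \<and> v \<in> Hsob 0}"

definition normH :: "real \<Rightarrow> 'n::finite state \<Rightarrow> real" where
  "normH c = (\<lambda>(X, u, v).
     sqrt ((norm X)\<^sup>2 + (normL2 u)\<^sup>2 + c\<^sup>2 * (normL2 (wderiv u))\<^sup>2 + (normL2 v)\<^sup>2))"

definition dom_T :: "real \<Rightarrow> real^'n^1 \<Rightarrow> 'n::finite state set" where
  "dom_T c0 K = {(X, u, v). u \<in> Hsob 2 \<and> v \<in> Hsob 1 \<and>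
     cont_rep u 0 = (K *v X) $ 1 \<and>
     cont_rep (wderiv u) 1 = - c0 * cont_rep v 1}"

definition op_T :: "real \<Rightarrow> real^'n^'n \<Rightarrow> real^1^'n \<Rightarrow> 'n::finite state \<Rightarrow> 'n state" where
  "op_T c A B = (\<lambda>(X, u, v).
     (A *v X + B *v vec (cont_rep u 1), v, \<lambda>x. c\<^sup>2 * wderiv (wderiv u) x))"

section \<open>Solutions\<close>

definition H_continuous :: "real \<Rightarrow> (real \<Rightarrow> 'n::finite state) \<Rightarrow> bool" where
  "H_continuous c z \<longleftrightarrow>
     (\<forall>t\<ge>0. ((\<lambda>s. normH c (st_diff (z s) (z t))) \<longlongrightarrow> 0) (at t within {0..}))"

text \<open>\<open>H_primitive c z Z\<close> says that \<open>Z t\<close> is the integral of the continuous curve \<open>z\<close> over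
  \<open>[0, t]\<close>, as an element of the Hilbert space: \<open>Z\<close> vanishes at \<open>0\<close> and has norm derivative \<open>z\<close>.\<close>

definition H_primitive ::
  "real \<Rightarrow> (real \<Rightarrow> 'n::finite state) \<Rightarrow> (real \<Rightarrow> 'n state) \<Rightarrow> bool" where
  "H_primitive c z Z \<longleftrightarrow>
     (\<forall>t\<ge>0. Z t \<in> H_space) \<and> normH c (Z 0) = 0 \<and>
     (\<forall>t\<ge>0. ((\<lambda>s. normH c (st_diff (st_diff (Z s) (Z t)) (st_scale (s - t) (z t))) / \<bar>s - t\<bar>)
               \<longlongrightarrow> 0) (at t within {0..}))"

text \<open>
  Solutions are continuous mild solutions of $\dot z = Tz$, $z(0) = z^0$, with $z = (X,u,u_t)$:
  $\int_0^t z(s)\,ds$ lies in the domain of $T$ and $z(t) = z^0 + T \int_0^t z(s)\,ds$.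
  In components: $\dot X = AX + Bu(1,\cdot)$ and $u(0,\cdot) = KX$ hold classically, the third
  component $v$ is the time derivative of $u$ in $L^2$, and $u_{tt} = c^2 u_{xx}$ and
  $u_x(1,\cdot) = -c_0 u_t(1,\cdot)$ hold integrated in time.

  Asking for $z \in C^1([0,\infty);\mathcal{H})$ with values in the domain instead would be too
  strong: $u(0,t) = KX(t)$ would force $v^0(0) = K(AX^0 + Bu^0(1))$, which is not part of
  $(X^0,u^0,v^0) \in \mathcal{D}(T)$.
\<close>

definition solution :: "real \<Rightarrow> real \<Rightarrow> real^'n^'n \<Rightarrow> real^1^'n \<Rightarrow> real^'n^1
    \<Rightarrow> 'n::finite state \<Rightarrow> (real \<Rightarrow> 'n state) \<Rightarrow> bool" where
  "solution c c0 A B K z0 z \<longleftrightarrow>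
     (\<forall>t\<ge>0. z t \<in> H_space) \<and> H_continuous c z \<and>
     (\<exists>Z. H_primitive c z Z \<and>
        (\<forall>t\<ge>0. Z t \<in> dom_T c0 K \<and>
                normH c (st_diff (z t) (st_add z0 (op_T c A B (Z t)))) = 0))"

end

(*
The Riemann coordinates u_t + c u_x and (after reflecting the interval) u_t - c u_x are both
transported to the left with speed c, and X together with their means obeys a linear equation.
For V = xi . P0 xi + int chi . (S + x R) chi, with xi = (X, int chi), integration by parts and
Jensen's inequality (int chi . R chi >= mean . R mean) bound the time derivative by the quadratic
form of Psi0 in (X, int chi, u_t(1), c u_x(0)), so V decays exponentially along solutions with
values in the domain of T. The increments Z(t + h) - Z(t) of the primitive of a mild solution, and
the difference of two primitives, are such solutions; this gives stability (divide by h, let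
h tend to 0) and uniqueness. For existence, u is sought as a(ct + x) + b(ct - x): the boundary
conditions become a delay system for a, b and X, solved by the method of steps.
*)
theory Submission
  imports Defs
begin

text \<open>A mild solution need not stay where V can be differentiated: even for data in
  \<open>dom_T\<close> the identity v(0) = K X' may fail at time 0, and reflections carry the
  resulting jumps of u_x and u_t along. Integrated in time the equation reads Z' = z0 + T Z with Z
  in the domain. It is affine, so differences of two such curves solve the homogeneous equation
  classically. Negativity of Psi0 alone does not give decay, because it controls only the means of
  the Riemann coordinates, while V contains their L2 norms. Jensen's inequality is therefore applied
  to a share 1 - \<eta> of the integral of R only; the rest gives coercivity, and the error in the
  means is absorbed by the strict negativity. Since states are functions and not classes,
  derivatives are choices fixed only up to null sets. Weak derivatives are traded for indefinite
  integrals (\<open>AC\<close>), for which products, traces and uniqueness are elementary. For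
  existence, time is measured as s = c t, so that one crossing of the string takes one unit and
  kinks stay at integer arguments of the waves.\<close>

abbreviation I01 :: "real measure" where "I01 \<equiv> lebesgue_on {0..1}"

section \<open>Integration over the unit interval\<close>

lemma finite_measure_I01: "finite_measure I01"
  by (rule finite_measure_lebesgue_on) simp

lemma AE_I01_interval: "AE x in I01. x \<in> {0..1}"
  by (rule AE_I2) simp

lemma borel_measurable_I01: "f \<in> borel_measurable borel \<Longrightarrow> f \<in> borel_measurable I01"
  by (intro measurable_restrict_space1 measurable_completion) simp

lemma id_measurable_I01 [measurable]: "(\<lambda>x. x) \<in> measurable I01 borel"
  by (intro borel_measurable_I01) simp

lemma continuous_on_measurable_I01:
  fixes f :: "real \<Rightarrow> real"
  shows "continuous_on {0..1} f \<Longrightarrow> f \<in> borel_measurable I01"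
  by (rule continuous_imp_measurable_on_sets_lebesgue) auto

lemma integrable_I01_bounded:
  fixes f :: "real \<Rightarrow> real"
  assumes "f \<in> borel_measurable I01" "\<And>x. x \<in> {0..1} \<Longrightarrow> \<bar>f x\<bar> \<le> C"
  shows "integrable I01 f"
proof -
  interpret finite_measure I01 by (rule finite_measure_I01)
  show ?thesis
    by (rule integrable_const_bound[of _ C]) (use assms in \<open>auto intro!: AE_I2\<close>)
qed

lemma continuous_on_Icc_bound:
  fixes f :: "real \<Rightarrow> real"
  assumes "continuous_on {a..b} f"
  obtains C where "\<And>x. x \<in> {a..b} \<Longrightarrow> \<bar>f x\<bar> \<le> C"
proof -
  have "bounded (f ` {a..b})"
    using compact_imp_bounded[OF compact_continuous_image[OF assms compact_Icc]] .
  then obtain C where "\<forall>y\<in>f ` {a..b}. norm y \<le> C" by (auto simp: bounded_iff)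
  then show ?thesis using that[of C] by auto
qed

lemma continuous_on_integrable_I01:
  fixes f :: "real \<Rightarrow> real"
  assumes "continuous_on {0..1} f"
  shows "integrable I01 f"
proof -
  obtain C where "\<And>x. x \<in> {0..1} \<Longrightarrow> \<bar>f x\<bar> \<le> C"
    using continuous_on_Icc_bound[OF assms] by blast
  then show ?thesis
    by (rule integrable_I01_bounded[OF continuous_on_measurable_I01[OF assms]])
qed

lemma integral_I01_HK:
  fixes f :: "real \<Rightarrow> real"
  assumes "integrable I01 f"
  shows "(\<integral>x. f x \<partial>I01) = integral {0..1} f"
  by (rule lebesgue_integral_eq_integral[OF assms]) simp

section \<open>The semi-inner product of square integrable functions\<close>

lemma L2_measurable: "f \<in> L2 \<Longrightarrow> f \<in> borel_measurable I01"
  by (simp add: L2_def)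

lemma L2_mult_integrable:
  assumes "f \<in> L2" "g \<in> L2"
  shows "integrable I01 (\<lambda>x. f x * g x)"
proof (rule Bochner_Integration.integrable_bound)
  show "integrable I01 (\<lambda>x. (f x)\<^sup>2 + (g x)\<^sup>2)"
    using assms by (auto simp: L2_def)
  show "(\<lambda>x. f x * g x) \<in> borel_measurable I01"
    using assms by (auto simp: L2_def)
  have "\<bar>a * b\<bar> \<le> a\<^sup>2 + b\<^sup>2" for a b :: real
    using sum_squares_bound[of a b] sum_squares_bound[of a "-b"] zero_le_power2[of a] zero_le_power2[of b]
    by (simp add: abs_le_iff)
  then show "AE x in I01. norm (f x * g x) \<le> norm ((f x)\<^sup>2 + (g x)\<^sup>2)"
    by auto
qed

lemma L2_add: "f \<in> L2 \<Longrightarrow> g \<in> L2 \<Longrightarrow> (\<lambda>x. f x + g x) \<in> L2"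
  using L2_mult_integrable[of f g]
  by (auto simp: L2_def power2_sum mult.assoc)

lemma L2_scale: "f \<in> L2 \<Longrightarrow> (\<lambda>x. r * f x) \<in> L2"
  by (auto simp: L2_def power_mult_distrib)

lemma L2_diff: "f \<in> L2 \<Longrightarrow> g \<in> L2 \<Longrightarrow> (\<lambda>x. f x - g x) \<in> L2"
  using L2_add[of f "\<lambda>x. (-1) * g x"] L2_scale[of g "-1"] by simp

lemma L2_bounded:
  assumes "f \<in> borel_measurable I01" "\<And>x. x \<in> {0..1} \<Longrightarrow> \<bar>f x\<bar> \<le> C"
  shows "f \<in> L2"
proof -
  have "\<bar>(f x)\<^sup>2\<bar> \<le> C\<^sup>2" if "x \<in> {0..1}" for x
    using power_mono[OF assms(2)[OF that], of 2] by simp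
  then show ?thesis
    unfolding L2_def using assms(1) integrable_I01_bounded[of "\<lambda>x. (f x)\<^sup>2"] by auto
qed

lemma L2_continuous: "continuous_on {0..1} f \<Longrightarrow> f \<in> L2"
  unfolding L2_def
  by (auto intro!: continuous_on_measurable_I01 continuous_on_integrable_I01 continuous_intros)

lemma L2_const: "(\<lambda>x. k) \<in> L2"
  by (rule L2_continuous) simp

lemma L2_integrable: "f \<in> L2 \<Longrightarrow> integrable I01 f"
  using L2_mult_integrable[OF _ L2_const[of 1]] by simp

lemma L2_bounded_mult:
  assumes "f \<in> L2" "w \<in> borel_measurable I01" "\<And>x. x \<in> {0..1} \<Longrightarrow> \<bar>w x\<bar> \<le> C"
  shows "(\<lambda>x. w x * f x) \<in> L2"
proof -
  have "integrable I01 (\<lambda>x. (w x * f x)\<^sup>2)"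
  proof (rule Bochner_Integration.integrable_bound)
    show "integrable I01 (\<lambda>x. C\<^sup>2 * (f x)\<^sup>2)"
      using assms by (auto simp: L2_def)
    show "(\<lambda>x. (w x * f x)\<^sup>2) \<in> borel_measurable I01"
      using assms by (auto simp: L2_def)
    have "(w x * f x)\<^sup>2 \<le> C\<^sup>2 * (f x)\<^sup>2" if "x \<in> {0..1}" for x
      using power_mono[OF assms(3)[OF that], of 2] by (simp add: power_mult_distrib mult_right_mono)
    then show "AE x in I01. norm ((w x * f x)\<^sup>2) \<le> norm (C\<^sup>2 * (f x)\<^sup>2)"
      by (intro AE_I2) auto
  qed
  then show ?thesis
    using assms by (auto simp: L2_def)
qed

lemma L2_AE_cong:
  assumes "f \<in> L2" "g \<in> borel_measurable I01" "AE x in I01. f x = g x"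
  shows "g \<in> L2"
proof -
  have "integrable I01 (\<lambda>x. (g x)\<^sup>2)"
    by (rule integrable_cong_AE_imp[of _ "\<lambda>x. (f x)\<^sup>2"]) (use assms in \<open>auto simp: L2_def\<close>)
  then show ?thesis using assms by (simp add: L2_def)
qed

text \<open>Rests on the completeness of Lebesgue measure: a change on a negligible set keeps a
  function measurable.\<close>

lemma measurable_I01_AE_cong:
  fixes f g :: "real \<Rightarrow> real"
  assumes "f \<in> borel_measurable I01" "AE x in I01. f x = g x"
  shows "g \<in> borel_measurable I01"
proof -
  obtain N where N: "N \<in> null_sets I01" "{x \<in> space I01. f x \<noteq> g x} \<subseteq> N"
    using assms(2) by (auto simp: eventually_ae_filter)
  have "N \<in> null_sets lebesgue"
    using N(1) by (simp add: null_sets_restrict_space)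
  then have "negligible N" by (simp add: negligible_iff_null_sets)
  then have "negligible {x \<in> {0..1}. f x \<noteq> g x}"
    using N(2) negligible_subset by auto
  moreover have "f measurable_on {0..1}"
    using assms(1) by (simp add: measurable_on_iff_borel_measurable)
  ultimately have "g measurable_on {0..1}"
    by (intro measurable_on_spike[of f "{0..1}" "{x \<in> {0..1}. f x \<noteq> g x}" g]) auto
  then show ?thesis
    by (simp add: measurable_on_iff_borel_measurable)
qed

text \<open>Free of measurability hypotheses, so that it applies to \<open>wderiv\<close> of any
  function. If the squares are not measurable, neither integral exists and both take the default
  value 0.\<close>

lemma normL2_AE_cong:
  assumes "AE x in I01. f x = g x"
  shows "normL2 f = normL2 g"
proof (cases "f \<in> borel_measurable I01")
  case True
  then have "g \<in> borel_measurable I01" using measurable_I01_AE_cong assms by blast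
  with True show ?thesis unfolding normL2_def
    by (intro arg_cong[where f=sqrt] integral_cong_AE) (use assms in auto)
next
  case False
  have "integral\<^sup>L I01 (\<lambda>x. (f x)\<^sup>2) = integral\<^sup>L I01 (\<lambda>x. (g x)\<^sup>2)"
  \<comment> \<open>The square of a non-measurable function may be measurable, hence the second
    distinction.\<close>
  proof (cases "(\<lambda>x. (f x)\<^sup>2) \<in> borel_measurable I01")
    case True
    moreover have "AE x in I01. (f x)\<^sup>2 = (g x)\<^sup>2" using assms by auto
    ultimately show ?thesis
      by (intro integral_cong_AE measurable_I01_AE_cong[OF True]) auto
  next
    case False
    moreover have "AE x in I01. (g x)\<^sup>2 = (f x)\<^sup>2" using assms by auto
    ultimately have "(\<lambda>x. (g x)\<^sup>2) \<notin> borel_measurable I01"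
      using measurable_I01_AE_cong[of "\<lambda>x. (g x)\<^sup>2" "\<lambda>x. (f x)\<^sup>2"] by metis
    then show ?thesis using False
      by (metis borel_measurable_integrable not_integrable_integral_eq)
  qed
  then show ?thesis by (simp add: normL2_def)
qed

lemma normL2_nonneg [simp]: "normL2 f \<ge> 0"
  by (simp add: normL2_def)

lemma normL2_power2: "(normL2 f)\<^sup>2 = (\<integral>x. (f x)\<^sup>2 \<partial>I01)"
  by (simp add: normL2_def)

lemma normL2_scale: "normL2 (\<lambda>x. r * f x) = \<bar>r\<bar> * normL2 f"
  by (simp add: normL2_def power_mult_distrib real_sqrt_mult)

lemma normL2_eq_0: "f \<in> L2 \<Longrightarrow> normL2 f = 0 \<longleftrightarrow> (AE x in I01. f x = 0)"
  unfolding normL2_def L2_def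
  by (simp add: integral_nonneg_eq_0_iff_AE)

lemma discriminant_bound:
  fixes a b d :: real
  assumes "a \<ge> 0" "d \<ge> 0" and *: "\<And>s t. 0 \<le> s\<^sup>2 * a + 2 * s * t * b + t\<^sup>2 * d"
  shows "b\<^sup>2 \<le> a * d"
proof (cases "d = 0")
  case True
  have t: "0 \<le> a + 2 * t * b" for t using *[of 1 t] True by simp
  have "b = 0"
  proof (rule ccontr)
    assume "b \<noteq> 0"
    \<comment> \<open>For d = 0 the form at s = 1 is affine in t; this t would make it equal to
      -1.\<close>
    then have "2 * (- (a + 1) / (2 * b)) * b = - (a + 1)" by simp
    then show False using t[of "- (a + 1) / (2 * b)"] by linarith
  qed
  then show ?thesis using assms by simp
next
  case False
  then have "d > 0" using assms by linarith
  \<comment> \<open>The form at s = d, t = -b.\<close>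
  have "0 \<le> d * (a * d - b\<^sup>2)"
    using *[of d "- b"] by (simp add: power2_eq_square algebra_simps)
  then show ?thesis using \<open>d > 0\<close> by (simp add: zero_le_mult_iff)
qed

lemma normL2_Cauchy_Schwarz:
  assumes "f \<in> L2" "g \<in> L2"
  shows "\<bar>\<integral>x. f x * g x \<partial>I01\<bar> \<le> normL2 f * normL2 g"
proof -
  let ?a = "\<integral>x. (f x)\<^sup>2 \<partial>I01" and ?b = "\<integral>x. f x * g x \<partial>I01" and ?d = "\<integral>x. (g x)\<^sup>2 \<partial>I01"
  have *: "0 \<le> s\<^sup>2 * ?a + 2 * s * t * ?b + t\<^sup>2 * ?d" for s t
  proof -
    have "0 \<le> (\<integral>x. (s * f x + t * g x)\<^sup>2 \<partial>I01)" by simp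
    also have "\<dots> = (\<integral>x. s\<^sup>2 * (f x)\<^sup>2 + (2 * s * t) * (f x * g x) + t\<^sup>2 * (g x)\<^sup>2 \<partial>I01)"
      by (intro Bochner_Integration.integral_cong) (auto simp: power2_eq_square algebra_simps)
    also have "\<dots> = s\<^sup>2 * ?a + 2 * s * t * ?b + t\<^sup>2 * ?d"
      using assms L2_mult_integrable[OF assms] by (auto simp: L2_def)
    finally show ?thesis .
  qed
  have "?a \<ge> 0" "?d \<ge> 0" by simp_all
  then have "?b\<^sup>2 \<le> ?a * ?d" using * by (rule discriminant_bound)
  then have "sqrt (?b\<^sup>2) \<le> sqrt (?a * ?d)" by (rule real_sqrt_le_mono)
  then show ?thesis by (simp add: normL2_def real_sqrt_mult)
qed

lemma normL2_triangle:
  assumes "f \<in> L2" "g \<in> L2"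
  shows "normL2 (\<lambda>x. f x + g x) \<le> normL2 f + normL2 g"
proof (rule power2_le_imp_le)
  have "(normL2 (\<lambda>x. f x + g x))\<^sup>2 = (\<integral>x. (f x)\<^sup>2 + 2 * (f x * g x) + (g x)\<^sup>2 \<partial>I01)"
    unfolding normL2_power2 by (intro Bochner_Integration.integral_cong) (auto simp: power2_eq_square algebra_simps)
  also have "\<dots> = (normL2 f)\<^sup>2 + 2 * (\<integral>x. f x * g x \<partial>I01) + (normL2 g)\<^sup>2"
    unfolding normL2_power2 using assms L2_mult_integrable[OF assms] by (auto simp: L2_def)
  also have "\<dots> \<le> (normL2 f + normL2 g)\<^sup>2"
    using normL2_Cauchy_Schwarz[OF assms] by (auto simp: power2_sum)
  finally show "(normL2 (\<lambda>x. f x + g x))\<^sup>2 \<le> (normL2 f + normL2 g)\<^sup>2" .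
qed simp

lemma integral_le_normL2:
  assumes "f \<in> L2"
  shows "\<bar>\<integral>x. f x \<partial>I01\<bar> \<le> normL2 f"
proof -
  have "normL2 (\<lambda>x. 1) = 1"
    by (simp add: normL2_def measure_restrict_space)
  then show ?thesis
    using normL2_Cauchy_Schwarz[OF assms L2_const[of 1]] by simp
qed

lemma normL2_bounded_mult:
  assumes "f \<in> L2" "w \<in> borel_measurable I01" "\<And>x. x \<in> {0..1} \<Longrightarrow> \<bar>w x\<bar> \<le> C"
  shows "normL2 (\<lambda>x. w x * f x) \<le> C * normL2 f"
proof -
  have "0 \<le> C" using assms(3)[of 0] by simp
  have "(\<integral>x. (w x * f x)\<^sup>2 \<partial>I01) \<le> (\<integral>x. C\<^sup>2 * (f x)\<^sup>2 \<partial>I01)"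
  proof (rule integral_mono)
    show "integrable I01 (\<lambda>x. (w x * f x)\<^sup>2)" using L2_bounded_mult[OF assms] by (simp add: L2_def)
    show "integrable I01 (\<lambda>x. C\<^sup>2 * (f x)\<^sup>2)" using assms by (simp add: L2_def)
    show "(w x * f x)\<^sup>2 \<le> C\<^sup>2 * (f x)\<^sup>2" if "x \<in> space I01" for x
      using power_mono[OF assms(3), of x 2] that by (simp add: power_mult_distrib mult_right_mono)
  qed
  then have "normL2 (\<lambda>x. w x * f x) \<le> sqrt (C\<^sup>2 * (\<integral>x. (f x)\<^sup>2 \<partial>I01))"
    by (simp add: normL2_def)
  then show ?thesis using \<open>0 \<le> C\<close> by (simp add: normL2_def real_sqrt_mult)
qed

section \<open>Sobolev functions on the unit interval as indefinite integrals\<close>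

section \<open>Absolutely continuous functions on the unit interval\<close>

text \<open>An integral over all of [0,1] with an indicator factor, rather than over a varying
  interval: linearity, Fubini and norm estimates then apply without changing the measure space.
  \<open>prim_eq_integral\<close> gives back the usual form.\<close>

definition prim :: "(real \<Rightarrow> real) \<Rightarrow> real \<Rightarrow> real" where
  "prim f x = (\<integral>y. indicator {0..x} y * f y \<partial>I01)"

lemma indicator_integrable_I01:
  assumes "integrable I01 f" "A \<in> sets borel"
  shows "integrable I01 (\<lambda>y. indicator A y * f y :: real)"
proof (rule Bochner_Integration.integrable_bound[OF assms(1)])
  have "(indicator A :: real \<Rightarrow> real) \<in> borel_measurable I01"
    using assms(2) by (intro borel_measurable_I01) simp
  then show "(\<lambda>y. indicator A y * f y) \<in> borel_measurable I01" using assms(1) by simp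
qed (auto simp: indicator_def)

lemma prim_eq_integral:
  assumes "integrable I01 f" "x \<in> {0..1}"
  shows "prim f x = integral {0..x} f"
proof -
  have "prim f x = integral {0..1} (\<lambda>y. indicator {0..x} y * f y)"
    unfolding prim_def by (rule integral_I01_HK[OF indicator_integrable_I01[OF assms(1)]]) simp
  also have "\<dots> = integral {0..1} (\<lambda>y. if y \<in> {0..x} then f y else 0)"
    by (rule Henstock_Kurzweil_Integration.integral_cong) simp
  also have "\<dots> = integral {0..x} f"
    using Henstock_Kurzweil_Integration.integral_restrict_Int[of "{0..1}" "{0..x}" f] assms(2)
    by (simp add: Int_absorb2)
  finally show ?thesis .
qed

lemma prim_0 [simp]: "integrable I01 f \<Longrightarrow> prim f 0 = 0"
  by (simp add: prim_eq_integral)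

lemma prim_1 [simp]: "prim f 1 = (\<integral>y. f y \<partial>I01)"
  unfolding prim_def by (intro Bochner_Integration.integral_cong) auto

lemma prim_add: "integrable I01 f \<Longrightarrow> integrable I01 g \<Longrightarrow> prim (\<lambda>x. f x + g x) x = prim f x + prim g x"
  unfolding prim_def using indicator_integrable_I01[of f "{0..x}"] indicator_integrable_I01[of g "{0..x}"]
  by (simp add: distrib_left)

lemma prim_scale: "prim (\<lambda>x. r * f x) x = r * prim f x"
  unfolding prim_def by (simp add: mult.left_commute)

lemma prim_diff: "integrable I01 f \<Longrightarrow> integrable I01 g \<Longrightarrow> prim (\<lambda>x. f x - g x) x = prim f x - prim g x"
  using prim_add[of f "\<lambda>x. (-1) * g x" x] prim_scale[of "-1" g x] by simp

lemma prim_cong: "(\<And>y. y \<in> {0..1} \<Longrightarrow> f y = g y) \<Longrightarrow> prim f x = prim g x"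
  unfolding prim_def by (rule Bochner_Integration.integral_cong) auto

lemma prim_cong_AE:
  assumes "f \<in> borel_measurable I01" "AE x in I01. f x = g x"
  shows "prim f x = prim g x"
proof -
  have m: "(indicator {0..x} :: real \<Rightarrow> real) \<in> borel_measurable I01"
    by (intro borel_measurable_I01) simp
  have "g \<in> borel_measurable I01" using measurable_I01_AE_cong assms by blast
  then show ?thesis unfolding prim_def using assms m
    by (intro integral_cong_AE) auto
qed

lemma continuous_on_prim:
  assumes "integrable I01 f"
  shows "continuous_on {0..1} (prim f)"
proof -
  have "f integrable_on {0..1}" using integrable_on_lebesgue_on[OF assms] by simp
  then have "continuous_on {0..1} (\<lambda>x. integral {0..x} f)"
    by (rule indefinite_integral_continuous_1)
  then show ?thesis
    by (rule continuous_on_eq) (simp add: prim_eq_integral[OF assms])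
qed

lemma integrable_continuous_mult:
  fixes w f :: "real \<Rightarrow> real"
  assumes "continuous_on {0..1} w" "integrable I01 f"
  shows "integrable I01 (\<lambda>x. w x * f x)"
proof -
  obtain C where C: "\<And>x. x \<in> {0..1} \<Longrightarrow> \<bar>w x\<bar> \<le> C"
    using continuous_on_Icc_bound[OF assms(1)] by blast
  show ?thesis
  proof (rule Bochner_Integration.integrable_bound[of _ "\<lambda>x. C * f x"])
    show "integrable I01 (\<lambda>x. C * f x)" using assms(2) by simp
    show "(\<lambda>x. w x * f x) \<in> borel_measurable I01"
      using borel_measurable_integrable[OF assms(2)] continuous_on_measurable_I01[OF assms(1)] by simp
    show "AE x in I01. norm (w x * f x) \<le> norm (C * f x)"
    proof (rule AE_I2)
      fix x assume "x \<in> space I01"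
      then have "\<bar>w x\<bar> \<le> \<bar>C\<bar>" using C[of x] by simp
      then show "norm (w x * f x) \<le> norm (C * f x)" by (simp add: abs_mult mult_right_mono)
    qed
  qed
qed

text \<open>Fubini on the unit square, split along the diagonal.\<close>

lemma prim_mult_end:
  assumes f: "integrable I01 f" and g: "integrable I01 g"
  shows "(\<integral>y. prim f y * g y + f y * prim g y \<partial>I01) = (\<integral>y. f y \<partial>I01) * (\<integral>y. g y \<partial>I01)"
proof -
  interpret finite_measure I01 by (rule finite_measure_I01)
  interpret pair_sigma_finite I01 I01 ..
  have [measurable]: "f \<in> borel_measurable I01" "g \<in> borel_measurable I01"
    using f g by auto
  have int: "integrable (I01 \<Otimes>\<^sub>M I01) (\<lambda>(x, y). f x * g y)"
    by (intro Fubini_integrable) (use f g in \<open>auto simp: abs_mult\<close>)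
  have int2: "integrable (I01 \<Otimes>\<^sub>M I01) (\<lambda>(x, y). if x \<le> y then f x * g y else 0)"
    by (rule Bochner_Integration.integrable_bound[OF int]) auto
  have int3: "integrable (I01 \<Otimes>\<^sub>M I01) (\<lambda>(x, y). if y < x then f x * g y else 0)"
    by (rule Bochner_Integration.integrable_bound[OF int]) auto
  have A: "(\<integral>x. (if x \<le> y then f x * g y else 0) \<partial>I01) = prim f y * g y" for y
  proof -
    have "(\<integral>x. (if x \<le> y then f x * g y else 0) \<partial>I01) = (\<integral>x. (indicator {0..y} x * f x) * g y \<partial>I01)"
      by (rule Bochner_Integration.integral_cong) auto
    then show ?thesis by (simp add: prim_def)
  qed
  have B: "(\<integral>x. (\<integral>y. (if y < x then f x * g y else 0) \<partial>I01) \<partial>I01) = (\<integral>x. f x * prim g x \<partial>I01)"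
  proof (rule Bochner_Integration.integral_cong)
    fix x
    have "(\<integral>y. (if y < x then f x * g y else 0) \<partial>I01) = (\<integral>y. f x * (indicator {0..x} y * g y) \<partial>I01)"
    proof (rule integral_cong_AE)
      \<comment> \<open>The closed indicator also contains the diagonal point y = x, a null
        set.\<close>
      have "AE y in lebesgue. y \<noteq> x" 
        by (rule AE_not_in[of "{x}", simplified]) (simp add: null_sets_completionI)
      then have "AE y in I01. y \<noteq> x"
        by (subst AE_restrict_space_iff) auto
      moreover have "AE y in I01. y \<in> {0..1}" by (rule AE_I2) simp
      ultimately show "AE y in I01. (if y < x then f x * g y else 0) = f x * (indicator {0..x} y * g y)"
        by eventually_elim auto
      show "(\<lambda>y. f x * (indicator {0..x} y * g y)) \<in> borel_measurable I01"
        using indicator_integrable_I01[OF g, of "{0..x}"] by auto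
    qed simp
    then show "(\<integral>y. (if y < x then f x * g y else 0) \<partial>I01) = f x * prim g x"
      by (simp add: prim_def)
  qed simp
  have "(\<integral>y. f y \<partial>I01) * (\<integral>y. g y \<partial>I01) = (\<integral>x. (\<integral>y. f x * g y \<partial>I01) \<partial>I01)"
    by simp
  also have "\<dots> = (\<integral>z. (\<lambda>(x, y). f x * g y) z \<partial>(I01 \<Otimes>\<^sub>M I01))"
    by (rule integral_fst[OF int])
  also have "\<dots> = (\<integral>z. (\<lambda>(x, y). if x \<le> y then f x * g y else 0) z
                   + (\<lambda>(x, y). if y < x then f x * g y else 0) z \<partial>(I01 \<Otimes>\<^sub>M I01))"
    by (intro Bochner_Integration.integral_cong) auto
  also have "\<dots> = (\<integral>z. (\<lambda>(x, y). if x \<le> y then f x * g y else 0) z \<partial>(I01 \<Otimes>\<^sub>M I01))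
                   + (\<integral>z. (\<lambda>(x, y). if y < x then f x * g y else 0) z \<partial>(I01 \<Otimes>\<^sub>M I01))"
    by (rule Bochner_Integration.integral_add[OF int2 int3])
  also have "\<dots> = (\<integral>y. prim f y * g y \<partial>I01) + (\<integral>x. f x * prim g x \<partial>I01)"
    using integral_snd[OF int2] integral_fst[OF int3] A B by simp
  also have "\<dots> = (\<integral>y. prim f y * g y + f y * prim g y \<partial>I01)"
  proof (rule Bochner_Integration.integral_add[symmetric])
    show "integrable I01 (\<lambda>y. prim f y * g y)"
      using integrable_snd[OF int2] by (simp add: A)
    have "integrable I01 (\<lambda>y. prim g y * f y)"
      by (rule integrable_continuous_mult[OF continuous_on_prim[OF g] f])
    then show "integrable I01 (\<lambda>y. f y * prim g y)" by (simp add: mult.commute)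
  qed
  finally show ?thesis by simp
qed

text \<open>Integrals of f over subintervals are differences of \<open>prim f\<close>, hence vanish.
  Induction over the Borel sets extends this to all of them, and Lebesgue sets differ from Borel
  sets by null sets. A density whose integrals all vanish is zero almost everywhere.\<close>

lemma prim_zero_AE:
  assumes f: "integrable I01 f" and 0: "\<And>x. x \<in> {0..1} \<Longrightarrow> prim f x = 0"
  shows "AE x in I01. f x = 0"
proof -
  have [measurable]: "f \<in> borel_measurable I01" using f by auto
  have borel: "(\<integral>y. indicator A y * f y \<partial>I01) = 0" if "A \<in> sets borel" for A
    using that
  proof (induction rule: borel_set_induct)
    case empty
    show ?case by simp
  next
    case (interval a b)
    have split: "(\<integral>y. indicator {a..b} y * f y \<partial>I01) = 0" if ab: "0 \<le> a" "a \<le> b" "b \<le> 1" for a b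
    proof -
      have ind: "integrable I01 (\<lambda>y. indicator {a..b} y * f y)"
        by (rule indicator_integrable_I01[OF f]) simp
      have "(\<integral>y. indicator {a..b} y * f y \<partial>I01) = integral {0..1} (\<lambda>y. indicator {a..b} y * f y)"
        by (rule integral_I01_HK[OF ind])
      also have "\<dots> = integral {0..1} (\<lambda>y. if y \<in> {a..b} then f y else 0)"
        by (rule Henstock_Kurzweil_Integration.integral_cong) simp
      also have "\<dots> = integral {a..b} f"
        using Henstock_Kurzweil_Integration.integral_restrict_Int[of "{0..1}" "{a..b}" f] ab
        by (simp add: Int_absorb2)
      also have "\<dots> = integral {0..b} f - integral {0..a} f"
      proof -
        have "f integrable_on {0..1}" using integrable_on_lebesgue_on[OF f] by simp
        then have "f integrable_on {0..b}" by (rule integrable_on_subinterval) (use ab in auto)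
        from Henstock_Kurzweil_Integration.integral_combine[OF ab(1,2) this] show ?thesis by simp
      qed
      also have "\<dots> = 0"
        using 0[of a] 0[of b] ab by (simp add: prim_eq_integral[OF f])
      finally show ?thesis .
    qed
    show ?case
    proof (cases "max a 0 \<le> min b 1")
      case True
      have "(\<integral>y. indicator {a..b} y * f y \<partial>I01) = (\<integral>y. indicator {max a 0..min b 1} y * f y \<partial>I01)"
        by (rule Bochner_Integration.integral_cong) (auto simp: indicator_def)
      then show ?thesis using split[OF _ True] by simp
    next
      case False
      then have "(\<integral>y. indicator {a..b} y * f y \<partial>I01) = (\<integral>y. 0 \<partial>I01)"
        using interval by (intro Bochner_Integration.integral_cong) (auto simp: indicator_def)
      then show ?thesis by simp
    qed
  next
    case (compl A)
    have "(\<integral>y. indicator (-A) y * f y \<partial>I01) = (\<integral>y. f y - indicator A y * f y \<partial>I01)"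
      by (rule Bochner_Integration.integral_cong) (auto simp: indicator_def)
    also have "\<dots> = (\<integral>y. f y \<partial>I01) - (\<integral>y. indicator A y * f y \<partial>I01)"
      using f indicator_integrable_I01[OF f compl(1)] by simp
    finally show ?case using compl 0[of 1] by simp
  next
    case (union F)
    \<comment> \<open>The members of the disjoint family are cut down to [0,1], because measurable
      sets of \<open>I01\<close> are subsets of it.\<close>
    have eq: "(\<integral>y. indicator (A \<inter> {0..1}) y * f y \<partial>I01) = (\<integral>y. indicator A y * f y \<partial>I01)" for A
      by (rule Bochner_Integration.integral_cong) (auto simp: indicator_def)
    have "(LINT y:(\<Union>i. F i \<inter> {0..1})|I01. f y) = (\<Sum>i. (LINT y:F i \<inter> {0..1}|I01. f y))"
    proof (rule lebesgue_integral_countable_add)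
      show "F i \<inter> {0..1} \<in> sets I01" for i
        using union(2)[of i] by (subst sets_restrict_space_iff) auto
      show "F i \<inter> {0..1} \<inter> (F j \<inter> {0..1}) = {}" if "i \<noteq> j" for i j
        using union(1) that by (auto simp: disjoint_family_on_def)
      have "(\<Union>i. F i \<inter> {0..1}) \<in> sets borel" using union(2) by (intro sets.countable_UN) auto
      then show "set_integrable I01 (\<Union>i. F i \<inter> {0..1}) f"
        unfolding set_integrable_def using indicator_integrable_I01[OF f] by simp
    qed
    moreover have "(\<Union>i. F i \<inter> {0..1}) = (\<Union>i. F i) \<inter> {0..1}" by auto
    ultimately show ?case using union(3) by (simp add: set_lebesgue_integral_def eq)
  qed
  show ?thesis
  proof (rule density_unique_real[OF f])
    show "integrable I01 (\<lambda>x. 0 :: real)" by simp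
    fix A assume A: "A \<in> sets I01"
    then have "A \<in> sets lebesgue" by (subst (asm) sets_restrict_space_iff) auto
    then obtain C T where CT: "fsigma C" "T \<in> null_sets lebesgue" "C \<union> T = A"
      by (rule lebesgue_set_almost_fsigma)
    have C: "C \<in> sets borel" 
      using CT(1)
    proof cases
      case (1 F)
      then show ?thesis by (metis UNIV_I borel_closed sets.countable_UN image_subset_iff)
    qed
    have "AE y in lebesgue. y \<notin> T" using CT(2) by (rule AE_not_in)
    then have "AE y in I01. y \<notin> T" by (subst AE_restrict_space_iff) auto
    then have ae: "AE y in I01. indicator C y * f y = indicator A y * f y"
    proof eventually_elim
      fix y assume "y \<notin> T"
      then have "y \<in> C \<longleftrightarrow> y \<in> A" using CT(3) by blast
      then show "indicator C y * f y = indicator A y * f y" by (simp add: indicator_def)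
    qed
    moreover have m: "(\<lambda>y. indicator C y * f y) \<in> borel_measurable I01"
      using indicator_integrable_I01[OF f C] by auto
    ultimately have "(\<integral>y. indicator C y * f y \<partial>I01) = (\<integral>y. indicator A y * f y \<partial>I01)"
      by (intro integral_cong_AE ae measurable_I01_AE_cong[OF m ae])
    then show "(LINT x:A|I01. f x) = (LINT x:A|I01. 0)"
      using borel[OF C] by (simp add: set_lebesgue_integral_def)
  qed
qed

text \<open>Absolute continuity on [0,1] with the density carried along, in the form of the
  fundamental theorem of calculus. F matters only on [0,1] and f only up to null sets, which is the
  indeterminacy of a weak derivative.\<close>

definition AC :: "(real \<Rightarrow> real) \<Rightarrow> (real \<Rightarrow> real) \<Rightarrow> bool" where
  "AC F f \<longleftrightarrow> integrable I01 f \<and> (\<forall>x\<in>{0..1}. F x = F 0 + prim f x)"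

lemma AC_integrable: "AC F f \<Longrightarrow> integrable I01 f"
  by (simp add: AC_def)

lemma AC_eq: "AC F f \<Longrightarrow> x \<in> {0..1} \<Longrightarrow> F x = F 0 + prim f x"
  unfolding AC_def by blast

lemma ACI: "integrable I01 f \<Longrightarrow> (\<And>x. x \<in> {0..1} \<Longrightarrow> F x = F 0 + prim f x) \<Longrightarrow> AC F f"
  unfolding AC_def by blast

lemma AC_continuous_on:
  assumes "AC F f"
  shows "continuous_on {0..1} F"
  by (rule continuous_on_eq[of _ "\<lambda>x. F 0 + prim f x", OF _ AC_eq[OF assms, symmetric]])
    (use AC_integrable[OF assms] in \<open>auto intro!: continuous_intros continuous_on_prim\<close>)

lemma AC_L2: "AC F f \<Longrightarrow> F \<in> L2"
  by (intro L2_continuous AC_continuous_on)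

lemma AC_integral: "AC F f \<Longrightarrow> (\<integral>x. f x \<partial>I01) = F 1 - F 0"
  using AC_eq[of F f 1] by simp

lemma AC_prim: "integrable I01 f \<Longrightarrow> AC (\<lambda>x. k + prim f x) f"
  by (rule ACI) auto

lemma AC_add:
  assumes "AC F f" "AC G g"
  shows "AC (\<lambda>x. F x + G x) (\<lambda>x. f x + g x)"
proof (rule ACI)
  show "F x + G x = F 0 + G 0 + prim (\<lambda>x. f x + g x) x" if "x \<in> {0..1}" for x
    using AC_eq[OF assms(1) that] AC_eq[OF assms(2) that] assms[THEN AC_integrable]
    by (simp add: prim_add)
qed (use assms[THEN AC_integrable] in auto)

lemma AC_scale:
  assumes "AC F f"
  shows "AC (\<lambda>x. r * F x) (\<lambda>x. r * f x)"
proof (rule ACI)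
  show "r * F x = r * F 0 + prim (\<lambda>x. r * f x) x" if "x \<in> {0..1}" for x
    using AC_eq[OF assms that] by (simp add: prim_scale algebra_simps)
qed (use assms[THEN AC_integrable] in auto)

lemma AC_diff: "AC F f \<Longrightarrow> AC G g \<Longrightarrow> AC (\<lambda>x. F x - G x) (\<lambda>x. f x - g x)"
  using AC_add[of F f "\<lambda>x. (-1) * G x" "\<lambda>x. (-1) * g x"] AC_scale[of G g "-1"] by simp

lemma AC_const: "AC (\<lambda>x. k) (\<lambda>x. 0)"
  by (rule ACI) (simp_all add: prim_def)

lemma AC_cong:
  assumes "AC F f" "\<And>x. x \<in> {0..1} \<Longrightarrow> F x = G x" "AE x in I01. f x = g x"
  shows "AC G g"
proof -
  have f: "integrable I01 f" using assms(1) by (rule AC_integrable)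
  have g: "g \<in> borel_measurable I01"
    by (rule measurable_I01_AE_cong[OF borel_measurable_integrable[OF f] assms(3)])
  have "integrable I01 g"
    by (rule integrable_cong_AE_imp[OF f g assms(3)])
  then show ?thesis
  proof (rule ACI)
    fix x :: real assume x: "x \<in> {0..1}"
    have "prim f x = prim g x"
      by (rule prim_cong_AE[OF borel_measurable_integrable[OF f] assms(3)])
    moreover note AC_eq[OF assms(1) x] assms(2)[OF x] assms(2)[of 0]
    ultimately show "G x = G 0 + prim g x" by simp
  qed
qed

text \<open>Finitely many exceptional points are allowed for the sake of the travelling waves, whose
  derivatives may jump at integers. Boundedness and measurability make f Lebesgue integrable, so
  that the gauge integral of the fundamental theorem equals \<open>prim f\<close>.\<close>

lemma AC_bounded_derivative:
  assumes "finite S" "continuous_on {0..1} F"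
    and der: "\<And>x. x \<in> {0<..<1} - S \<Longrightarrow> (F has_real_derivative f x) (at x)"
    and "f \<in> borel_measurable I01" "\<And>x. x \<in> {0..1} \<Longrightarrow> \<bar>f x\<bar> \<le> C"
  shows "AC F f"
proof -
  have f: "integrable I01 f" by (rule integrable_I01_bounded) fact+
  have "F x = F 0 + prim f x" if x: "x \<in> {0..1}" for x
  proof -
    have "(f has_integral (F x - F 0)) {0..x}"
    proof (rule fundamental_theorem_of_calculus_interior_strong[OF assms(1)])
      show "continuous_on {0..x} F" by (rule continuous_on_subset[OF assms(2)]) (use x in auto)
    qed (use x der in \<open>auto simp flip: has_real_derivative_iff_has_vector_derivative\<close>)
    then show ?thesis using prim_eq_integral[OF f x] by (simp add: integral_unique)
  qed
  with f show ?thesis by (intro ACI)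
qed

lemma AC_C1:
  assumes "\<And>x. (F has_real_derivative f x) (at x)" "continuous_on {0..1} f"
  shows "AC F f"
proof -
  obtain C where C: "\<And>x. x \<in> {0..1} \<Longrightarrow> \<bar>f x\<bar> \<le> C"
    using continuous_on_Icc_bound[OF assms(2)] by blast
  show ?thesis
  proof (rule AC_bounded_derivative[where S="{}" and C=C])
    show "continuous_on {0..1} F"
      by (rule DERIV_continuous_on) (use assms(1) in \<open>auto intro: has_field_derivative_at_within\<close>)
  qed (use assms C continuous_on_measurable_I01 in auto)
qed

text \<open>Truncating f and g beyond x leaves their primitives up to x unchanged and reduces the
  claim to the endpoint case \<open>prim_mult_end\<close>.\<close>

lemma prim_mult:
  assumes f: "integrable I01 f" and g: "integrable I01 g" and x: "x \<in> {0..1}"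
  shows "prim (\<lambda>y. prim f y * g y + f y * prim g y) x = prim f x * prim g x"
proof -
  let ?c = "\<lambda>f y. indicator {0..x} y * f y :: real"
  have p: "prim (?c f) y = prim f y" if "y \<le> x" for y and f :: "real \<Rightarrow> real"
    unfolding prim_def by (rule Bochner_Integration.integral_cong) (use that in \<open>auto simp: indicator_def\<close>)
  have "prim f x * prim g x = (\<integral>y. ?c f y \<partial>I01) * (\<integral>y. ?c g y \<partial>I01)"
    by (simp add: prim_def)
  also have "\<dots> = (\<integral>y. prim (?c f) y * ?c g y + ?c f y * prim (?c g) y \<partial>I01)"
    by (rule prim_mult_end[symmetric]) (intro indicator_integrable_I01 f g; simp)+
  also have "\<dots> = (\<integral>y. indicator {0..x} y * (prim f y * g y + f y * prim g y) \<partial>I01)"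
  proof (rule Bochner_Integration.integral_cong)
    show "prim (?c f) y * ?c g y + ?c f y * prim (?c g) y =
        indicator {0..x} y * (prim f y * g y + f y * prim g y)" for y
      by (cases "y \<in> {0..x}") (simp_all add: p[of y])
  qed simp
  finally show ?thesis by (simp add: prim_def)
qed

lemma AC_mult:
  assumes "AC F f" "AC G g"
  shows "AC (\<lambda>x. F x * G x) (\<lambda>x. F x * g x + f x * G x)"
proof -
  have f: "integrable I01 f" and g: "integrable I01 g"
    using assms by (auto dest: AC_integrable)
  have Fg: "integrable I01 (\<lambda>x. F x * g x)" and Gf: "integrable I01 (\<lambda>x. f x * G x)"
    using integrable_continuous_mult[OF AC_continuous_on[OF assms(1)] g]
      integrable_continuous_mult[OF AC_continuous_on[OF assms(2)] f] by (auto simp: mult.commute)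
  have pg: "integrable I01 (\<lambda>x. prim f x * g x)" "integrable I01 (\<lambda>x. f x * prim g x)"
    using integrable_continuous_mult[OF continuous_on_prim[OF f] g]
      integrable_continuous_mult[OF continuous_on_prim[OF g] f] by (auto simp: mult.commute)
  have "F x * G x = F 0 * G 0 + prim (\<lambda>x. F x * g x + f x * G x) x" if x: "x \<in> {0..1}" for x
  proof -
    have eq: "F x = F 0 + prim f x" "G x = G 0 + prim g x" if "x \<in> {0..1}" for x
      using AC_eq[OF assms(1) that] AC_eq[OF assms(2) that] .
    have "prim (\<lambda>y. F y * g y + f y * G y) x
        = prim (\<lambda>y. (F 0 * g y + G 0 * f y) + (prim f y * g y + f y * prim g y)) x"
    proof (rule prim_cong)
      have *: "a = a0 + p \<Longrightarrow> b = b0 + q \<Longrightarrow> a * s + r * b = (a0 * s + b0 * r) + (p * s + r * q)"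
        for a b a0 b0 p q r s :: real by (simp add: algebra_simps)
      show "F y * g y + f y * G y = (F 0 * g y + G 0 * f y) + (prim f y * g y + f y * prim g y)"
        if "y \<in> {0..1}" for y
        by (rule *) (rule eq[OF that])+
    qed
    also have "\<dots> = F 0 * prim g x + G 0 * prim f x + prim f x * prim g x"
      using f g pg prim_mult[OF f g x] by (simp add: prim_add prim_scale)
    finally show ?thesis using eq[OF x] by (simp add: algebra_simps)
  qed
  with Bochner_Integration.integrable_add[OF Fg Gf] show ?thesis by (rule ACI)
qed

section \<open>Reflection\<close>

lemma reflect_I01:
  fixes f :: "real \<Rightarrow> real"
  assumes "integrable I01 f"
  shows "integrable I01 (\<lambda>x. f (1 - x))" and "(\<integral>x. f (1 - x) \<partial>I01) = (\<integral>x. f x \<partial>I01)"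
proof -
  let ?f = "\<lambda>x. indicator {0..1} x *\<^sub>R f x"
  have f: "integrable lebesgue ?f"
    using assms by (subst (asm) integrable_restrict_space) auto
  have eq: "?f (1 + (-1) * x) = indicator {0..1} x *\<^sub>R f (1 - x)" for x
    by (auto simp: indicator_def)
  show "integrable I01 (\<lambda>x. f (1 - x))"
    using lebesgue_integrable_real_affine[OF f, of "-1" 1] unfolding eq
    by (subst integrable_restrict_space) simp_all
  show "(\<integral>x. f (1 - x) \<partial>I01) = (\<integral>x. f x \<partial>I01)"
    using lebesgue_integral_real_affine[of "-1" ?f 1] unfolding eq
    by (subst (1 2) integral_restrict_space) simp_all
qed

lemma reflect_L2:
  assumes "f \<in> L2"
  shows "(\<lambda>x. f (1 - x)) \<in> L2" "normL2 (\<lambda>x. f (1 - x)) = normL2 f"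
proof -
  have i: "integrable I01 (\<lambda>x. (f x)\<^sup>2)" using assms by (simp add: L2_def)
  show "(\<lambda>x. f (1 - x)) \<in> L2"
    using borel_measurable_integrable[OF reflect_I01(1)[OF L2_integrable[OF assms]]] reflect_I01(1)[OF i]
    by (simp add: L2_def)
  show "normL2 (\<lambda>x. f (1 - x)) = normL2 f"
    unfolding normL2_def reflect_I01(2)[OF i] ..
qed

lemma AC_reflect:
  assumes "AC F f"
  shows "AC (\<lambda>x. F (1 - x)) (\<lambda>x. - f (1 - x))"
proof -
  have f: "integrable I01 f" using assms by (rule AC_integrable)
  have "F (1 - x) = F 1 + prim (\<lambda>x. - f (1 - x)) x" if x: "x \<in> {0..1}" for x
  proof -
    have "prim (\<lambda>x. f (1 - x)) x = (\<integral>y. indicator {1-x..1} (1 - y) * f (1 - y) \<partial>I01)"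
      unfolding prim_def by (rule Bochner_Integration.integral_cong) (auto simp: indicator_def)
    also have "\<dots> = (\<integral>y. indicator {1-x..1} y * f y \<partial>I01)"
      by (rule reflect_I01(2)[of "\<lambda>y. indicator {1-x..1} y * f y"]) (intro indicator_integrable_I01 f; simp)
    also have "\<dots> = (\<integral>y. f y - indicator {0..1-x} y * f y \<partial>I01)"
    proof (rule integral_cong_AE)
      have "AE y in lebesgue. y \<noteq> 1 - x" 
        by (rule AE_not_in[of "{1 - x}", simplified]) (simp add: null_sets_completionI)
      then have "AE y in I01. y \<noteq> 1 - x"
        by (subst AE_restrict_space_iff) auto
      then show "AE y in I01. indicator {1-x..1} y * f y = f y - indicator {0..1-x} y * f y"
        using AE_I01_interval by eventually_elim (auto simp: indicator_def)
      show "(\<lambda>y. indicator {1-x..1} y * f y) \<in> borel_measurable I01"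
        using indicator_integrable_I01[OF f, of "{1-x..1}"] by auto
      show "(\<lambda>y. f y - indicator {0..1-x} y * f y) \<in> borel_measurable I01"
        using indicator_integrable_I01[OF f, of "{0..1-x}"] f by auto
    qed
    also have "\<dots> = prim f 1 - prim f (1 - x)"
      using f indicator_integrable_I01[OF f, of "{0..1-x}"] by (simp add: prim_def[of f "1-x"])
    finally have "prim (\<lambda>x. f (1 - x)) x = F 1 - F (1 - x)"
      using AC_eq[OF assms, of 1] AC_eq[OF assms, of "1 - x"] x by simp
    then show ?thesis using prim_scale[of "-1" "\<lambda>x. f (1 - x)" x] by simp
  qed
  then show ?thesis using reflect_I01(1)[OF f] by (intro ACI) simp_all
qed

section \<open>Weak derivatives\<close>

text \<open>The squared difference is continuous, nonnegative and has zero integral.\<close>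

lemma continuous_AE_eq:
  fixes F G :: "real \<Rightarrow> real"
  assumes "continuous_on {0..1} F" "continuous_on {0..1} G" "AE x in I01. F x = G x"
    and x: "x \<in> {0..1}"
  shows "F x = G x"
proof -
  let ?k = "\<lambda>x. (F x - G x)\<^sup>2"
  have c: "continuous_on {0..1} ?k" using assms by (intro continuous_intros)
  have "(\<integral>x. ?k x \<partial>I01) = (\<integral>x. 0 \<partial>I01)"
    by (rule integral_cong_AE) (use assms continuous_on_measurable_I01[OF c] in auto)
  then have "integral {0..1} ?k = 0"
    using integral_I01_HK[OF continuous_on_integrable_I01[OF c]] by simp
  then have "?k x = 0"
    using integral_eq_0_iff[of 0 1 ?k] c x by auto
  then show ?thesis by simp
qed

lemma antiderivative_UNIV:
  fixes g :: "real \<Rightarrow> 'a::euclidean_space"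
  assumes "continuous_on UNIV g"
  obtains G where "G 0 = 0" "\<And>x. (G has_vector_derivative g x) (at x)"
proof -
  obtain F where F: "\<And>x. (F has_vector_derivative g x) (at x)"
    using einterval_antiderivative[of "-\<infinity>" "\<infinity>" g] assms
    by (auto simp: continuous_on_eq_continuous_at)
  show ?thesis
    by (rule that[of "\<lambda>x. F x - F 0"]) (auto intro!: derivative_eq_intros F)
qed

text \<open>An antiderivative is constant on either side of {a..b}. The vanishing integral makes the
  two constants equal, so subtracting \<open>G a\<close> produces compact support.\<close>

lemma test_function_antiderivative:
  fixes \<psi> :: "real \<Rightarrow> real"
  assumes cont: "continuous_on UNIV \<psi>" and ab: "0 < a" "a \<le> b" "b < 1"
    and supp: "\<And>x. x \<notin> {a..b} \<Longrightarrow> \<psi> x = 0" and int: "(\<integral>x. \<psi> x \<partial>I01) = 0"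
  obtains \<phi> where "test_function \<phi> \<psi>"
proof -
  obtain G where G: "\<And>x. (G has_real_derivative \<psi> x) (at x)"
    using antiderivative_UNIV[OF cont] by (auto simp: has_real_derivative_iff_has_vector_derivative)
  have const: "G y = G x" if "x \<le> y" "\<And>z. x < z \<Longrightarrow> z < y \<Longrightarrow> z \<notin> {a..b}" for x y
  proof (cases "x = y")
    case False
    show ?thesis
    proof (rule DERIV_isconst_end[of x y G])
      show "continuous_on {x..y} G"
        using G by (intro DERIV_continuous_on) (auto intro: has_field_derivative_at_within)
      show "(G has_real_derivative 0) (at z)" if "x < z" "z < y" for z
        using G[of z] supp \<open>\<And>z. x < z \<Longrightarrow> z < y \<Longrightarrow> z \<notin> {a..b}\<close>[OF that] by simp
    qed (use that False in auto)
  qed simp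
  have lo: "G x = G a" if "x \<le> a" for x
    using const[of x a] that by simp
  have hi: "G x = G b" if "b \<le> x" for x
    using const[of b x] that by simp
  have "AC G \<psi>"
    by (rule AC_C1[OF G continuous_on_subset[OF cont]]) simp
  then have "G 1 = G 0" using AC_integral int by force
  then have "G b = G a" using lo[of 0] hi[of 1] ab by simp
  then have "test_function (\<lambda>x. G x - G a) \<psi>"
    unfolding test_function_def
  proof (intro conjI allI)
    show "((\<lambda>x. G x - G a) has_real_derivative \<psi> x) (at x)" for x
      by (auto intro!: derivative_eq_intros G)
    have "G x - G a = 0" if "x \<notin> {a..b}" for x
    proof (cases "x < a")
      case True
      then show ?thesis using lo[of x] by simp
    next
      case False
      then show ?thesis using hi[of x] that \<open>G b = G a\<close> by simp
    qed
    then have "\<forall>x. x \<notin> {a..b} \<longrightarrow> G x - G a = 0" by blast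
    with ab show "\<exists>c d. 0 < c \<and> c \<le> d \<and> d < 1 \<and> (\<forall>x. x \<notin> {c..d} \<longrightarrow> G x - G a = 0)"
      by blast
  qed (rule cont)
  then show ?thesis by (rule that)
qed

lemma prim_increment:
  assumes "integrable I01 f" "0 \<le> a" "a \<le> b"
  shows "prim f b - prim f a = (\<integral>x. indicator {a<..b} x * f x \<partial>I01)"
proof -
  have "prim f b - prim f a = (\<integral>x. indicator {0..b} x * f x - indicator {0..a} x * f x \<partial>I01)"
    unfolding prim_def using indicator_integrable_I01[OF assms(1)] by simp
  also have "\<dots> = (\<integral>x. indicator {a<..b} x * f x \<partial>I01)"
    by (rule Bochner_Integration.integral_cong) (use assms in \<open>auto simp: indicator_def\<close>)
  finally show ?thesis .
qed

text \<open>A continuous \<psi> supported in (0,1) becomes the derivative of a test function once a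
  multiple of a fixed bump is subtracted to make its integral zero. Hence h - m annihilates every
  such \<psi>, and approximating indicators of intervals shows that the primitive of h - m is
  constant.\<close>

lemma du_Bois_Reymond:
  assumes h: "integrable I01 h"
    and test: "\<And>\<phi> \<phi>'. test_function \<phi> \<phi>' \<Longrightarrow> (\<integral>x. h x * \<phi>' x \<partial>I01) = 0"
  obtains m where "AE x in I01. h x = m"
proof -
  \<comment> \<open>The bump is the positive part of a parabola with zeros at 1/8 and 7/8, so it is
    supported inside (0,1).\<close>
  let ?q = "\<lambda>x::real. (x - 1/8) * (7/8 - x)"
  define \<psi>0 where "\<psi>0 x = max 0 (?q x)" for x
  define s where "s = (\<integral>x. \<psi>0 x \<partial>I01)"
  \<comment> \<open>The only possible value of the constant: testing h = m against
    \<open>\<psi>0\<close> gives m times s.\<close>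
  define m where "m = (\<integral>x. h x * \<psi>0 x \<partial>I01) / s"
  have c0: "continuous_on UNIV \<psi>0" unfolding \<psi>0_def by (intro continuous_intros)
  have int: "integrable I01 \<psi>" if "continuous_on UNIV \<psi>" for \<psi> :: "real \<Rightarrow> real"
    by (rule continuous_on_integrable_I01) (rule continuous_on_subset[OF that], simp)
  have inth: "integrable I01 (\<lambda>x. h x * \<psi> x)" if "continuous_on UNIV \<psi>" for \<psi> :: "real \<Rightarrow> real"
    using integrable_continuous_mult[OF continuous_on_subset[OF that] h] by (simp add: mult.commute)
  have "s > 0"
  proof -
    \<comment> \<open>Integrating the parabola itself, negative ends included, gives 1/6 - 7/64 > 0,
      and \<open>\<psi>0\<close> dominates it.\<close>
    have "AC (\<lambda>x. x\<^sup>2 / 2 - x^3 / 3 - (7/64) * x) ?q"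
  
    proof (rule AC_C1)
      show "((\<lambda>x. x\<^sup>2 / 2 - x^3 / 3 - (7/64) * x) has_real_derivative ?q x) (at x)" for x
        by (rule derivative_eq_intros refl | simp)+ (simp add: field_simps power2_eq_square)
    qed (intro continuous_intros)
    then have "(\<integral>x. ?q x \<partial>I01) > 0" by (subst AC_integral) auto
    also have "(\<integral>x. ?q x \<partial>I01) \<le> s"
      unfolding s_def by (rule integral_mono) (auto intro!: int continuous_intros c0 simp: \<psi>0_def)
    finally show ?thesis .
  qed
  have supp0: "\<psi>0 x = 0" if "x \<notin> {1/8..7/8}" for x
    using that by (auto simp: \<psi>0_def max_def zero_le_mult_iff not_le)
  have key: "(\<integral>x. (h x - m) * \<psi> x \<partial>I01) = 0"
    if c: "continuous_on UNIV \<psi>" and ab: "0 < a" "a \<le> b" "b < 1" and supp: "\<And>x. x \<notin> {a..b} \<Longrightarrow> \<psi> x = 0"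
    for \<psi> a b
  proof -
    \<comment> \<open>Makes the integral of \<open>?\<chi>\<close> zero, since
      \<open>\<psi>0\<close> integrates to s.\<close>
    let ?r = "(\<integral>x. \<psi> x \<partial>I01) / s"
    let ?\<chi> = "\<lambda>x. \<psi> x - ?r * \<psi>0 x"
    obtain \<phi> where "test_function \<phi> ?\<chi>"
    proof (rule test_function_antiderivative)
      show "continuous_on UNIV ?\<chi>" by (intro continuous_intros c c0)
      show "0 < min a (1/8)" "min a (1/8) \<le> max b (7/8)" "max b (7/8) < 1" using ab by auto
      show "?\<chi> x = 0" if "x \<notin> {min a (1/8)..max b (7/8)}" for x
      proof -
        have "x \<notin> {a..b}" "x \<notin> {1/8..7/8}" using that ab by (auto simp: min_le_iff_disj le_max_iff_disj)
        then show ?thesis using supp supp0 by simp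
      qed
      show "(\<integral>x. ?\<chi> x \<partial>I01) = 0"
        using int[OF c] int[OF c0] \<open>s > 0\<close> by (simp add: s_def[symmetric])
    qed
    from test[OF this] have "(\<integral>x. h x * \<psi> x - ?r * (h x * \<psi>0 x) \<partial>I01) = 0"
      by (simp add: algebra_simps)
    then have "(\<integral>x. h x * \<psi> x \<partial>I01) = ?r * (\<integral>x. h x * \<psi>0 x \<partial>I01)"
      using inth[OF c] inth[OF c0] by simp
    also have "\<dots> = m * (\<integral>x. \<psi> x \<partial>I01)" using \<open>s > 0\<close> by (simp add: m_def)
    finally have "(\<integral>x. h x * \<psi> x \<partial>I01) - (\<integral>x. m * \<psi> x \<partial>I01) = 0" by simp
    then show ?thesis
      using inth[OF c] int[OF c] by (simp add: left_diff_distrib)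
  qed
  let ?k = "\<lambda>x. h x - m"
  interpret finite_measure I01 by (rule finite_measure_I01)
  have k: "integrable I01 ?k" using h by simp
  have [measurable]: "?k \<in> borel_measurable I01" using k by auto
  have eq: "prim ?k b = prim ?k a" if ab: "0 < a" "a < b" "b < 1" for a b
  proof -
    \<comment> \<open>Leaves room below 1 for the descending ramp on [b, b + 1 / kk n].\<close>
    obtain N where N: "1 / real (Suc N) < 1 - b"
      using reals_Archimedean[of "1 - b"] ab by (auto simp: inverse_eq_divide)
    define kk where "kk n = real (Suc (N + n))" for n
    have kk: "kk n > 0" "b + 1 / kk n < 1" for n
    proof -
      have "1 / kk n \<le> 1 / real (Suc N)" by (auto simp: kk_def intro!: divide_left_mono)
      then show "b + 1 / kk n < 1" using N by linarith
    qed (simp add: kk_def)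
    \<comment> \<open>For large n a trapezoid that rises on [a, a + 1 / kk n] and falls on
      [b, b + 1 / kk n]. The ramps are placed so that the pointwise limit is the indicator of the
      half-open interval in \<open>prim_increment\<close>.\<close>
    define \<psi> where "\<psi> n x = max 0 (min 1 (min (kk n * (x - a)) (1 + kk n * (b - x))))" for n x
    have c: "continuous_on UNIV (\<psi> n)" for n unfolding \<psi>_def by (intro continuous_intros)
    have z: "(\<integral>x. \<psi> n x * ?k x \<partial>I01) = 0" for n
    proof -
      have "(\<integral>x. ?k x * \<psi> n x \<partial>I01) = 0"
      proof (rule key[OF c, of a "b + 1 / kk n"])
        show "\<psi> n x = 0" if "x \<notin> {a..b + 1 / kk n}" for x
        proof (cases "x < a")
          case True
          then have "kk n * (x - a) \<le> 0" using kk(1)[of n] by (simp add: mult_le_0_iff)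
          then show ?thesis by (simp add: \<psi>_def)
        next
          case False
          then have "x > b + 1 / kk n" using that by auto
          then have "kk n * (b - x) \<le> -1" using kk(1)[of n] by (simp add: field_simps)
          then show ?thesis by (simp add: \<psi>_def)
        qed
      qed (use ab kk[of n] in \<open>auto intro: add_increasing2 less_imp_le\<close>)
      then show ?thesis by (simp add: mult.commute)
    qed
    have "(\<lambda>n. \<integral>x. \<psi> n x * ?k x \<partial>I01) \<longlonglongrightarrow> (\<integral>x. indicator {a<..b} x * ?k x \<partial>I01)"
    proof (rule integral_dominated_convergence[where w="\<lambda>x. \<bar>?k x\<bar>"])
      show "(\<lambda>x. indicator {a<..b} x * ?k x) \<in> borel_measurable I01"
        using indicator_integrable_I01[OF k, of "{a<..b}"] by auto
      show "(\<lambda>x. \<psi> n x * ?k x) \<in> borel_measurable I01" for n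
        using inth[OF c] int[OF c, THEN borel_measurable_integrable] by auto
      show "integrable I01 (\<lambda>x. \<bar>?k x\<bar>)" using k by auto
      have "norm (\<psi> n x * ?k x) \<le> \<bar>?k x\<bar>" for n x
      proof -
        have "\<bar>\<psi> n x\<bar> \<le> 1" by (simp add: \<psi>_def)
        then show ?thesis by (simp add: abs_mult mult_left_le_one_le)
      qed
      then show "AE x in I01. norm (\<psi> n x * ?k x) \<le> \<bar>?k x\<bar>" for n by simp
      have kktop: "filterlim kk at_top sequentially"
        by (rule filterlim_at_top_mono[OF filterlim_real_sequentially]) (simp add: kk_def)
      have "(\<lambda>n. \<psi> n x) \<longlonglongrightarrow> indicator {a<..b} x" for x
      proof (cases "x \<in> {a<..b}")
        case True
        have "\<forall>\<^sub>F n in sequentially. kk n \<ge> 1 / (x - a)"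
          using kktop by (simp add: filterlim_at_top)
        then have "\<forall>\<^sub>F n in sequentially. \<psi> n x = 1"
        proof eventually_elim
          case (elim n)
          then have "kk n * (x - a) \<ge> 1" using True by (simp add: field_simps)
          moreover have "kk n * (b - x) \<ge> 0" using True kk(1)[of n] by simp
          ultimately show ?case by (simp add: \<psi>_def)
        qed
        then show ?thesis using True by (simp add: tendsto_eventually)
      next
        case False
        then consider "x \<le> a" | "x > b" by fastforce
        then have "\<forall>\<^sub>F n in sequentially. \<psi> n x = 0"
        proof cases
          case 1
          then have le: "kk n * (x - a) \<le> 0" for n using kk(1)[of n] by (simp add: mult_le_0_iff)
          have "\<psi> n x = 0" for n using le[of n] by (simp add: \<psi>_def)
          then show ?thesis by simp
        next
          case 2
          have "\<forall>\<^sub>F n in sequentially. kk n \<ge> 1 / (x - b)"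
            using kktop by (simp add: filterlim_at_top)
          then show ?thesis
          proof eventually_elim
            case (elim n)
            then have "kk n * (b - x) \<le> -1" using 2 by (simp add: field_simps)
            then show ?case by (simp add: \<psi>_def)
          qed
        qed
        then show ?thesis using False by (simp add: tendsto_eventually)
      qed
      then show "AE x in I01. (\<lambda>n. \<psi> n x * ?k x) \<longlonglongrightarrow> indicator {a<..b} x * ?k x"
        by (intro AE_I2 tendsto_intros)
    qed
    then have "(\<integral>x. indicator {a<..b} x * ?k x \<partial>I01) = 0"
      unfolding z using LIMSEQ_unique tendsto_const by blast
    then show ?thesis using prim_increment[OF k, of a b] ab by simp
  qed
  let ?p = "prim ?k"
  have cp: "continuous_on {0..1} ?p" by (rule continuous_on_prim[OF k])
  have const: "?p x = ?p (1/2)" if "x \<in> {0<..<1}" for x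
  proof (cases "x = 1/2")
    case False
    then show ?thesis using eq[of x "1/2"] eq[of "1/2" x] that by fastforce
  qed (simp only:)
  have "?p x = ?p (1/2)" if "x \<in> {0..1}" for x
  proof (rule continuous_constant_on_closure[of "{0<..<1}" ?p "?p (1/2)" x])
    show "continuous_on (closure {0<..<1}) ?p" using cp by simp
    show "x \<in> closure {0<..<1}" using that by simp
    show "?p y = ?p (1/2)" if "y \<in> {0<..<1}" for y using that by (rule const)
  qed
  moreover have "?p 0 = 0" using k by (rule prim_0)
  ultimately have "?p x = 0" if "x \<in> {0..1}" for x
    using that by (metis atLeastAtMost_iff order_refl zero_le_one)
  then have "AE x in I01. ?k x = 0" by (rule prim_zero_AE[OF k])
  then show ?thesis by (intro that[of m]) simp
qed

lemma test_functionD: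
  assumes "test_function \<phi> \<phi>'"
  shows "AC \<phi> \<phi>'" "\<phi> 0 = 0" "\<phi> 1 = 0"
proof -
  show "AC \<phi> \<phi>'"
    using assms by (intro AC_C1) (auto simp: test_function_def intro: continuous_on_subset)
  obtain a b where "0 < a" "a \<le> b" "b < 1" "\<And>x. x \<notin> {a..b} \<Longrightarrow> \<phi> x = 0"
    using assms unfolding test_function_def by blast
  then show "\<phi> 0 = 0" "\<phi> 1 = 0" by auto
qed

lemma AC_test_function:
  assumes "AC F f" "test_function \<phi> \<phi>'"
  shows "(\<integral>x. F x * \<phi>' x \<partial>I01) = - (\<integral>x. f x * \<phi> x \<partial>I01)"
proof -
  note \<phi> = test_functionD[OF assms(2)]
  have "integrable I01 (\<lambda>x. F x * \<phi>' x)" "integrable I01 (\<lambda>x. f x * \<phi> x)"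
    using integrable_continuous_mult[OF AC_continuous_on[OF assms(1)] AC_integrable[OF \<phi>(1)]]
      integrable_continuous_mult[OF AC_continuous_on[OF \<phi>(1)] AC_integrable[OF assms(1)]]
    by (simp_all add: mult.commute)
  then show ?thesis
    using AC_integral[OF AC_mult[OF assms(1) \<phi>(1)]] \<phi>(2,3) by simp
qed

lemma weak_derivI:
  assumes F: "AC F f'" and f: "f \<in> L2" and f': "f' \<in> L2" and eq: "AE x in I01. f x = F x"
  shows "weak_deriv f f'"
  unfolding weak_deriv_def
proof (intro conjI allI impI)
  fix \<phi> \<phi>' assume t: "test_function \<phi> \<phi>'"
  have m: "\<phi>' \<in> borel_measurable I01"
    using AC_integrable[OF test_functionD(1)[OF t]] by auto
  have "(\<integral>x. f x * \<phi>' x \<partial>I01) = (\<integral>x. F x * \<phi>' x \<partial>I01)"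
    by (intro integral_cong_AE borel_measurable_times m L2_measurable f AC_L2[OF F]) (use eq in auto)
  then show "(\<integral>x. f x * \<phi>' x \<partial>I01) = - (\<integral>x. f' x * \<phi> x \<partial>I01)"
    using AC_test_function[OF F t] by simp
qed fact+

text \<open>f minus the primitive of f' has weak derivative zero and so is constant almost
  everywhere. This converts questions about weak derivatives into questions about \<open>AC\<close>;
  uniqueness, linearity and boundary values all come from it.\<close>

lemma weak_derivD:
  assumes w: "weak_deriv f f'"
  obtains F where "AC F f'" "AE x in I01. f x = F x"
proof -
  have f: "f \<in> L2" and f': "f' \<in> L2" using w by (auto simp: weak_deriv_def)
  have P: "AC (prim f') f'" using AC_prim[OF L2_integrable[OF f'], of 0] by simp
  have h: "(\<lambda>x. f x - prim f' x) \<in> L2" by (intro L2_diff f AC_L2[OF P])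
  obtain m where m: "AE x in I01. f x - prim f' x = m"
  proof (rule du_Bois_Reymond[OF L2_integrable[OF h]])
    fix \<phi> \<phi>' assume t: "test_function \<phi> \<phi>'"
    have c: "continuous_on {0..1} \<phi>'"
      using t by (auto simp: test_function_def intro: continuous_on_subset)
    have i: "integrable I01 (\<lambda>x. f x * \<phi>' x)" "integrable I01 (\<lambda>x. prim f' x * \<phi>' x)"
      using integrable_continuous_mult[OF c L2_integrable[OF f]]
        integrable_continuous_mult[OF c L2_integrable[OF AC_L2[OF P]]] by (simp_all add: mult.commute)
    have "(\<integral>x. f x * \<phi>' x \<partial>I01) = - (\<integral>x. f' x * \<phi> x \<partial>I01)"
      using w t by (auto simp: weak_deriv_def)
    then show "(\<integral>x. (f x - prim f' x) * \<phi>' x \<partial>I01) = 0"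
      using AC_test_function[OF P t] i by (simp add: left_diff_distrib)
  qed
  show ?thesis
  proof (rule that)
    show "AC (\<lambda>x. m + prim f' x) f'" by (rule AC_prim[OF L2_integrable[OF f']])
    show "AE x in I01. f x = m + prim f' x" using m by eventually_elim simp
  qed
qed

lemma AC_unique:
  assumes "AC F f" "AC F g"
  shows "AE x in I01. f x = g x"
proof -
  have fg: "integrable I01 f" "integrable I01 g" using assms by (auto dest: AC_integrable)
  have "AE x in I01. f x - g x = 0"
  proof (rule prim_zero_AE)
    show "prim (\<lambda>x. f x - g x) x = 0" if "x \<in> {0..1}" for x
      using AC_eq[OF assms(1) that] AC_eq[OF assms(2) that] prim_diff[OF fg] by simp
  qed (use fg in auto)
  then show ?thesis by simp
qed

lemma AC_AE_cong:
  assumes "AC F f" "AC G g" "AE x in I01. F x = G x"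
  shows "AC G f"
  by (rule AC_cong[OF assms(1)])
    (use continuous_AE_eq[OF AC_continuous_on[OF assms(1)] AC_continuous_on[OF assms(2)] assms(3)] in auto)

lemma weak_deriv_unique:
  assumes "weak_deriv f g" "weak_deriv f' g'" "AE x in I01. f x = f' x"
  shows "AE x in I01. g x = g' x"
proof -
  obtain F where F: "AC F g" "AE x in I01. f x = F x" using weak_derivD[OF assms(1)] .
  obtain G where G: "AC G g'" "AE x in I01. f' x = G x" using weak_derivD[OF assms(2)] .
  have "AE x in I01. F x = G x" using F(2) G(2) assms(3) by eventually_elim simp
  with F(1) G(1) have "AC G g" by (rule AC_AE_cong)
  then show ?thesis using G(1) by (rule AC_unique)
qed

lemma weak_deriv_wderiv: "weak_deriv f g \<Longrightarrow> weak_deriv f (wderiv f)"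
  unfolding wderiv_def by (rule someI[of "weak_deriv f"])

lemma wderiv_AE:
  assumes "weak_deriv f g"
  shows "AE x in I01. wderiv f x = g x"
  by (rule weak_deriv_unique[OF weak_deriv_wderiv[OF assms] assms]) simp

lemma weak_deriv_cong:
  assumes w: "weak_deriv f g" and "f' \<in> L2" "g' \<in> L2"
    and f: "AE x in I01. f x = f' x" and g: "AE x in I01. g x = g' x"
  shows "weak_deriv f' g'"
proof -
  obtain F where F: "AC F g" "AE x in I01. f x = F x" using weak_derivD[OF w] .
  have "AC F g'" using AC_cong[OF F(1) _ g] by blast
  moreover have "AE x in I01. f' x = F x" using F(2) f by eventually_elim simp
  ultimately show ?thesis using assms by (intro weak_derivI)
qed

lemma weak_deriv_add:
  assumes "weak_deriv f f'" "weak_deriv g g'"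
  shows "weak_deriv (\<lambda>x. f x + g x) (\<lambda>x. f' x + g' x)"
proof -
  obtain F where F: "AC F f'" "AE x in I01. f x = F x" using weak_derivD[OF assms(1)] .
  obtain G where G: "AC G g'" "AE x in I01. g x = G x" using weak_derivD[OF assms(2)] .
  have "AE x in I01. f x + g x = F x + G x" using F(2) G(2) by eventually_elim simp
  then show ?thesis using assms
    by (intro weak_derivI[OF AC_add[OF F(1) G(1)]] L2_add) (auto simp: weak_deriv_def)
qed

lemma weak_deriv_scale:
  assumes "weak_deriv f f'"
  shows "weak_deriv (\<lambda>x. r * f x) (\<lambda>x. r * f' x)"
proof -
  obtain F where F: "AC F f'" "AE x in I01. f x = F x" using weak_derivD[OF assms(1)] .
  have "AE x in I01. r * f x = r * F x" using F(2) by eventually_elim simp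
  then show ?thesis using assms
    by (intro weak_derivI[OF AC_scale[OF F(1)]] L2_scale) (auto simp: weak_deriv_def)
qed

lemma weak_deriv_diff:
  assumes "weak_deriv f f'" "weak_deriv g g'"
  shows "weak_deriv (\<lambda>x. f x - g x) (\<lambda>x. f' x - g' x)"
  using weak_deriv_add[OF assms(1) weak_deriv_scale[OF assms(2), of "-1"]] by simp

lemma cont_rep_eq:
  assumes "continuous_on {0..1} W" "AE x in I01. W x = f x" "x \<in> {0..1}"
  shows "cont_rep f x = W x"
proof -
  have "continuous_on {0..1} (cont_rep f) \<and> (AE x in I01. cont_rep f x = f x)"
    unfolding cont_rep_def by (rule someI[of _ W]) (use assms in auto)
  then have c: "continuous_on {0..1} (cont_rep f)" and e: "AE x in I01. cont_rep f x = f x" by auto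
  have "AE x in I01. cont_rep f x = W x" using e assms(2) by eventually_elim simp
  then show ?thesis by (rule continuous_AE_eq[OF c assms(1) _ assms(3)])
qed

lemma cont_rep_AE_cong:
  assumes "AE x in I01. f x = g x"
  shows "cont_rep f = cont_rep g"
proof -
  have "(AE x in I01. w x = f x) \<longleftrightarrow> (AE x in I01. w x = g x)" for w
  proof
    assume "AE x in I01. w x = f x"
    with assms show "AE x in I01. w x = g x" by eventually_elim simp
  next
    assume "AE x in I01. w x = g x"
    with assms show "AE x in I01. w x = f x" by eventually_elim simp
  qed
  then show ?thesis unfolding cont_rep_def by simp
qed

lemma weak_deriv_cont_rep:
  assumes "weak_deriv f g"
  shows "AC (cont_rep f) g" "AE x in I01. cont_rep f x = f x"
proof -
  obtain F where F: "AC F g" "AE x in I01. f x = F x" using weak_derivD[OF assms] .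
  then have "cont_rep f x = F x" if "x \<in> {0..1}" for x
    using that by (intro cont_rep_eq AC_continuous_on[OF F(1)]) auto
  then show "AC (cont_rep f) g" by (intro AC_cong[OF F(1)]) auto
  show "AE x in I01. cont_rep f x = f x"
    using F(2) AE_I01_interval by eventually_elim (use \<open>\<And>x. x \<in> {0..1} \<Longrightarrow> cont_rep f x = F x\<close> in auto)
qed

lemma Hsob_1_iff: "f \<in> Hsob 1 \<longleftrightarrow> weak_deriv f (wderiv f)"
proof
  assume "f \<in> Hsob 1"
  then obtain g where "weak_deriv f g" by auto
  then show "weak_deriv f (wderiv f)" by (rule weak_deriv_wderiv)
next
  assume w: "weak_deriv f (wderiv f)"
  then have "wderiv f \<in> L2" by (simp add: weak_deriv_def)
  with w show "f \<in> Hsob 1" by auto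
qed

text \<open>The witness in \<open>Hsob\<close> need not be the function chosen by
  \<open>wderiv\<close>. Both agree almost everywhere, which suffices to pass the second derivative
  from one to the other.\<close>

lemma Hsob_2_iff: "f \<in> Hsob 2 \<longleftrightarrow> weak_deriv f (wderiv f) \<and> weak_deriv (wderiv f) (wderiv (wderiv f))"
proof
  assume "f \<in> Hsob 2"
  then obtain g where g: "g \<in> Hsob 1" "weak_deriv f g"
    by (auto simp: numeral_2_eq_2)
  then have w: "weak_deriv f (wderiv f)" by (intro weak_deriv_wderiv)
  have eq: "AE x in I01. g x = wderiv f x" using wderiv_AE[OF g(2)] by eventually_elim simp
  have wg: "weak_deriv g (wderiv g)" using g(1) by (simp only: Hsob_1_iff)
  have "wderiv f \<in> L2" "wderiv g \<in> L2" using w wg by (simp_all add: weak_deriv_def)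
  then have "weak_deriv (wderiv f) (wderiv g)"
    using weak_deriv_cong[OF wg _ _ eq] by simp
  then show "weak_deriv f (wderiv f) \<and> weak_deriv (wderiv f) (wderiv (wderiv f))"
    using w weak_deriv_wderiv by blast
next
  assume w: "weak_deriv f (wderiv f) \<and> weak_deriv (wderiv f) (wderiv (wderiv f))"
  then have "wderiv f \<in> Hsob 1" by (subst Hsob_1_iff) blast
  with w show "f \<in> Hsob 2" unfolding numeral_2_eq_2 One_nat_def Hsob.simps(2)[of "Suc 0"] by blast
qed

section \<open>From the matrix inequality to a dissipation inequality at a fixed time\<close>

section \<open>Block vectors and quadratic forms\<close>

definition vjoin :: "real^'a \<Rightarrow> real^'b \<Rightarrow> real^('a::finite + 'b::finite)" where
  "vjoin x y = (\<chi> i. case i of Inl a \<Rightarrow> x $ a | Inr b \<Rightarrow> y $ b)"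

lemma vjoin_nth [simp]: "vjoin x y $ Inl a = x $ a" "vjoin x y $ Inr b = y $ b"
  by (simp_all add: vjoin_def)

lemma sum_UNIV_Plus:
  "sum f (UNIV :: ('a::finite + 'b::finite) set) = (\<Sum>a\<in>UNIV. f (Inl a)) + (\<Sum>b\<in>UNIV. f (Inr b))"
  by (simp add: UNIV_Plus_UNIV[symmetric] sum.Plus comp_def del: UNIV_Plus_UNIV)

lemma hcat_mult_vjoin: "hcat M N *v vjoin x y = M *v x + N *v y"
  by (simp add: vec_eq_iff matrix_vector_mult_def hcat_def sum_UNIV_Plus)

lemma vcat_mult: "vcat M N *v x = vjoin (M *v x) (N *v x)"
proof -
  have "(vcat M N *v x) $ i = vjoin (M *v x) (N *v x) $ i" for i
    by (cases i) (simp_all add: matrix_vector_mult_def vcat_def)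
  then show ?thesis by (simp add: vec_eq_iff)
qed

lemma inner_vjoin: "vjoin x y \<bullet> vjoin x' y' = x \<bullet> x' + y \<bullet> y'"
  by (simp add: inner_vec_def sum_UNIV_Plus)

lemma norm_vjoin: "(norm (vjoin x y))\<^sup>2 = (norm x)\<^sup>2 + (norm y)\<^sup>2"
  by (simp add: power2_norm_eq_inner inner_vjoin)

lemma vjoin_add: "vjoin (x + x') (y + y') = vjoin x y + vjoin x' y'"
  and vjoin_scaleR: "vjoin (r *\<^sub>R x) (r *\<^sub>R y) = r *\<^sub>R vjoin x y"
proof -
  have "vjoin (x + x') (y + y') $ i = (vjoin x y + vjoin x' y') $ i"
    "vjoin (r *\<^sub>R x) (r *\<^sub>R y) $ i = (r *\<^sub>R vjoin x y) $ i" for i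
    by (cases i; simp)+
  then show "vjoin (x + x') (y + y') = vjoin x y + vjoin x' y'"
    "vjoin (r *\<^sub>R x) (r *\<^sub>R y) = r *\<^sub>R vjoin x y"
    by (simp_all add: vec_eq_iff)
qed

lemma bounded_linear_vjoin: "bounded_linear (\<lambda>(x, y). vjoin x y)"
proof (rule bounded_linear_intro[of _ 1])
  show "norm (case z of (x, y) \<Rightarrow> vjoin x y) \<le> norm z * 1" for z :: "(real^'a) \<times> (real^'b)"
  proof (rule power2_le_imp_le)
    show "(norm (case z of (x, y) \<Rightarrow> vjoin x y))\<^sup>2 \<le> (norm z * 1)\<^sup>2"
      by (cases z) (simp add: norm_vjoin norm_Pair)
  qed simp
qed (auto simp: vjoin_add vjoin_scaleR split: prod.splits)

lemma inner_transpose_mult: "x \<bullet> (transpose M *v y) = (M *v x) \<bullet> y"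
  for M :: "real^'n::finite^'m::finite"
  by (simp add: dot_lmul_matrix[symmetric] inner_commute)

lemma inner_sandwich: "x \<bullet> ((transpose M ** P ** N) *v x) = (M *v x) \<bullet> (P *v (N *v x))"
  for M :: "real^'n::finite^'m::finite"
  unfolding matrix_vector_mul_assoc[symmetric] by (rule inner_transpose_mult)

lemma inner_He: "x \<bullet> (He M *v x) = 2 * (x \<bullet> (M *v x))"
  unfolding He_def matrix_vector_mult_add_rdistrib inner_add_right inner_transpose_mult
  by (simp add: inner_commute)

lemma sym_inner_commute:
  fixes M :: "real^'n::finite^'n"
  assumes "transpose M = M"
  shows "x \<bullet> (M *v y) = y \<bullet> (M *v x)"
proof -
  have "x \<bullet> (transpose M *v y) = (M *v x) \<bullet> y" by (rule inner_transpose_mult)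
  then show ?thesis unfolding assms by (simp add: inner_commute)
qed

lemma inner_matrix_bound:
  fixes M :: "real^'n::finite^'m::finite"
  obtains C where "C > 0" "\<And>x y. \<bar>x \<bullet> (M *v y)\<bar> \<le> C * (norm x * norm y)"
proof -
  obtain C where C: "C > 0" "\<And>y. norm (M *v y) \<le> norm y * C"
    using bounded_linear.pos_bounded[OF matrix_vector_mul_bounded_linear[of M]] by blast
  have "\<bar>x \<bullet> (M *v y)\<bar> \<le> C * (norm x * norm y)" for x y
  proof -
    have "\<bar>x \<bullet> (M *v y)\<bar> \<le> norm x * norm (M *v y)" by (rule Cauchy_Schwarz_ineq2)
    also have "\<dots> \<le> norm x * (norm y * C)" by (intro mult_left_mono C) simp
    finally show ?thesis by (simp add: mult_ac)
  qed
  with C(1) show ?thesis by (rule that)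
qed

text \<open>The constant is the minimum of the form on the unit sphere, attained by compactness;
  homogeneity of degree two carries the bound to all vectors.\<close>

lemma pos_quadratic_coercive:
  fixes M :: "real^'n::finite^'n"
  assumes "\<And>x. x \<noteq> 0 \<Longrightarrow> x \<bullet> (M *v x) > 0"
  obtains e where "e > 0" "\<And>x. x \<bullet> (M *v x) \<ge> e * (norm x)\<^sup>2"
proof -
  let ?q = "\<lambda>x. x \<bullet> (M *v x)"
  have ne: "sphere (0 :: real^'n) 1 \<noteq> {}" by simp
  have "continuous_on (sphere 0 1) ?q" by (intro continuous_intros matrix_vector_mult_linear_continuous_on)
  then obtain u where u: "u \<in> sphere 0 1" "\<And>y. y \<in> sphere 0 1 \<Longrightarrow> ?q u \<le> ?q y"
    using continuous_attains_inf[OF compact_sphere ne] by blast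
  have "?q u * (norm x)\<^sup>2 \<le> ?q x" for x
  proof (cases "x = 0")
    case False
    let ?y = "(1 / norm x) *\<^sub>R x"
    have "?q u \<le> ?q ?y" using False by (intro u(2)) simp
    also have "\<dots> = ?q x / (norm x)\<^sup>2"
      by (simp add: matrix_vector_mult_scaleR power2_eq_square)
    finally show ?thesis using False by (simp add: field_simps)
  qed simp
  moreover have "?q u > 0" using u(1) by (intro assms) auto
  ultimately show ?thesis by (intro that[of "?q u"])
qed

section \<open>The quadratic form of the linear matrix inequality\<close>

lemma F0_mult: "F0 *v vjoin x e = x"
  by (simp add: F0_def hcat_mult_vjoin)

lemma N0_mult: "N0 c A B K *v vjoin (vjoin X m) e = (A + B ** K) *v X + B_tilde c B *v m"
  by (simp add: N0_def hcat_mult_vjoin)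

lemma row_eq_nth: "row i M = M $ i"
  by (simp add: row_def vec_eq_iff)

lemma vector_2_mult: "(vector [r1, r2] :: real^'n::finite^2) *v y = vector [r1 \<bullet> y, r2 \<bullet> y]"
  by (simp add: vec_eq_iff forall_2 vector_2 matrix_vector_mul_component)

lemma G0_mult:
  fixes A :: "real^'n::finite^'n"
  shows "G0 c c0 A B K *v vjoin x e
    = vector [e $ 2 + (K *v (N0 c A B K *v vjoin x e)) $ 1, (1 + c * c0) * e $ 1]"
  by (simp add: G0_def matrix_vector_mult_add_rdistrib hcat_mult_vjoin vector_2_mult row_eq_nth
      matrix_vector_mul_component g_mat_def flip: matrix_vector_mul_assoc)
    (simp add: vec_eq_iff forall_2 vector_2 inner_vec_def sum_2)

lemma H0_mult:
  fixes A :: "real^'n::finite^'n"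
  shows "H0 c c0 A B K *v vjoin x e
    = vector [(1 - c * c0) * e $ 1, - e $ 2 + (K *v (N0 c A B K *v vjoin x e)) $ 1]"
  by (simp add: H0_def matrix_vector_mult_add_rdistrib hcat_mult_vjoin vector_2_mult row_eq_nth
      matrix_vector_mul_component h_mat_def flip: matrix_vector_mul_assoc)
    (simp add: vec_eq_iff forall_2 vector_2 inner_vec_def sum_2)

text \<open>With e = (u_t(1), c u_x(0)), Y becomes the velocity of X, and G and H the Riemann
  coordinates at x = 0 and x = 1 (see \<open>boundary_values\<close>). H - G is then the mean of
  their x-derivatives, so the right-hand side is what integration by parts leaves of dV/dt, with the
  integral of the form of R replaced by its value at the means.\<close>

lemma Psi0_quadratic:
  fixes A :: "real^'n::finite^'n" and B K c c0 and X :: "real^'n" and m e :: "real^2"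
  defines "\<zeta> \<equiv> vjoin (vjoin X m) e"
  defines "Y \<equiv> N0 c A B K *v \<zeta>" and "G \<equiv> G0 c c0 A B K *v \<zeta>" and "H \<equiv> H0 c c0 A B K *v \<zeta>"
  shows "\<zeta> \<bullet> (Psi0 c c0 A B K P0 S R *v \<zeta>)
    = 2 * (vjoin Y (c *\<^sub>R (H - G)) \<bullet> (P0 *v vjoin X m)) - c * (m \<bullet> (R *v m))
      + c * (H \<bullet> ((S + R) *v H) - G \<bullet> (S *v G))"
proof -
  have Z: "Z0 c c0 A B K *v \<zeta> = vjoin Y (c *\<^sub>R (H - G))"
    unfolding Z0_def vcat_mult Y_def G_def H_def
    by (simp add: scaleR_matrix_vector_assoc[symmetric] matrix_vector_mult_diff_rdistrib)
  have "\<zeta> \<bullet> (He (transpose (Z0 c c0 A B K) ** P0 ** F0) *v \<zeta>) = 2 * (vjoin Y (c *\<^sub>R (H - G)) \<bullet> (P0 *v vjoin X m))"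
    unfolding inner_He inner_sandwich Z by (simp add: \<zeta>_def F0_mult)
  moreover have "\<zeta> \<bullet> (R_tilde0 R *v \<zeta>) = m \<bullet> (R *v m)"
    unfolding R_tilde0_def bdiag_def \<zeta>_def vcat_mult hcat_mult_vjoin inner_vjoin by (simp add: vcat_mult hcat_mult_vjoin inner_vjoin)
  ultimately show ?thesis
    unfolding Psi0_def G_def H_def
    by (simp add: matrix_vector_mult_add_rdistrib matrix_vector_mult_diff_rdistrib inner_add_right
        inner_diff_right inner_sandwich flip: scaleR_matrix_vector_assoc)
qed

section \<open>The Lyapunov functional\<close>

text \<open>Bilinear in f and g because the time derivative of the functional appears in polarised
  form. Summing over the entries lets the product rule and integration by parts be proved for scalar
  functions. \<open>lyap_int R 0\<close> is the unweighted form of R.\<close>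

definition lyap_int :: "real^2^2 \<Rightarrow> real^2^2 \<Rightarrow> (2 \<Rightarrow> real \<Rightarrow> real) \<Rightarrow> (2 \<Rightarrow> real \<Rightarrow> real) \<Rightarrow> real" where
  "lyap_int S R f g = (\<Sum>i\<in>UNIV. \<Sum>j\<in>UNIV. \<integral>x. (S $ i $ j + x * R $ i $ j) * (f i x * g j x) \<partial>I01)"

definition means :: "(2 \<Rightarrow> real \<Rightarrow> real) \<Rightarrow> real^2" where
  "means f = (\<chi> i. \<integral>x. f i x \<partial>I01)"

definition lyap :: "real^('n + 2)^('n + 2) \<Rightarrow> real^2^2 \<Rightarrow> real^2^2 \<Rightarrow> real^'n::finite
    \<Rightarrow> (2 \<Rightarrow> real \<Rightarrow> real) \<Rightarrow> real" where
  "lyap P0 S R X f = vjoin X (means f) \<bullet> (P0 *v vjoin X (means f)) + lyap_int S R f f"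

definition sqnorms :: "(2 \<Rightarrow> real \<Rightarrow> real) \<Rightarrow> real" where
  "sqnorms f = (\<Sum>i\<in>UNIV. (normL2 (f i))\<^sup>2)"

lemma inner_matrix_sum: "x \<bullet> (M *v y) = (\<Sum>i\<in>UNIV. \<Sum>j\<in>UNIV. M $ i $ j * (x $ i * y $ j))"
  for M :: "real^'n::finite^'m::finite"
  by (simp add: inner_vec_def matrix_vector_mult_def sum_distrib_left mult_ac)

lemma weight_bound: "x \<in> {0..1} \<Longrightarrow> \<bar>a + x * b\<bar> \<le> \<bar>a\<bar> + \<bar>b\<bar>" for a b x :: real
  by (rule order_trans[OF abs_triangle_ineq]) (auto simp: abs_mult intro: mult_left_le_one_le)

lemma weight_measurable: "(\<lambda>x. a + x * b :: real) \<in> borel_measurable I01"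
  by (intro continuous_on_measurable_I01 continuous_intros)

lemma weighted_integrable:
  assumes "f \<in> L2" "g \<in> L2"
  shows "integrable I01 (\<lambda>x. (a + x * b) * (f x * g x))"
  using L2_mult_integrable[OF L2_bounded_mult[OF assms(1) weight_measurable[of a b] weight_bound] assms(2)]
  by (simp add: mult.assoc)

lemma lyap_int_eq:
  assumes "\<And>i. f i \<in> L2" "\<And>i. g i \<in> L2"
  shows "integrable I01 (\<lambda>x. (\<chi> i. f i x) \<bullet> ((S + x *\<^sub>R R) *v (\<chi> i. g i x)))"
    and "lyap_int S R f g = (\<integral>x. (\<chi> i. f i x) \<bullet> ((S + x *\<^sub>R R) *v (\<chi> i. g i x)) \<partial>I01)"
  unfolding lyap_int_def inner_matrix_sum using weighted_integrable[OF assms] by auto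

lemma sqnorms_eq:
  assumes "\<And>i. f i \<in> L2"
  shows "integrable I01 (\<lambda>x. (norm (\<chi> i. f i x))\<^sup>2)"
    and "sqnorms f = (\<integral>x. (norm (\<chi> i. f i x))\<^sup>2 \<partial>I01)"
  unfolding sqnorms_def power2_norm_eq_inner inner_vec_def normL2_power2
  using L2_mult_integrable[OF assms assms] by (auto simp: power2_eq_square)

lemma norm_means_le:
  assumes "\<And>i. f i \<in> L2"
  shows "(norm (means f))\<^sup>2 \<le> sqnorms f"
proof -
  have "(\<integral>x. f i x \<partial>I01)\<^sup>2 \<le> (normL2 (f i))\<^sup>2" for i
    using power_mono[OF integral_le_normL2[OF assms[of i]], of 2] by simp
  then show ?thesis
    unfolding power2_norm_eq_inner inner_vec_def sqnorms_def means_def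
    by (intro sum_mono) (simp add: power2_eq_square)
qed

lemma sqnorms_nonneg: "sqnorms f \<ge> 0"
  by (simp add: sqnorms_def sum_nonneg)

lemma lyap_int_lower:
  assumes f: "\<And>i. f i \<in> L2" and M: "\<And>x y. x \<in> {0..1} \<Longrightarrow> y \<bullet> ((S + x *\<^sub>R R) *v y) \<ge> e * (norm y)\<^sup>2"
  shows "lyap_int S R f f \<ge> e * sqnorms f"
proof -
  have "(\<integral>x. e * (norm (\<chi> i. f i x))\<^sup>2 \<partial>I01) \<le> lyap_int S R f f"
    unfolding lyap_int_eq(2)[OF f f]
    using sqnorms_eq(1)[OF f] lyap_int_eq(1)[OF f f] by (intro integral_mono M) auto
  then show ?thesis by (simp add: sqnorms_eq(2)[OF f])
qed

lemma lyap_int_upper: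
  assumes f: "\<And>i. f i \<in> L2" and M: "\<And>x y. x \<in> {0..1} \<Longrightarrow> y \<bullet> ((S + x *\<^sub>R R) *v y) \<le> e * (norm y)\<^sup>2"
  shows "lyap_int S R f f \<le> e * sqnorms f"
proof -
  have "lyap_int S R f f \<le> (\<integral>x. e * (norm (\<chi> i. f i x))\<^sup>2 \<partial>I01)"
    unfolding lyap_int_eq(2)[OF f f]
    using sqnorms_eq(1)[OF f] lyap_int_eq(1)[OF f f] by (intro integral_mono M) auto
  then show ?thesis by (simp add: sqnorms_eq(2)[OF f])
qed

text \<open>P0 controls X and S controls the Riemann coordinates in L2; the weight x R is
  nonnegative and is dropped.\<close>

lemma lyap_coercive:
  fixes P0 :: "real^('n::finite + 2)^('n + 2)"
  assumes P0: "sym_pos_def P0" and S: "sym_pos_def S" and R: "sym_pos_def R"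
  obtains l where "l > 0"
    "\<And>X f. (\<And>i. f i \<in> L2) \<Longrightarrow> l * ((norm X)\<^sup>2 + sqnorms f) \<le> lyap P0 S R X f"
proof -
  obtain e where e: "e > 0" "\<And>x. x \<bullet> (P0 *v x) \<ge> e * (norm x)\<^sup>2"
    by (rule pos_quadratic_coercive[of P0]) (use P0 in \<open>auto simp: sym_pos_def_def\<close>)
  obtain d where d: "d > 0" "\<And>x. x \<bullet> (S *v x) \<ge> d * (norm x)\<^sup>2"
    by (rule pos_quadratic_coercive[of S]) (use S in \<open>auto simp: sym_pos_def_def\<close>)
  have R0: "y \<bullet> (R *v y) \<ge> 0" for y
    using R by (cases "y = 0") (auto simp: sym_pos_def_def less_imp_le)
  show ?thesis
  proof (rule that[of "min e d"])
    fix X :: "real^'n" and f :: "2 \<Rightarrow> real \<Rightarrow> real" assume f: "\<And>i. f i \<in> L2"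
    have "e * (norm X)\<^sup>2 \<le> e * (norm (vjoin X (means f)))\<^sup>2"
      using e(1) by (simp add: norm_vjoin)
    also note e(2)
    finally have 1: "e * (norm X)\<^sup>2 \<le> vjoin X (means f) \<bullet> (P0 *v vjoin X (means f))" .
    have 2: "d * sqnorms f \<le> lyap_int S R f f"
    proof (rule lyap_int_lower[OF f])
      show "d * (norm y)\<^sup>2 \<le> y \<bullet> ((S + x *\<^sub>R R) *v y)" if "x \<in> {0..1}" for x y
        using d(2)[of y] mult_nonneg_nonneg[of x, OF _ R0[of y]] that
        by (simp add: matrix_vector_mult_add_rdistrib inner_add_right flip: scaleR_matrix_vector_assoc)
    qed
    have "min e d * (norm X)\<^sup>2 \<le> e * (norm X)\<^sup>2" "min e d * sqnorms f \<le> d * sqnorms f"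
      by (intro mult_right_mono sqnorms_nonneg; simp)+
    with 1 2 show "min e d * ((norm X)\<^sup>2 + sqnorms f) \<le> lyap P0 S R X f"
      unfolding lyap_def distrib_left by linarith
  qed (use e d in simp)
qed

lemma lyap_bounded:
  fixes P0 :: "real^('n::finite + 2)^('n + 2)"
  obtains C where "C > 0"
    "\<And>X f. (\<And>i. f i \<in> L2) \<Longrightarrow> lyap P0 S R X f \<le> C * ((norm X)\<^sup>2 + sqnorms f)"
proof -
  obtain p where p: "p > 0" "\<And>x y. \<bar>x \<bullet> (P0 *v y)\<bar> \<le> p * (norm x * norm y)"
    using inner_matrix_bound[of P0] by blast
  obtain s where s: "s > 0" "\<And>x y. \<bar>x \<bullet> (S *v y)\<bar> \<le> s * (norm x * norm y)"
    using inner_matrix_bound[of S] by blast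
  obtain r where r: "r > 0" "\<And>x y. \<bar>x \<bullet> (R *v y)\<bar> \<le> r * (norm x * norm y)"
    using inner_matrix_bound[of R] by blast
  show ?thesis
  proof (rule that[of "p + (s + r)"])
    fix X :: "real^'n" and f :: "2 \<Rightarrow> real \<Rightarrow> real" assume f: "\<And>i. f i \<in> L2"
    have "vjoin X (means f) \<bullet> (P0 *v vjoin X (means f)) \<le> p * ((norm X)\<^sup>2 + (norm (means f))\<^sup>2)"
      using p(2)[of "vjoin X (means f)" "vjoin X (means f)"]
      unfolding norm_vjoin[symmetric] unfolding power2_eq_square by linarith
    also have "\<dots> \<le> p * ((norm X)\<^sup>2 + sqnorms f)"
      using p(1) norm_means_le[OF f] by simp
    finally have 1: "vjoin X (means f) \<bullet> (P0 *v vjoin X (means f)) \<le> p * ((norm X)\<^sup>2 + sqnorms f)" .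
    have 2: "lyap_int S R f f \<le> (s + r) * sqnorms f"
    proof (rule lyap_int_upper[OF f])
      fix x y assume x: "x \<in> {0..(1::real)}"
      have "x * (y \<bullet> (R *v y)) \<le> \<bar>y \<bullet> (R *v y)\<bar>"
      proof -
        have "x * (y \<bullet> (R *v y)) \<le> x * \<bar>y \<bullet> (R *v y)\<bar>" using x by (intro mult_left_mono) auto
        also have "\<dots> \<le> \<bar>y \<bullet> (R *v y)\<bar>" using x by (intro mult_left_le_one_le) auto
        finally show ?thesis .
      qed
      then show "y \<bullet> ((S + x *\<^sub>R R) *v y) \<le> (s + r) * (norm y)\<^sup>2"
        using s(2)[of y y] r(2)[of y y]
        by (simp add: matrix_vector_mult_add_rdistrib inner_add_right distrib_right power2_eq_square
            flip: scaleR_matrix_vector_assoc)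
    qed
    have "0 \<le> (s + r) * (norm X)\<^sup>2" using s r by simp
    with 1 2 show "lyap P0 S R X f \<le> (p + (s + r)) * ((norm X)\<^sup>2 + sqnorms f)"
      unfolding lyap_def by (simp add: algebra_simps)
  qed (use p s r in simp)
qed

text \<open>The product rule for weight times f_i times f_j. The weight S + x R equals S + R at 1
  and S at 0, and its derivative R yields the integral that drives the decay.\<close>

lemma lyap_int_by_parts:
  assumes f: "\<And>i. AC (f i) (f' i)" and f': "\<And>i. f' i \<in> L2"
  shows "lyap_int S R f' f + lyap_int S R f f'
    = (\<chi> i. f i 1) \<bullet> ((S + R) *v (\<chi> i. f i 1)) - (\<chi> i. f i 0) \<bullet> (S *v (\<chi> i. f i 0)) - lyap_int R 0 f f"
proof -
  have f2: "f i \<in> L2" for i by (rule AC_L2[OF f])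
  have eq: "(\<integral>x. (S $ i $ j + x * R $ i $ j) * (f' i x * f j x) \<partial>I01)
      + (\<integral>x. (S $ i $ j + x * R $ i $ j) * (f i x * f' j x) \<partial>I01)
    = (S $ i $ j + R $ i $ j) * (f i 1 * f j 1) - S $ i $ j * (f i 0 * f j 0)
      - (\<integral>x. (R $ i $ j + x * 0) * (f i x * f j x) \<partial>I01)" for i j
  proof -
    let ?a = "S $ i $ j" and ?b = "R $ i $ j"
    have "AC (\<lambda>x. ?a + x * ?b) (\<lambda>x. ?b)"
      by (rule AC_C1) (auto intro!: derivative_eq_intros)
    note AC_mult[OF this AC_mult[OF f[of i] f[of j]]]
    from AC_integral[OF this]
    have "(\<integral>x. ((?a + x * ?b) * (f i x * f' j x) + (?a + x * ?b) * (f' i x * f j x)) + ?b * (f i x * f j x) \<partial>I01)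
      = (?a + ?b) * (f i 1 * f j 1) - ?a * (f i 0 * f j 0)"
      by (simp add: distrib_left)
    moreover have "(\<integral>x. ((?a + x * ?b) * (f i x * f' j x) + (?a + x * ?b) * (f' i x * f j x)) + ?b * (f i x * f j x) \<partial>I01)
      = (\<integral>x. (?a + x * ?b) * (f i x * f' j x) \<partial>I01) + (\<integral>x. (?a + x * ?b) * (f' i x * f j x) \<partial>I01)
        + (\<integral>x. ?b * (f i x * f j x) \<partial>I01)"
      using weighted_integrable[OF f2[of i] f'[of j], of ?a ?b] weighted_integrable[OF f'[of i] f2[of j], of ?a ?b]
        L2_mult_integrable[OF f2[of i] f2[of j]] by simp
    ultimately show ?thesis by simp
  qed
  show ?thesis
    unfolding lyap_int_def inner_matrix_sum sum.distrib[symmetric] sum_subtractf[symmetric]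
    by (intro sum.cong refl) (simp add: eq[simplified])
qed

text \<open>The form is nonnegative at f - means f. On expansion the mixed terms and the constant
  term collapse to minus the form at the means, because the interval has length one.\<close>

lemma Jensen_quadratic:
  assumes f: "\<And>i. f i \<in> L2" and R: "\<And>y. y \<bullet> (R *v y) \<ge> 0"
  shows "means f \<bullet> (R *v means f) \<le> lyap_int R 0 f f"
proof -
  let ?m = "\<lambda>i. means f $ i"
  let ?g = "\<lambda>i x. f i x - ?m i"
  have g: "?g i \<in> L2" for i by (intro L2_diff f L2_const)
  have one: "measure I01 {0..1} = 1" by (simp add: measure_restrict_space)
  have "0 \<le> lyap_int R 0 ?g ?g"
    using lyap_int_lower[where f="?g" and S=R and R=0 and e=0] g R by simp
  also have "\<dots> = lyap_int R 0 f f - means f \<bullet> (R *v means f)"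
  proof -
    have "(\<integral>x. R $ i $ j * ((f i x - ?m i) * (f j x - ?m j)) \<partial>I01)
        = (\<integral>x. R $ i $ j * (f i x * f j x) \<partial>I01) - R $ i $ j * (?m i * ?m j)" for i j
    proof -
      have "(\<integral>x. (f i x - ?m i) * (f j x - ?m j) \<partial>I01)
          = (\<integral>x. f i x * f j x - ?m i * f j x - ?m j * f i x + ?m i * ?m j \<partial>I01)"
        by (intro Bochner_Integration.integral_cong) (auto simp: algebra_simps)
      also have "\<dots> = (\<integral>x. f i x * f j x \<partial>I01) - ?m i * ?m j"
        using L2_mult_integrable[OF f[of i] f[of j]] L2_integrable[OF f[of i]] L2_integrable[OF f[of j]]
          L2_integrable[OF L2_const[of "?m i * ?m j"]]
        by (simp add: one means_def)
      finally have "(\<integral>x. (f i x - ?m i) * (f j x - ?m j) \<partial>I01)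
        = (\<integral>x. f i x * f j x \<partial>I01) - ?m i * ?m j" .
      then show ?thesis
        unfolding Bochner_Integration.integral_mult_right_zero by (simp only: right_diff_distrib)
    qed
    then show ?thesis
      unfolding lyap_int_def inner_matrix_sum by (simp add: sum_subtractf)
  qed
  finally show ?thesis by simp
qed

text \<open>An inequality at a fixed time, with functions and boundary data as free variables: no
  curve is involved yet, and \<delta> depends only on the coefficients and the matrices.\<close>

lemma lyap_dissipation:
  fixes A :: "real^'n::finite^'n" and B K and P0 :: "real^('n + 2)^('n + 2)"
  assumes c: "c > 0" and P0: "sym_pos_def P0" and S: "sym_pos_def S" and R: "sym_pos_def R"
    and Psi: "sym_neg_def (Psi0 c c0 A B K P0 S R)"
  obtains \<delta> where "\<delta> > 0"
    "\<And>X f f' e Y. (\<And>i. AC (f i) (f' i)) \<Longrightarrow> (\<And>i. f' i \<in> L2) \<Longrightarrow>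
      Y = N0 c A B K *v vjoin (vjoin X (means f)) e \<Longrightarrow>
      (\<chi> i. f i 0) = G0 c c0 A B K *v vjoin (vjoin X (means f)) e \<Longrightarrow>
      (\<chi> i. f i 1) = H0 c c0 A B K *v vjoin (vjoin X (means f)) e \<Longrightarrow>
      2 * (vjoin Y (c *\<^sub>R means f') \<bullet> (P0 *v vjoin X (means f)))
        + c * (lyap_int S R f' f + lyap_int S R f f') \<le> - \<delta> * lyap P0 S R X f"
proof -
  let ?Psi = "Psi0 c c0 A B K P0 S R"
  obtain e where e: "e > 0" "\<And>x. x \<bullet> ((- ?Psi) *v x) \<ge> e * (norm x)\<^sup>2"
  proof (rule pos_quadratic_coercive[of "- ?Psi"])
    show "x \<bullet> ((- ?Psi) *v x) > 0" if "x \<noteq> 0" for x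
      using Psi that matrix_vector_mult_diff_rdistrib[of 0 ?Psi x] by (auto simp: sym_neg_def_def)
  qed blast
  have Psi_le: "x \<bullet> (?Psi *v x) \<le> - e * (norm x)\<^sup>2" for x
    using e(2)[of x] matrix_vector_mult_diff_rdistrib[of 0 ?Psi x] by auto
  obtain r where r: "r > 0" "\<And>x y. \<bar>x \<bullet> (R *v y)\<bar> \<le> r * (norm x * norm y)"
    using inner_matrix_bound[of R] by blast
  obtain d where d: "d > 0" "\<And>x. x \<bullet> (R *v x) \<ge> d * (norm x)\<^sup>2"
    by (rule pos_quadratic_coercive[of R]) (use R in \<open>auto simp: sym_pos_def_def\<close>)
  have R0: "y \<bullet> (R *v y) \<ge> 0" for y
    using R by (cases "y = 0") (auto simp: sym_pos_def_def less_imp_le)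
  obtain C where C: "C > 0"
    "\<And>X f. (\<And>i. f i \<in> L2) \<Longrightarrow> lyap P0 S R X f \<le> C * ((norm X)\<^sup>2 + sqnorms f)"
    using lyap_bounded[of P0 S R] by blast
  \<comment> \<open>The share of the integral of R withheld from Jensen's inequality. It is at most
    e / (c r), so that the strict negativity of Psi0 in the means pays for the part of c (m . R m)
    left uncovered.\<close>
  define \<eta> where "\<eta> = min 1 (e / (c * r))"
  have \<eta>: "0 < \<eta>" "\<eta> \<le> 1" "\<eta> * (c * r) \<le> e"
    using c e r by (auto simp: \<eta>_def min_def field_simps)
  \<comment> \<open>Rate for the squared norms: e from Psi0 in the direction of X, \<eta> c d from
    the withheld integral.\<close>
  define k where "k = min e (\<eta> * c * d)"
  have k: "0 < k" "k \<le> e" "k \<le> \<eta> * c * d" using c e d \<eta> by (auto simp: k_def)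
  show ?thesis
  \<comment> \<open>V is at most C times those squared norms, which turns the rate k into k /
    C.\<close>
  proof (rule that[of "k / C"])
    fix X and f f' :: "2 \<Rightarrow> real \<Rightarrow> real" and ee Y
    assume ac: "\<And>i. AC (f i) (f' i)" and f': "\<And>i. f' i \<in> L2"
      and Y: "Y = N0 c A B K *v vjoin (vjoin X (means f)) ee"
      and G: "(\<chi> i. f i 0) = G0 c c0 A B K *v vjoin (vjoin X (means f)) ee"
      and H: "(\<chi> i. f i 1) = H0 c c0 A B K *v vjoin (vjoin X (means f)) ee"
    have f: "f i \<in> L2" for i by (rule AC_L2[OF ac])
    let ?m = "means f" and ?J = "lyap_int R 0 f f"
    let ?\<zeta> = "vjoin (vjoin X ?m) ee"
    let ?L = "2 * (vjoin Y (c *\<^sub>R means f') \<bullet> (P0 *v vjoin X ?m))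
        + c * (lyap_int S R f' f + lyap_int S R f f')"
    have mf': "means f' = (\<chi> i. f i 1) - (\<chi> i. f i 0)"
      by (simp add: vec_eq_iff means_def AC_integral[OF ac])
    \<comment> \<open>Psi0 contains - c (m . R m) where integration by parts produces - c
      \<open>?J\<close>; the difference is added back.\<close>
    have "?L = ?\<zeta> \<bullet> (?Psi *v ?\<zeta>) + c * (?m \<bullet> (R *v ?m)) - c * ?J"
      unfolding Psi0_quadratic lyap_int_by_parts[OF ac f'] mf' G H Y by (simp add: algebra_simps)
    also have "\<dots> \<le> - e * ((norm X)\<^sup>2 + (norm ?m)\<^sup>2) + c * (?m \<bullet> (R *v ?m)) - c * ?J"
    proof -
      have "e * ((norm X)\<^sup>2 + (norm ?m)\<^sup>2) \<le> e * (norm ?\<zeta>)\<^sup>2"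
        using e(1) by (simp add: norm_vjoin)
      then show ?thesis using Psi_le[of ?\<zeta>] by simp
    qed
    also have "\<dots> \<le> - e * (norm X)\<^sup>2 - \<eta> * c * ?J"
    proof -
      have "?m \<bullet> (R *v ?m) \<le> r * (norm ?m)\<^sup>2" using r(2)[of ?m ?m] by (simp add: power2_eq_square)
      then have "\<eta> * c * (?m \<bullet> (R *v ?m)) \<le> \<eta> * c * (r * (norm ?m)\<^sup>2)"
        using \<eta>(1) c by (intro mult_left_mono) auto
      also have "\<dots> \<le> e * (norm ?m)\<^sup>2"
        using mult_right_mono[OF \<eta>(3), of "(norm ?m)\<^sup>2"] by (simp add: mult_ac)
      finally have 1: "\<eta> * c * (?m \<bullet> (R *v ?m)) \<le> e * (norm ?m)\<^sup>2" .
      have "?m \<bullet> (R *v ?m) \<le> ?J" by (rule Jensen_quadratic[OF f R0])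
      then have "(1 - \<eta>) * c * (?m \<bullet> (R *v ?m)) \<le> (1 - \<eta>) * c * ?J"
        using \<eta>(2) c by (intro mult_left_mono) auto
      with 1 show ?thesis by (simp add: algebra_simps)
    qed
    also have "\<dots> \<le> - k * ((norm X)\<^sup>2 + sqnorms f)"
    proof -
      have "d * sqnorms f \<le> ?J" by (rule lyap_int_lower[OF f]) (use d in simp)
      then have "\<eta> * c * (d * sqnorms f) \<le> \<eta> * c * ?J"
        using \<eta>(1) c by (intro mult_left_mono) auto
      moreover have "k * sqnorms f \<le> \<eta> * c * d * sqnorms f"
        by (intro mult_right_mono k sqnorms_nonneg)
      moreover have "k * (norm X)\<^sup>2 \<le> e * (norm X)\<^sup>2"
        by (intro mult_right_mono k) simp
      ultimately show ?thesis by (simp add: algebra_simps)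
    qed
    also have "\<dots> \<le> - (k / C) * lyap P0 S R X f"
    proof -
      have "k / C * lyap P0 S R X f \<le> k / C * (C * ((norm X)\<^sup>2 + sqnorms f))"
        using k C by (intro mult_left_mono C(2)[OF f]) auto
      also have "\<dots> = k * ((norm X)\<^sup>2 + sqnorms f)" using C(1) by simp
      finally show ?thesis by simp
    qed
    finally show "?L \<le> - (k / C) * lyap P0 S R X f" .
  qed (use k C in simp)
qed

section \<open>Differentiating the functional along curves in the domain\<close>

section \<open>Curves of square integrable functions\<close>

text \<open>Differentiability of a curve in L2 for the seminorm \<open>normL2\<close>; the filter
  makes it one-sided at t = 0 and ignores negative times.\<close>

definition L2_deriv :: "(real \<Rightarrow> real \<Rightarrow> real) \<Rightarrow> (real \<Rightarrow> real) \<Rightarrow> real \<Rightarrow> bool" where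
  "L2_deriv f f' t \<longleftrightarrow>
     ((\<lambda>s. normL2 (\<lambda>x. f s x - f t x - (s - t) * f' x) / \<bar>s - t\<bar>) \<longlongrightarrow> 0) (at t within {0..})"

lemma within_nonneg: "\<forall>\<^sub>F s in at t within {0..}. s \<ge> (0::real) \<and> s \<noteq> t"
  by (auto simp: eventually_at_topological)

lemma at_within_Ici_nontrivial:
  assumes "t \<ge> (0::real)"
  shows "at t within {0..} \<noteq> bot"
proof -
  have "at_right t \<le> at t within {0..}" by (rule at_le) (use assms in auto)
  then show ?thesis using trivial_limit_at_right_real[of t] by (auto simp: bot_unique)
qed

lemma tendsto_zero_le:
  fixes f g :: "real \<Rightarrow> real"
  assumes "(g \<longlongrightarrow> 0) (at t within {0..})" "\<And>s. s \<ge> 0 \<Longrightarrow> s \<noteq> t \<Longrightarrow> \<bar>f s\<bar> \<le> g s"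
  shows "(f \<longlongrightarrow> 0) (at t within {0..})"
proof (rule Lim_null_comparison[OF _ assms(1)])
  show "\<forall>\<^sub>F s in at t within {0..}. norm (f s) \<le> g s"
    using within_nonneg by eventually_elim (use assms(2) in auto)
qed

lemma has_real_derivative_estimate:
  fixes g e :: "real \<Rightarrow> real"
  assumes "(e \<longlongrightarrow> 0) (at t within {0..})"
    and "\<And>s. s \<ge> 0 \<Longrightarrow> s \<noteq> t \<Longrightarrow> \<bar>g s - g t - (s - t) * D\<bar> \<le> \<bar>s - t\<bar> * e s"
  shows "(g has_real_derivative D) (at t within {0..})"
proof -
  have "((\<lambda>s. (g s - g t) / (s - t) - D) \<longlongrightarrow> 0) (at t within {0..})"
  proof (rule tendsto_zero_le[OF assms(1)])
    fix s :: real assume s: "s \<ge> 0" "s \<noteq> t"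
    have "\<bar>(g s - g t) / (s - t) - D\<bar> = \<bar>g s - g t - (s - t) * D\<bar> / \<bar>s - t\<bar>"
      using s by (simp add: abs_divide[symmetric] diff_divide_distrib)
    also have "\<dots> \<le> e s"
      using assms(2)[OF s] s by (simp add: pos_divide_le_eq mult.commute)
    finally show "\<bar>(g s - g t) / (s - t) - D\<bar> \<le> e s" .
  qed
  then show ?thesis
    by (simp add: has_field_derivative_iff Lim_null[symmetric])
qed

lemma L2_deriv_cong:
  assumes "L2_deriv f f' t" "t \<ge> 0"
    and "\<And>s. s \<ge> 0 \<Longrightarrow> AE x in I01. f s x = g s x" "AE x in I01. f' x = g' x"
  shows "L2_deriv g g' t"
  unfolding L2_deriv_def
proof (rule tendsto_zero_le[OF assms(1)[unfolded L2_deriv_def]])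
  fix s :: real assume s: "s \<ge> 0" "s \<noteq> t"
  have "AE x in I01. g s x - g t x - (s - t) * g' x = f s x - f t x - (s - t) * f' x"
    using assms(3)[OF s(1)] assms(3)[OF assms(2)] assms(4) by eventually_elim simp
  from normL2_AE_cong[OF this]
  show "\<bar>normL2 (\<lambda>x. g s x - g t x - (s - t) * g' x) / \<bar>s - t\<bar>\<bar>
      \<le> normL2 (\<lambda>x. f s x - f t x - (s - t) * f' x) / \<bar>s - t\<bar>" by simp
qed

lemma L2_deriv_add:
  assumes "L2_deriv f f' t" "L2_deriv g g' t" "t \<ge> 0"
    and f: "\<And>s. s \<ge> 0 \<Longrightarrow> f s \<in> L2" "f' \<in> L2" and g: "\<And>s. s \<ge> 0 \<Longrightarrow> g s \<in> L2" "g' \<in> L2"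
  shows "L2_deriv (\<lambda>s x. f s x + g s x) (\<lambda>x. f' x + g' x) t"
  unfolding L2_deriv_def
proof (rule tendsto_zero_le)
  let ?e = "\<lambda>f f' s. normL2 (\<lambda>x. f s x - f t x - (s - t) * f' x)"
  show "((\<lambda>s. ?e f f' s / \<bar>s - t\<bar> + ?e g g' s / \<bar>s - t\<bar>) \<longlongrightarrow> 0) (at t within {0..})"
    using tendsto_add[OF assms(1,2)[unfolded L2_deriv_def]] by simp
  fix s :: real assume s: "s \<ge> 0" "s \<noteq> t"
  have "?e (\<lambda>s x. f s x + g s x) (\<lambda>x. f' x + g' x) s
     = normL2 (\<lambda>x. (f s x - f t x - (s - t) * f' x) + (g s x - g t x - (s - t) * g' x))"
    by (rule arg_cong[where f=normL2]) (auto simp: algebra_simps)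
  also have "\<dots> \<le> ?e f f' s + ?e g g' s"
    using s assms by (intro normL2_triangle L2_diff L2_scale) auto
  finally show "\<bar>?e (\<lambda>s x. f s x + g s x) (\<lambda>x. f' x + g' x) s / \<bar>s - t\<bar>\<bar> \<le> ?e f f' s / \<bar>s - t\<bar> + ?e g g' s / \<bar>s - t\<bar>"
    by (simp add: divide_right_mono flip: add_divide_distrib)
qed

lemma L2_deriv_scale:
  assumes "L2_deriv f f' t"
  shows "L2_deriv (\<lambda>s x. r * f s x) (\<lambda>x. r * f' x) t"
  unfolding L2_deriv_def
proof (rule tendsto_zero_le)
  let ?e = "\<lambda>f f' s. normL2 (\<lambda>x. f s x - f t x - (s - t) * f' x)"
  show "((\<lambda>s. \<bar>r\<bar> * (?e f f' s / \<bar>s - t\<bar>)) \<longlongrightarrow> 0) (at t within {0..})"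
    using tendsto_mult_right_zero[OF assms[unfolded L2_deriv_def]] .
  fix s :: real assume s: "s \<ge> 0" "s \<noteq> t"
  have "(\<lambda>x. r * f s x - r * f t x - (s - t) * (r * f' x)) = (\<lambda>x. r * (f s x - f t x - (s - t) * f' x))"
    by (auto simp: algebra_simps)
  then show "\<bar>?e (\<lambda>s x. r * f s x) (\<lambda>x. r * f' x) s / \<bar>s - t\<bar>\<bar> \<le> \<bar>r\<bar> * (?e f f' s / \<bar>s - t\<bar>)"
    by (simp add: normL2_scale)
qed

lemma L2_deriv_reflect:
  assumes "L2_deriv f f' t" "t \<ge> 0" and f: "\<And>s. s \<ge> 0 \<Longrightarrow> f s \<in> L2" "f' \<in> L2"
  shows "L2_deriv (\<lambda>s x. f s (1 - x)) (\<lambda>x. f' (1 - x)) t"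
  unfolding L2_deriv_def
proof (rule tendsto_zero_le[OF assms(1)[unfolded L2_deriv_def]])
  fix s :: real assume s: "s \<ge> 0" "s \<noteq> t"
  have "(\<lambda>x. f s x - f t x - (s - t) * f' x) \<in> L2" using s assms by (intro L2_diff L2_scale) auto
  from reflect_L2(2)[OF this]
  show "\<bar>normL2 (\<lambda>x. f s (1 - x) - f t (1 - x) - (s - t) * f' (1 - x)) / \<bar>s - t\<bar>\<bar>
      \<le> normL2 (\<lambda>x. f s x - f t x - (s - t) * f' x) / \<bar>s - t\<bar>" by simp
qed

lemma L2_deriv_integral:
  assumes "L2_deriv f f' t" "t \<ge> 0" and f: "\<And>s. s \<ge> 0 \<Longrightarrow> f s \<in> L2" "f' \<in> L2"
  shows "((\<lambda>s. \<integral>x. f s x \<partial>I01) has_real_derivative (\<integral>x. f' x \<partial>I01)) (at t within {0..})"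
proof (rule has_real_derivative_estimate[OF assms(1)[unfolded L2_deriv_def]])
  fix s :: real assume s: "s \<ge> 0" "s \<noteq> t"
  have "(\<lambda>x. f s x - f t x - (s - t) * f' x) \<in> L2" using s assms by (intro L2_diff L2_scale) auto
  from integral_le_normL2[OF this]
  show "\<bar>(\<integral>x. f s x \<partial>I01) - (\<integral>x. f t x \<partial>I01) - (s - t) * (\<integral>x. f' x \<partial>I01)\<bar>
     \<le> \<bar>s - t\<bar> * (normL2 (\<lambda>x. f s x - f t x - (s - t) * f' x) / \<bar>s - t\<bar>)"
    using s L2_integrable[OF f(1)[OF s(1)]] L2_integrable[OF f(1)[OF assms(2)]] L2_integrable[OF f(2)] by simp
qed

text \<open>The remainder of the product splits into the product of the two increments, f times the
  remainder of g, and the remainder of f times g. By Cauchy-Schwarz the first is quadratic in s - t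
  and the others are o(s - t).\<close>

lemma L2_deriv_product:
  assumes df: "L2_deriv f f' t" and dg: "L2_deriv g g' t" and t: "t \<ge> 0"
    and f: "\<And>s. s \<ge> 0 \<Longrightarrow> f s \<in> L2" "f' \<in> L2" and g: "\<And>s. s \<ge> 0 \<Longrightarrow> g s \<in> L2" "g' \<in> L2"
    and w: "w \<in> borel_measurable I01" "\<And>x. x \<in> {0..1} \<Longrightarrow> \<bar>w x\<bar> \<le> C"
  shows "((\<lambda>s. \<integral>x. w x * (f s x * g s x) \<partial>I01) has_real_derivative
    (\<integral>x. w x * (f' x * g t x) \<partial>I01) + (\<integral>x. w x * (f t x * g' x) \<partial>I01)) (at t within {0..})"
proof (rule has_real_derivative_estimate)
  let ?ef = "\<lambda>s. normL2 (\<lambda>x. f s x - f t x - (s - t) * f' x) / \<bar>s - t\<bar>"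
  let ?eg = "\<lambda>s. normL2 (\<lambda>x. g s x - g t x - (s - t) * g' x) / \<bar>s - t\<bar>"
  \<comment> \<open>Bounds the three parts of the remainder after division by |s - t|; increments
    are estimated through the derivatives as in \<open>incr\<close>.\<close>
  let ?e = "\<lambda>s. C * (\<bar>s - t\<bar> * (normL2 f' + ?ef s) * (normL2 g' + ?eg s) + normL2 (f t) * ?eg s + ?ef s * normL2 (g t))"
  have lims: "(?ef \<longlongrightarrow> 0) (at t within {0..})" "(?eg \<longlongrightarrow> 0) (at t within {0..})"
    using df dg by (simp_all add: L2_deriv_def)
  have "((\<lambda>s. \<bar>s - t\<bar>) \<longlongrightarrow> \<bar>t - t\<bar>) (at t within {0..})"
    by (intro tendsto_intros)
  then have "((\<lambda>s. \<bar>s - t\<bar>) \<longlongrightarrow> 0) (at t within {0..})" by simp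
  then have "(?e \<longlongrightarrow> C * (0 * (normL2 f' + 0) * (normL2 g' + 0) + normL2 (f t) * 0 + 0 * normL2 (g t))) (at t within {0..})"
    by (intro tendsto_intros lims)
  then show "(?e \<longlongrightarrow> 0) (at t within {0..})" by simp
  fix s :: real assume s: "s \<ge> 0" "s \<noteq> t"
  let ?h = "s - t"
  let ?E = "\<lambda>x. f s x - f t x - ?h * f' x" and ?F = "\<lambda>x. g s x - g t x - ?h * g' x"
  note L = f(1)[OF s(1)] f(1)[OF t] f(2) g(1)[OF s(1)] g(1)[OF t] g(2)
  have E: "?E \<in> L2" and F: "?F \<in> L2" by (intro L2_diff L2_scale L)+
  have df2: "(\<lambda>x. f s x - f t x) \<in> L2" and dg2: "(\<lambda>x. g s x - g t x) \<in> L2" by (intro L2_diff L)+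
  have C: "C \<ge> 0" using w(2)[of 0] by simp
  have int: "integrable I01 (\<lambda>x. w x * (a x * b x))" if "a \<in> L2" "b \<in> L2" for a b
    using L2_mult_integrable[OF L2_bounded_mult[OF that(1) w] that(2)] by (simp add: mult.assoc)
  have bnd: "\<bar>\<integral>x. w x * (a x * b x) \<partial>I01\<bar> \<le> C * (normL2 a * normL2 b)" if "a \<in> L2" "b \<in> L2" for a b
  proof -
    have "\<bar>\<integral>x. w x * (a x * b x) \<partial>I01\<bar> = \<bar>\<integral>x. (w x * a x) * b x \<partial>I01\<bar>" by (simp add: mult.assoc)
    also have "\<dots> \<le> normL2 (\<lambda>x. w x * a x) * normL2 b"
      by (rule normL2_Cauchy_Schwarz[OF L2_bounded_mult[OF that(1) w] that(2)])
    also have "\<dots> \<le> (C * normL2 a) * normL2 b"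
      by (intro mult_right_mono normL2_bounded_mult[OF that(1) w]) simp_all
    finally show ?thesis by (simp add: mult.assoc)
  qed
  have incr: "normL2 (\<lambda>x. a s x - a t x) \<le> \<bar>?h\<bar> * (normL2 a' + normL2 (\<lambda>x. a s x - a t x - ?h * a' x) / \<bar>?h\<bar>)"
    if "a s \<in> L2" "a t \<in> L2" "a' \<in> L2" for a a'
  proof -
    have "normL2 (\<lambda>x. a s x - a t x) = normL2 (\<lambda>x. ?h * a' x + (a s x - a t x - ?h * a' x))" by simp
    also have "\<dots> \<le> normL2 (\<lambda>x. ?h * a' x) + normL2 (\<lambda>x. a s x - a t x - ?h * a' x)"
      by (intro normL2_triangle L2_scale L2_diff that)
    finally show ?thesis using s by (simp add: normL2_scale distrib_left)
  qed
  let ?D = "(\<integral>x. w x * (f' x * g t x) \<partial>I01) + (\<integral>x. w x * (f t x * g' x) \<partial>I01)"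
  have "(\<integral>x. w x * (f s x * g s x) \<partial>I01) - (\<integral>x. w x * (f t x * g t x) \<partial>I01) - ?h * ?D
    = (\<integral>x. w x * (f s x * g s x) - w x * (f t x * g t x)
         - (?h * (w x * (f' x * g t x)) + ?h * (w x * (f t x * g' x))) \<partial>I01)"
    using int L by (simp add: distrib_left)
  also have "\<dots> = (\<integral>x. w x * ((f s x - f t x) * (g s x - g t x)) + w x * (f t x * ?F x) + w x * (?E x * g t x) \<partial>I01)"
    by (intro Bochner_Integration.integral_cong) (auto simp: algebra_simps)
  also have "\<dots> = (\<integral>x. w x * ((f s x - f t x) * (g s x - g t x)) \<partial>I01)
      + (\<integral>x. w x * (f t x * ?F x) \<partial>I01) + (\<integral>x. w x * (?E x * g t x) \<partial>I01)"
    using int[OF df2 dg2] int[OF L(2) F] int[OF E L(5)] by simp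
  finally have eq: "(\<integral>x. w x * (f s x * g s x) \<partial>I01) - (\<integral>x. w x * (f t x * g t x) \<partial>I01) - ?h * ?D
    = (\<integral>x. w x * ((f s x - f t x) * (g s x - g t x)) \<partial>I01)
      + (\<integral>x. w x * (f t x * ?F x) \<partial>I01) + (\<integral>x. w x * (?E x * g t x) \<partial>I01)" .
  have "\<bar>(\<integral>x. w x * (f s x * g s x) \<partial>I01) - (\<integral>x. w x * (f t x * g t x) \<partial>I01) - ?h * ?D\<bar>
    \<le> C * (normL2 (\<lambda>x. f s x - f t x) * normL2 (\<lambda>x. g s x - g t x))
      + C * (normL2 (f t) * normL2 ?F) + C * (normL2 ?E * normL2 (g t))"
    unfolding eq using bnd[OF df2 dg2] bnd[OF L(2) F] bnd[OF E L(5)] by linarith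
  also have "\<dots> \<le> C * ((\<bar>?h\<bar> * (normL2 f' + ?ef s)) * (\<bar>?h\<bar> * (normL2 g' + ?eg s)))
      + C * (normL2 (f t) * normL2 ?F) + C * (normL2 ?E * normL2 (g t))"
    using C L by (intro add_right_mono mult_left_mono mult_mono incr) auto
  also have "\<dots> = \<bar>?h\<bar> * ?e s"
  proof -
    have alg: "C * ((h * (p + a)) * (h * (q + b))) + C * (m * (h * b)) + C * ((h * a) * n)
      = h * (C * (h * (p + a) * (q + b) + m * b + a * n))" for h p a q b m n :: real
      by (simp add: algebra_simps)
    have "normL2 ?E = \<bar>?h\<bar> * ?ef s" "normL2 ?F = \<bar>?h\<bar> * ?eg s" using s by simp_all
    then show ?thesis using alg[of "\<bar>?h\<bar>" "normL2 f'" "?ef s" "normL2 g'" "?eg s" "normL2 (f t)" "normL2 (g t)"]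
      by simp
  qed
  finally show "\<bar>(\<integral>x. w x * (f s x * g s x) \<partial>I01) - (\<integral>x. w x * (f t x * g t x) \<partial>I01) - ?h * ?D\<bar> \<le> \<bar>?h\<bar> * ?e s" .
qed

section \<open>Estimates in the Sobolev space of order one\<close>

text \<open>Integrating the derivative of (1 - x) F over [0,1] expresses F 0 through the integrals
  of F and of (1 - x) f.\<close>

lemma AC_trace_bound:
  assumes "AC F f" "f \<in> L2"
  shows "\<bar>F 0\<bar> \<le> normL2 F + normL2 f"
proof -
  have F: "F \<in> L2" by (rule AC_L2[OF assms(1)])
  have wf: "(\<lambda>x. (1 - x) * f x) \<in> L2"
    by (rule L2_bounded_mult[OF assms(2), of _ 1]) (auto intro!: continuous_on_measurable_I01 continuous_intros)
  have "AC (\<lambda>x. 1 - x) (\<lambda>x. -1)"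
    by (rule AC_C1) (auto intro!: derivative_eq_intros)
  from AC_integral[OF AC_mult[OF this assms(1)]]
  have "F 0 = (\<integral>x. F x \<partial>I01) - (\<integral>x. (1 - x) * f x \<partial>I01)"
    using L2_integrable[OF F] L2_integrable[OF wf] by simp
  moreover have "\<bar>\<integral>x. F x \<partial>I01\<bar> \<le> normL2 F" by (rule integral_le_normL2[OF F])
  moreover have "\<bar>\<integral>x. (1 - x) * f x \<partial>I01\<bar> \<le> normL2 (\<lambda>x. (1 - x) * f x)"
    by (rule integral_le_normL2[OF wf])
  moreover have "normL2 (\<lambda>x. (1 - x) * f x) \<le> 1 * normL2 f"
    by (rule normL2_bounded_mult[OF assms(2)]) (auto intro!: continuous_on_measurable_I01 continuous_intros)
  ultimately show ?thesis by linarith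
qed

text \<open>The right-hand side already bounds F pointwise, and the interval has length one.\<close>

lemma AC_normL2_bound:
  assumes "AC F f" "f \<in> L2"
  shows "normL2 F \<le> \<bar>F 0\<bar> + normL2 f"
proof -
  have "\<bar>F x\<bar> \<le> \<bar>F 0\<bar> + normL2 f" if x: "x \<in> {0..1}" for x
  proof -
    have m: "(indicator {0..x} :: real \<Rightarrow> real) \<in> borel_measurable I01"
      by (intro borel_measurable_I01) simp
    have b: "\<bar>indicator {0..x} y :: real\<bar> \<le> 1" for y by (simp add: indicator_def)
    have "\<bar>prim f x\<bar> \<le> normL2 (\<lambda>y. indicator {0..x} y * f y)"
      unfolding prim_def by (rule integral_le_normL2[OF L2_bounded_mult[OF assms(2) m b]])
    also have "\<dots> \<le> 1 * normL2 f" by (rule normL2_bounded_mult[OF assms(2) m b])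
    finally show ?thesis using AC_eq[OF assms(1) x] by simp
  qed
  then have "normL2 (\<lambda>x. F x * 1) \<le> (\<bar>F 0\<bar> + normL2 f) * normL2 (\<lambda>x. 1)"
    by (intro normL2_bounded_mult L2_const continuous_on_measurable_I01 AC_continuous_on[OF assms(1)])
  then show ?thesis by (simp add: normL2_def measure_restrict_space)
qed

section \<open>Decay of classical solutions\<close>

lemma st_diff_simp: "st_diff (X, u, v) (Y, w, y) = (X - Y, \<lambda>x. u x - w x, \<lambda>x. v x - y x)"
  by (simp add: st_diff_def st_add_def st_scale_def)

lemma st_increment_simp:
  "st_diff (st_diff (X, u, v) (X', u', v')) (st_scale r (Y, w, y))
     = (X - X' - r *\<^sub>R Y, \<lambda>x. u x - u' x - r * w x, \<lambda>x. v x - v' x - r * y x)"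
  by (simp add: st_diff_def st_add_def st_scale_def)

lemma normH_power2:
  "(normH c (X, u, v))\<^sup>2 = (norm X)\<^sup>2 + (normL2 u)\<^sup>2 + c\<^sup>2 * (normL2 (wderiv u))\<^sup>2 + (normL2 v)\<^sup>2"
  by (simp add: normH_def)

lemma normH_nonneg [simp]: "normH c z \<ge> 0"
  by (cases z) (simp add: normH_def)

lemma normH_components:
  shows "norm X \<le> normH c (X, u, v)" "normL2 u \<le> normH c (X, u, v)"
    "\<bar>c\<bar> * normL2 (wderiv u) \<le> normH c (X, u, v)" "normL2 v \<le> normH c (X, u, v)"
  unfolding normH_def prod.case
  by (auto intro!: real_le_rsqrt simp: power_mult_distrib)

lemma normH_le_sum:
  "normH c (X, u, v) \<le> norm X + normL2 u + \<bar>c\<bar> * normL2 (wderiv u) + normL2 v"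
proof -
  have sq: "a\<^sup>2 + b\<^sup>2 + d\<^sup>2 + e\<^sup>2 \<le> (a + b + d + e)\<^sup>2" if "a \<ge> 0" "b \<ge> 0" "d \<ge> 0" "e \<ge> 0" for a b d e :: real
  proof -
    have "0 \<le> a * b + a * d + a * e + b * d + b * e + d * e" using that by simp
    moreover have "(a + b + d + e)\<^sup>2 = a\<^sup>2 + b\<^sup>2 + d\<^sup>2 + e\<^sup>2 + 2 * (a * b + a * d + a * e + b * d + b * e + d * e)"
      by (simp add: power2_eq_square algebra_simps)
    ultimately show ?thesis by simp
  qed
  show ?thesis
    by (rule power2_le_imp_le) (use sq[of "norm X" "normL2 u" "\<bar>c\<bar> * normL2 (wderiv u)" "normL2 v"] in
      \<open>auto simp: normH_power2 power_mult_distrib\<close>)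
qed

lemma normH_AE_cong:
  assumes "AE x in I01. u x = u' x" "AE x in I01. wderiv u x = wderiv u' x" "AE x in I01. v x = v' x"
  shows "normH c (X, u, v) = normH c (X, u', v')"
  using assms[THEN normL2_AE_cong] by (simp add: normH_def)

lemma dom_TD:
  assumes "(X, u, v) \<in> dom_T c0 K"
  shows "weak_deriv u (wderiv u)" "weak_deriv (wderiv u) (wderiv (wderiv u))" "weak_deriv v (wderiv v)"
    "cont_rep u 0 = (K *v X) $ 1" "cont_rep (wderiv u) 1 = - c0 * cont_rep v 1"
  using assms by (auto simp: dom_T_def Hsob_2_iff Hsob_1_iff simp del: Hsob.simps One_nat_def)

lemma weak_deriv_L2: "weak_deriv f g \<Longrightarrow> f \<in> L2" "weak_deriv f g \<Longrightarrow> g \<in> L2"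
  by (simp_all add: weak_deriv_def)

lemma cont_rep_AC: "weak_deriv f g \<Longrightarrow> AC (cont_rep f) g"
  by (rule weak_deriv_cont_rep)

text \<open>The Riemann coordinates \<open>u\<^sub>t + c u\<^sub>x\<close> and \<open>u\<^sub>t - c u\<^sub>x\<close>; the second one, which travels
  to the right, is reflected so that both are transported to the left.\<close>

definition chi :: "real \<Rightarrow> (real \<Rightarrow> real) \<Rightarrow> (real \<Rightarrow> real) \<Rightarrow> 2 \<Rightarrow> real \<Rightarrow> real" where
  "chi c u v i x = (if i = 1 then cont_rep v x + c * cont_rep (wderiv u) x
     else cont_rep v (1 - x) - c * cont_rep (wderiv u) (1 - x))"

definition chi' :: "real \<Rightarrow> (real \<Rightarrow> real) \<Rightarrow> (real \<Rightarrow> real) \<Rightarrow> 2 \<Rightarrow> real \<Rightarrow> real" where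
  "chi' c u v i x = (if i = 1 then wderiv v x + c * wderiv (wderiv u) x
     else c * wderiv (wderiv u) (1 - x) - wderiv v (1 - x))"

context
  fixes c c0 :: real and K :: "real^'n::finite^1" and X :: "real^'n" and u v :: "real \<Rightarrow> real"
  assumes dom: "(X, u, v) \<in> dom_T c0 K"
begin

lemma chi_AC: "AC (chi c u v i) (chi' c u v i)"
proof -
  note v = cont_rep_AC[OF dom_TD(3)[OF dom]] and r = AC_scale[OF cont_rep_AC[OF dom_TD(2)[OF dom]], of c]
  show ?thesis
  proof (cases "i = 1")
    case True
    then show ?thesis using AC_add[OF v r] by (simp add: chi_def[abs_def] chi'_def[abs_def])
  next
    case False
    have "AC (\<lambda>x. cont_rep v (1 - x) - c * cont_rep (wderiv u) (1 - x))
        (\<lambda>x. - wderiv v (1 - x) - - (c * wderiv (wderiv u) (1 - x)))"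
      by (rule AC_diff[OF AC_reflect[OF v] AC_reflect[OF r]])
    then show ?thesis using False by (simp add: chi_def[abs_def] chi'_def[abs_def])
  qed
qed

lemma chi_L2: "chi c u v i \<in> L2"
  by (rule AC_L2[OF chi_AC])

lemma chi'_L2: "chi' c u v i \<in> L2"
proof -
  note L = weak_deriv_L2(2)[OF dom_TD(2)[OF dom]] weak_deriv_L2(2)[OF dom_TD(3)[OF dom]]
  show ?thesis
    using L2_add[OF L(2) L2_scale[OF L(1), of c]]
      L2_diff[OF L2_scale[OF reflect_L2(1)[OF L(1)], of c] reflect_L2(1)[OF L(2)]]
    by (cases "i = 1") (simp_all add: chi'_def[abs_def])
qed

text \<open>Parallelogram identity for v + c u_x and v - c u_x; reflection preserves the
  norm.\<close>

lemma sqnorms_chi: "sqnorms (chi c u v) = 2 * (normL2 v)\<^sup>2 + 2 * c\<^sup>2 * (normL2 (wderiv u))\<^sup>2"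
proof -
  let ?w = "cont_rep v" and ?r = "cont_rep (wderiv u)"
  have w: "?w \<in> L2" and r: "(\<lambda>x. c * ?r x) \<in> L2"
    using cont_rep_AC[OF dom_TD(3)[OF dom]] cont_rep_AC[OF dom_TD(2)[OF dom]]
    by (auto intro: AC_L2 L2_scale)
  have "normL2 (chi c u v 2) = normL2 (\<lambda>x. ?w x - c * ?r x)"
    using reflect_L2(2)[OF L2_diff[OF w r]] by (simp add: chi_def[abs_def])
  moreover have "normL2 (chi c u v 1) = normL2 (\<lambda>x. ?w x + c * ?r x)"
    by (simp add: chi_def[abs_def])
  ultimately have "sqnorms (chi c u v) = (normL2 (\<lambda>x. ?w x + c * ?r x))\<^sup>2 + (normL2 (\<lambda>x. ?w x - c * ?r x))\<^sup>2"
    by (simp only: sqnorms_def sum_2)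
  also have "\<dots> = (\<integral>x. (?w x + c * ?r x)\<^sup>2 \<partial>I01) + (\<integral>x. (?w x - c * ?r x)\<^sup>2 \<partial>I01)"
    by (simp only: normL2_power2)
  also have "\<dots> = (\<integral>x. (?w x + c * ?r x)\<^sup>2 + (?w x - c * ?r x)\<^sup>2 \<partial>I01)"
    using L2_add[OF w r] L2_diff[OF w r] by (simp add: L2_def)
  also have "\<dots> = (\<integral>x. 2 * (?w x)\<^sup>2 + 2 * (c * ?r x)\<^sup>2 \<partial>I01)"
    by (intro Bochner_Integration.integral_cong) (auto simp: power2_eq_square algebra_simps)
  also have "\<dots> = 2 * (normL2 ?w)\<^sup>2 + 2 * (normL2 (\<lambda>x. c * ?r x))\<^sup>2"
    using w r by (simp add: L2_def normL2_power2)
  also have "normL2 ?w = normL2 v"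
    by (rule normL2_AE_cong[OF weak_deriv_cont_rep(2)[OF dom_TD(3)[OF dom]]])
  also have "normL2 (\<lambda>x. c * ?r x) = \<bar>c\<bar> * normL2 (wderiv u)"
    unfolding normL2_scale normL2_AE_cong[OF weak_deriv_cont_rep(2)[OF dom_TD(2)[OF dom]]] ..
  finally show ?thesis by (simp add: power_mult_distrib)
qed

lemma sqnorms_le_normH: "(norm X)\<^sup>2 + sqnorms (chi c u v) \<le> 2 * (normH c (X, u, v))\<^sup>2"
  unfolding sqnorms_chi normH_power2 by (simp add: algebra_simps)

text \<open>The Riemann coordinates see u only through u_x. The boundary condition u(0) = K X
  recovers u from its trace and its derivative: squaring that bound gives 2 k^2, and 2 |u_x|^2 is at
  most \<open>sqnorms\<close> divided by c^2.\<close>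

lemma normH_le_sqnorms:
  assumes "c > 0" and k: "\<And>Y. \<bar>(K *v Y) $ 1\<bar> \<le> k * norm Y"
  shows "(normH c (X, u, v))\<^sup>2 \<le> (1 + 2 * k\<^sup>2 + 1 / c\<^sup>2) * ((norm X)\<^sup>2 + sqnorms (chi c u v))"
proof -
  note wd = dom_TD[OF dom]
  have "normL2 u = normL2 (cont_rep u)"
    by (rule normL2_AE_cong[OF weak_deriv_cont_rep(2)[OF wd(1)], symmetric])
  also have "\<dots> \<le> \<bar>cont_rep u 0\<bar> + normL2 (wderiv u)"
    by (rule AC_normL2_bound[OF cont_rep_AC[OF wd(1)] weak_deriv_L2(2)[OF wd(1)]])
  also have "\<dots> \<le> k * norm X + normL2 (wderiv u)"
    unfolding wd(4) using k[of X] by simp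
  finally have "normL2 u \<le> k * norm X + normL2 (wderiv u)" .
  then have "(normL2 u)\<^sup>2 \<le> (k * norm X + normL2 (wderiv u))\<^sup>2"
    by (rule power_mono) simp
  also have "\<dots> \<le> 2 * k\<^sup>2 * (norm X)\<^sup>2 + 2 * (normL2 (wderiv u))\<^sup>2"
    using sum_squares_bound[of "k * norm X" "normL2 (wderiv u)"] by (simp add: power2_sum power_mult_distrib)
  finally have 1: "(normL2 u)\<^sup>2 \<le> 2 * k\<^sup>2 * (norm X)\<^sup>2 + 2 * (normL2 (wderiv u))\<^sup>2" .
  have 2: "2 * (normL2 (wderiv u))\<^sup>2 \<le> 1 / c\<^sup>2 * sqnorms (chi c u v)"
    unfolding sqnorms_chi using \<open>c > 0\<close> by (simp add: field_simps)
  have 3: "c\<^sup>2 * (normL2 (wderiv u))\<^sup>2 + (normL2 v)\<^sup>2 \<le> sqnorms (chi c u v)"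
    unfolding sqnorms_chi by simp
  have 4: "0 \<le> 1 / c\<^sup>2 * (norm X)\<^sup>2" "0 \<le> 2 * k\<^sup>2 * sqnorms (chi c u v)"
    using sqnorms_nonneg[of "chi c u v"] by simp_all
  have "(normH c (X, u, v))\<^sup>2 \<le> (norm X)\<^sup>2 + (2 * k\<^sup>2 * (norm X)\<^sup>2 + 1 / c\<^sup>2 * sqnorms (chi c u v)) + sqnorms (chi c u v)"
    unfolding normH_power2 using 1 2 3 by linarith
  also have "\<dots> \<le> (1 + 2 * k\<^sup>2 + 1 / c\<^sup>2) * ((norm X)\<^sup>2 + sqnorms (chi c u v))"
    using 4 by (simp add: algebra_simps)
  finally show ?thesis .
qed

text \<open>The means of the two coordinates differ by 2 c (u(1) - u(0)), which explains the factor
  1 / (2 c) and the row (1, -1) in \<open>B_tilde\<close>; the summand B K accounts for u(0) = K X.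
  The condition \<open>v0\<close> is not part of the domain of T; \<open>curve_trace\<close>
  supplies it along curves.\<close>

lemma boundary_values:
  fixes A :: "real^'n^'n" and B :: "real^1^'n"
  assumes c: "c > 0"
    and Y: "Y = A *v X + B *v vec (cont_rep u 1)" and v0: "cont_rep v 0 = (K *v Y) $ 1"
  defines "\<zeta> \<equiv> vjoin (vjoin X (means (chi c u v))) (vector [cont_rep v 1, c * cont_rep (wderiv u) 0] :: real^2)"
  shows "Y = N0 c A B K *v \<zeta>"
    and "(\<chi> i. chi c u v i 0) = G0 c c0 A B K *v \<zeta>"
    and "(\<chi> i. chi c u v i 1) = H0 c c0 A B K *v \<zeta>"
proof -
  let ?r = "cont_rep (wderiv u)" and ?w = "cont_rep v"
  note wd = dom_TD[OF dom]
  have w: "?w \<in> L2" and r: "?r \<in> L2"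
    using AC_L2[OF cont_rep_AC[OF wd(3)]] AC_L2[OF cont_rep_AC[OF wd(2)]] .
  have wr: "(\<lambda>x. ?w x - c * ?r x) \<in> L2" by (intro L2_diff L2_scale w r)
  have "means (chi c u v) $ 2 = (\<integral>x. ?w x - c * ?r x \<partial>I01)"
    using reflect_I01(2)[OF L2_integrable[OF wr]] by (simp add: means_def chi_def[abs_def])
  then have "means (chi c u v) $ 1 - means (chi c u v) $ 2 = 2 * c * (\<integral>x. ?r x \<partial>I01)"
    using L2_integrable[OF w] L2_integrable[OF r] by (simp add: means_def chi_def[abs_def])
  also have "(\<integral>x. ?r x \<partial>I01) = (\<integral>x. wderiv u x \<partial>I01)"
    by (rule integral_cong_AE[OF L2_measurable[OF r] L2_measurable[OF weak_deriv_L2(2)[OF wd(1)]]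
      weak_deriv_cont_rep(2)[OF wd(2)]])
  also have "\<dots> = cont_rep u 1 - cont_rep u 0"
    by (rule AC_integral[OF cont_rep_AC[OF wd(1)]])
  finally have m: "means (chi c u v) $ 1 - means (chi c u v) $ 2 = 2 * c * (cont_rep u 1 - (K *v X) $ 1)"
    unfolding wd(4) .
  have Bt: "B_tilde c B *v m = B *v vec ((m $ 1 - m $ 2) / (2 * c))" for m :: "real^2"
    by (simp add: B_tilde_def vec_eq_iff matrix_vector_mult_def matrix_matrix_mult_def sum_2 vector_2
        diff_divide_distrib right_diff_distrib mult_ac)
  have "N0 c A B K *v \<zeta> = A *v X + B *v (K *v X + vec (cont_rep u 1 - (K *v X) $ 1))"
    unfolding \<zeta>_def N0_mult Bt m using c
    by (simp add: matrix_vector_mult_add_rdistrib matrix_vector_right_distrib matrix_vector_mul_assoc)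
  also have "K *v X + vec (cont_rep u 1 - (K *v X) $ 1) = vec (cont_rep u 1)"
    by (simp add: vec_eq_iff forall_1)
  finally show N: "Y = N0 c A B K *v \<zeta>" by (simp add: Y)
  show "(\<chi> i. chi c u v i 0) = G0 c c0 A B K *v \<zeta>"
    unfolding \<zeta>_def G0_mult unfolding \<zeta>_def[symmetric] N[symmetric]
    by (simp add: vec_eq_iff forall_2 vector_2 chi_def v0 wd(5) algebra_simps)
  show "(\<chi> i. chi c u v i 1) = H0 c c0 A B K *v \<zeta>"
    unfolding \<zeta>_def H0_mult unfolding \<zeta>_def[symmetric] N[symmetric]
    by (simp add: vec_eq_iff forall_2 vector_2 chi_def v0 wd(5) algebra_simps)
qed

end

context
  fixes c c0 :: real and A :: "real^'n::finite^'n" and B :: "real^1^'n" and K :: "real^'n^1"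
    and X :: "real \<Rightarrow> real^'n" and u v :: "real \<Rightarrow> real \<Rightarrow> real" and Y :: "real \<Rightarrow> real^'n"
  assumes c: "c > 0"
    and dom: "\<And>t. t \<ge> 0 \<Longrightarrow> (X t, u t, v t) \<in> dom_T c0 K"
    and Y: "\<And>t. Y t = A *v X t + B *v vec (cont_rep (u t) 1)"
    and der: "\<And>t. t \<ge> 0 \<Longrightarrow> ((\<lambda>s. normH c (X s - X t - (s - t) *\<^sub>R Y t,
        \<lambda>x. u s x - u t x - (s - t) * v t x,
        \<lambda>x. v s x - v t x - (s - t) * (c\<^sup>2 * wderiv (wderiv (u t)) x)) / \<bar>s - t\<bar>) \<longlongrightarrow> 0) (at t within {0..})"
begin

lemma curve_X:
  assumes t: "t \<ge> 0"
  shows "(X has_vector_derivative Y t) (at t within {0..})"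
proof -
  have "((\<lambda>s. norm (X s - X t - (s - t) *\<^sub>R Y t) / norm (s - t)) \<longlongrightarrow> 0) (at t within {0..})"
    by (rule tendsto_zero_le[OF der[OF t]]) (simp add: divide_right_mono normH_components(1))
  then show ?thesis
    unfolding has_vector_derivative_def has_derivative_iff_norm
    by (auto intro: bounded_linear_scaleR_left simp: divide_inverse)
qed

text \<open>The state norm contains u_x, so the difference quotients of u_x converge in L2, and
  their limit is v_x.\<close>

lemma curve_ux:
  assumes t: "t \<ge> 0"
  shows "L2_deriv (\<lambda>s. wderiv (u s)) (wderiv (v t)) t"
  unfolding L2_deriv_def
proof (rule tendsto_zero_le)
  let ?z = "\<lambda>s. normH c (X s - X t - (s - t) *\<^sub>R Y t,
        \<lambda>x. u s x - u t x - (s - t) * v t x,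
        \<lambda>x. v s x - v t x - (s - t) * (c\<^sup>2 * wderiv (wderiv (u t)) x))"
  show "((\<lambda>s. (1 / c) * (?z s / \<bar>s - t\<bar>)) \<longlongrightarrow> 0) (at t within {0..})"
    by (rule tendsto_mult_right_zero[OF der[OF t]])
  fix s :: real assume s: "s \<ge> 0" "s \<noteq> t"
  note w = dom_TD(1)[OF dom[OF s(1)]] dom_TD(1)[OF dom[OF t]] dom_TD(3)[OF dom[OF t]]
  have "AE x in I01. wderiv (\<lambda>x. u s x - u t x - (s - t) * v t x) x
      = wderiv (u s) x - wderiv (u t) x - (s - t) * wderiv (v t) x"
    by (intro wderiv_AE weak_deriv_diff weak_deriv_scale w)
  then have eq: "normL2 (wderiv (\<lambda>x. u s x - u t x - (s - t) * v t x))
      = normL2 (\<lambda>x. wderiv (u s) x - wderiv (u t) x - (s - t) * wderiv (v t) x)"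
    by (rule normL2_AE_cong)
  have "c * normL2 (\<lambda>x. wderiv (u s) x - wderiv (u t) x - (s - t) * wderiv (v t) x) \<le> ?z s"
    using normH_components(3)[of c "\<lambda>x. u s x - u t x - (s - t) * v t x"] c unfolding eq by simp
  then have "normL2 (\<lambda>x. wderiv (u s) x - wderiv (u t) x - (s - t) * wderiv (v t) x) \<le> 1 / c * ?z s"
    using c by (simp add: field_simps)
  then show "\<bar>normL2 (\<lambda>x. wderiv (u s) x - wderiv (u t) x - (s - t) * wderiv (v t) x) / \<bar>s - t\<bar>\<bar>
      \<le> 1 / c * (?z s / \<bar>s - t\<bar>)"
    by (simp add: divide_right_mono del: times_divide_eq_left)
qed

lemma curve_v:
  assumes t: "t \<ge> 0"
  shows "L2_deriv v (\<lambda>x. c\<^sup>2 * wderiv (wderiv (u t)) x) t"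
  unfolding L2_deriv_def
  by (rule tendsto_zero_le[OF der[OF t]]) (simp add: divide_right_mono normH_components(4))

text \<open>Comes from differentiating u(0) = K X in time. Evaluation at 0 is bounded in the state
  norm by \<open>AC_trace_bound\<close>, so the time derivative passes to the trace. The result is
  the compatibility condition that \<open>dom_T\<close> does not contain.\<close>

lemma curve_trace:
  assumes t: "t \<ge> 0"
  shows "cont_rep (v t) 0 = (K *v Y t) $ 1"
proof -
  have "((\<lambda>s. cont_rep (u s) 0) has_real_derivative cont_rep (v t) 0) (at t within {0..})"
  proof (rule has_real_derivative_estimate)
    let ?z = "\<lambda>s. normH c (X s - X t - (s - t) *\<^sub>R Y t,
          \<lambda>x. u s x - u t x - (s - t) * v t x,
          \<lambda>x. v s x - v t x - (s - t) * (c\<^sup>2 * wderiv (wderiv (u t)) x))"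
    show "((\<lambda>s. (1 + 1 / c) * (?z s / \<bar>s - t\<bar>)) \<longlongrightarrow> 0) (at t within {0..})"
      by (rule tendsto_mult_right_zero[OF der[OF t]])
    fix s :: real assume s: "s \<ge> 0" "s \<noteq> t"
    note w = dom_TD(1)[OF dom[OF s(1)]] dom_TD(1)[OF dom[OF t]] dom_TD(3)[OF dom[OF t]]
    let ?f = "\<lambda>x. u s x - u t x - (s - t) * v t x"
    let ?F = "\<lambda>x. cont_rep (u s) x - cont_rep (u t) x - (s - t) * cont_rep (v t) x"
    have wf: "weak_deriv ?f (wderiv ?f)"
      by (rule weak_deriv_wderiv[OF weak_deriv_diff[OF weak_deriv_diff[OF w(1,2)] weak_deriv_scale[OF w(3)]]])
    have F1: "AC ?F (\<lambda>x. wderiv (u s) x - wderiv (u t) x - (s - t) * wderiv (v t) x)"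
      by (intro AC_diff AC_scale cont_rep_AC w)
    have F2: "AE x in I01. wderiv (u s) x - wderiv (u t) x - (s - t) * wderiv (v t) x = wderiv ?f x"
      using wderiv_AE[OF weak_deriv_diff[OF weak_deriv_diff[OF w(1,2)] weak_deriv_scale[OF w(3), of "s - t"]]]
      by eventually_elim simp
    have AC: "AC ?F (wderiv ?f)" by (rule AC_cong[OF F1 refl F2])
    have "AE x in I01. ?F x = ?f x"
      using w[THEN weak_deriv_cont_rep(2)] by eventually_elim simp
    from AC_trace_bound[OF AC weak_deriv_L2(2)[OF wf]] normL2_AE_cong[OF this]
    have "\<bar>?F 0\<bar> \<le> normL2 ?f + normL2 (wderiv ?f)" by simp
    also have "\<dots> \<le> ?z s + 1 / c * ?z s"
    proof (rule add_mono)
      show "normL2 ?f \<le> ?z s" by (rule normH_components)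
      have "\<bar>c\<bar> * normL2 (wderiv ?f) \<le> ?z s" by (rule normH_components)
      then show "normL2 (wderiv ?f) \<le> 1 / c * ?z s" using c by (simp add: field_simps)
    qed
    also have "\<dots> = \<bar>s - t\<bar> * ((1 + 1 / c) * (?z s / \<bar>s - t\<bar>))"
      using s by (simp add: distrib_right)
    finally show "\<bar>?F 0\<bar> \<le> \<bar>s - t\<bar> * ((1 + 1 / c) * (?z s / \<bar>s - t\<bar>))" .
  qed
  moreover have "((\<lambda>s. (K *v X s) $ 1) has_real_derivative (K *v Y t) $ 1) (at t within {0..})"
  proof -
    have "bounded_linear (\<lambda>x. (K *v x) $ 1)"
      using bounded_linear_compose[OF bounded_linear_vec_nth matrix_vector_mul_bounded_linear] .
    from bounded_linear.has_vector_derivative[OF this curve_X[OF t]]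
    show ?thesis by (simp add: has_real_derivative_iff_has_vector_derivative)
  qed
  then have "((\<lambda>s. cont_rep (u s) 0) has_real_derivative (K *v Y t) $ 1) (at t within {0..})"
    by (rule has_field_derivative_transform_within[of _ _ _ _ 1]) (use t dom_TD(4)[OF dom] in auto)
  ultimately show ?thesis
    unfolding has_field_derivative_iff
    by (rule tendsto_unique[rotated]) (rule at_within_Ici_nontrivial[OF t])
qed

text \<open>v + c u_x and v - c u_x satisfy transport equations with speeds of opposite sign. The
  reflection reverses the x-derivative of the second one, so that both have c times the x-derivative
  as time derivative.\<close>

lemma curve_chi:
  assumes t: "t \<ge> 0"
  shows "L2_deriv (\<lambda>s. chi c (u s) (v s) i) (\<lambda>x. c * chi' c (u t) (v t) i x) t"
proof -
  note dT = dom_TD[OF dom]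
  have uL: "wderiv (u s) \<in> L2" "wderiv (wderiv (u s)) \<in> L2" "v s \<in> L2" "wderiv (v s) \<in> L2" if "s \<ge> 0" for s
    using dT(2)[OF that] dT(3)[OF that] by (auto dest: weak_deriv_L2)
  have crL: "cont_rep (wderiv (u s)) \<in> L2" "cont_rep (v s) \<in> L2" if "s \<ge> 0" for s
    using cont_rep_AC[OF dT(2)[OF that]] cont_rep_AC[OF dT(3)[OF that]] by (auto intro: AC_L2)
  have r: "L2_deriv (\<lambda>s x. c * cont_rep (wderiv (u s)) x) (\<lambda>x. c * wderiv (v t) x) t"
    by (rule L2_deriv_scale[OF L2_deriv_cong[OF curve_ux[OF t] t]])
      (simp_all add: eq_commute[of "wderiv _ _"] weak_deriv_cont_rep(2)[OF dT(2)])
  have w: "L2_deriv (\<lambda>s. cont_rep (v s)) (\<lambda>x. c\<^sup>2 * wderiv (wderiv (u t)) x) t"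
    by (rule L2_deriv_cong[OF curve_v[OF t] t])
      (simp_all add: eq_commute[of "v _ _"] weak_deriv_cont_rep(2)[OF dT(3)])
  show ?thesis
  proof (cases "i = 1")
    case True
    have "L2_deriv (\<lambda>s x. cont_rep (v s) x + c * cont_rep (wderiv (u s)) x)
       (\<lambda>x. c\<^sup>2 * wderiv (wderiv (u t)) x + c * wderiv (v t) x) t"
      by (intro L2_deriv_add w r t L2_scale crL uL)
    then show ?thesis
      using True by (simp add: chi_def[abs_def] chi'_def[abs_def] power2_eq_square algebra_simps)
  next
    case False
    have "L2_deriv (\<lambda>s x. cont_rep (v s) (1 - x) + (-1) * (c * cont_rep (wderiv (u s)) (1 - x)))
       (\<lambda>x. c\<^sup>2 * wderiv (wderiv (u t)) (1 - x) + (-1) * (c * wderiv (v t) (1 - x))) t"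
      by (intro L2_deriv_add L2_deriv_scale[of _ _ _ "-1"] L2_deriv_reflect[OF w] L2_deriv_reflect[OF r] t
          L2_scale[of _ "-1"] reflect_L2(1)[of "cont_rep _"] reflect_L2(1)[of "\<lambda>x. _ * _ x"] L2_scale crL uL)
    then show ?thesis
      using False by (simp add: chi_def[abs_def] chi'_def[abs_def] power2_eq_square algebra_simps)
  qed
qed

text \<open>The factor 2 comes from the symmetry of P0. The integral part is left polarised here; it
  is integrated by parts only in \<open>lyap_dissipation\<close>.\<close>

lemma curve_lyap:
  fixes P0 :: "real^('n + 2)^('n + 2)"
  assumes t: "t \<ge> 0" and P0: "transpose P0 = P0"
  defines "f \<equiv> chi c (u t) (v t)" and "f' \<equiv> chi' c (u t) (v t)"
  shows "((\<lambda>s. lyap P0 S R (X s) (chi c (u s) (v s))) has_real_derivative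
    2 * (vjoin (Y t) (c *\<^sub>R means f') \<bullet> (P0 *v vjoin (X t) (means f)))
      + c * (lyap_int S R f' f + lyap_int S R f f')) (at t within {0..})"
proof -
  let ?chi = "\<lambda>s. chi c (u s) (v s)"
  have L: "?chi s i \<in> L2" if "s \<ge> 0" for s i by (rule chi_L2[OF dom[OF that]])
  have L': "(\<lambda>x. c * f' i x) \<in> L2" for i unfolding f'_def by (intro L2_scale chi'_L2[OF dom[OF t]])
  note d = curve_chi[OF t, folded f'_def]
  have m: "((\<lambda>s. means (?chi s)) has_vector_derivative c *\<^sub>R means f') (at t within {0..})"
  proof -
    have "((\<lambda>s. means (?chi s) $ i) has_vector_derivative (c *\<^sub>R means f') $ i) (at t within {0..})" for i
      using L2_deriv_integral[OF d[of i] t L L'] by (simp add: means_def has_real_derivative_iff_has_vector_derivative)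
    then show ?thesis
      unfolding has_vector_derivative_def
      by (subst has_derivative_componentwise_within) (auto simp: Basis_vec_def inner_axis mult.assoc)
  qed
  have xi: "((\<lambda>s. vjoin (X s) (means (?chi s))) has_vector_derivative vjoin (Y t) (c *\<^sub>R means f')) (at t within {0..})"
    using bounded_linear.has_vector_derivative[OF bounded_linear_vjoin has_vector_derivative_Pair[OF curve_X[OF t] m]]
    by simp
  have "((\<lambda>s. vjoin (X s) (means (?chi s)) \<bullet> (P0 *v vjoin (X s) (means (?chi s)))) has_vector_derivative
     vjoin (X t) (means f) \<bullet> (P0 *v vjoin (Y t) (c *\<^sub>R means f'))
      + vjoin (Y t) (c *\<^sub>R means f') \<bullet> (P0 *v vjoin (X t) (means f))) (at t within {0..})"
    unfolding f_def
    by (rule bounded_bilinear.has_vector_derivative[OF bounded_bilinear_inner xi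
        bounded_linear.has_vector_derivative[OF matrix_vector_mul_bounded_linear xi]])
  then have 1: "((\<lambda>s. vjoin (X s) (means (?chi s)) \<bullet> (P0 *v vjoin (X s) (means (?chi s)))) has_real_derivative
     2 * (vjoin (Y t) (c *\<^sub>R means f') \<bullet> (P0 *v vjoin (X t) (means f)))) (at t within {0..})"
    by (simp add: has_real_derivative_iff_has_vector_derivative sym_inner_commute[OF P0, of "vjoin (X t) (means f)"])
  have "((\<lambda>s. lyap_int S R (?chi s) (?chi s)) has_real_derivative
      (\<Sum>i\<in>UNIV. \<Sum>j\<in>UNIV. (\<integral>x. (S $ i $ j + x * R $ i $ j) * ((c * f' i x) * f j x) \<partial>I01)
        + (\<integral>x. (S $ i $ j + x * R $ i $ j) * (f i x * (c * f' j x)) \<partial>I01))) (at t within {0..})"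
    unfolding lyap_int_def f_def
    by (intro DERIV_sum L2_deriv_product[OF d d t L L' L L' weight_measurable weight_bound])
  also have "(\<Sum>i\<in>UNIV. \<Sum>j\<in>UNIV. (\<integral>x. (S $ i $ j + x * R $ i $ j) * ((c * f' i x) * f j x) \<partial>I01)
        + (\<integral>x. (S $ i $ j + x * R $ i $ j) * (f i x * (c * f' j x)) \<partial>I01))
     = c * (lyap_int S R f' f + lyap_int S R f f')"
  proof -
    have e: "(\<integral>x. w x * ((c * a x) * b x) \<partial>I01) = c * (\<integral>x. w x * (a x * b x) \<partial>I01)"
      "(\<integral>x. w x * (a x * (c * b x)) \<partial>I01) = c * (\<integral>x. w x * (a x * b x) \<partial>I01)" for w a b :: "real \<Rightarrow> real"
      by (simp_all flip: integral_mult_right_zero add: mult_ac)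
    show ?thesis
      unfolding lyap_int_def e by (simp only: distrib_left[symmetric] sum_distrib_left[symmetric] sum.distrib[symmetric])
  qed
  finally have 2: "((\<lambda>s. lyap_int S R (?chi s) (?chi s)) has_real_derivative
      c * (lyap_int S R f' f + lyap_int S R f f')) (at t within {0..})" .
  show ?thesis unfolding lyap_def by (rule DERIV_add[OF 1 2])
qed

end

text \<open>exp(\<delta> t) V is nonincreasing. The inequality is required only in the open
  interval, and \<delta> may be negative, in which case this is Gronwall's growth bound.\<close>

lemma exponential_decay:
  fixes V V' :: "real \<Rightarrow> real"
  assumes t: "t \<ge> 0"
    and der: "\<And>s. 0 \<le> s \<Longrightarrow> s \<le> t \<Longrightarrow> (V has_real_derivative V' s) (at s within {0..})"
    and le: "\<And>s. 0 < s \<Longrightarrow> s < t \<Longrightarrow> V' s \<le> - \<delta> * V s"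
  shows "V t \<le> exp (- \<delta> * t) * V 0"
proof -
  let ?g = "\<lambda>t. exp (\<delta> * t) * V t"
  have g: "(?g has_real_derivative exp (\<delta> * s) * (\<delta> * V s + V' s)) (at s within {0..})" if "0 \<le> s" "s \<le> t" for s
    by (rule derivative_eq_intros der[OF that] refl | simp add: algebra_simps)+
  have "?g t \<le> ?g 0"
  proof (rule DERIV_nonpos_imp_decreasing_open[OF t])
    fix s assume s: "0 < s" "s < t"
    have "at s within {0..} = at s" by (rule at_within_open_subset[of s "{0<..}"]) (use s in auto)
    then have "(?g has_real_derivative exp (\<delta> * s) * (\<delta> * V s + V' s)) (at s)" using g[of s] s by simp
    moreover have "exp (\<delta> * s) * (\<delta> * V s + V' s) \<le> 0"
      using le[of s] s by (intro mult_nonneg_nonpos) auto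
    ultimately show "\<exists>y. (?g has_real_derivative y) (at s) \<and> y \<le> 0" by blast
  next
    show "continuous_on {0..t} ?g"
      by (rule DERIV_continuous_on[OF DERIV_subset[OF g]]) auto
  qed
  then have "exp (- \<delta> * t) * ?g t \<le> exp (- \<delta> * t) * ?g 0" by (intro mult_left_mono) auto
  then show ?thesis by (simp add: mult.assoc[symmetric] exp_add[symmetric])
qed

definition H_deriv :: "real \<Rightarrow> (real \<Rightarrow> 'n::finite state) \<Rightarrow> 'n state \<Rightarrow> real \<Rightarrow> bool" where
  "H_deriv c D z t \<longleftrightarrow>
     ((\<lambda>s. normH c (st_diff (st_diff (D s) (D t)) (st_scale (s - t) z)) / \<bar>s - t\<bar>) \<longlongrightarrow> 0)
       (at t within {0..})"

text \<open>Curves that stay in the domain and solve z' = T z in the norm, so that the functional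
  may be differentiated along them. The initial state is left free, since only differences of
  primitives of mild solutions are fed in.\<close>

definition classical_solution :: "real \<Rightarrow> real \<Rightarrow> real^'n^'n \<Rightarrow> real^1^'n \<Rightarrow> real^'n^1
    \<Rightarrow> (real \<Rightarrow> 'n::finite state) \<Rightarrow> bool" where
  "classical_solution c c0 A B K D \<longleftrightarrow>
     (\<forall>t\<ge>0. D t \<in> dom_T c0 K \<and> H_deriv c D (op_T c A B (D t)) t)"

lemma classical_decay:
  fixes A :: "real^'n::finite^'n" and P0 :: "real^('n + 2)^('n + 2)"
  assumes c: "c > 0" and P0: "sym_pos_def P0" and S: "sym_pos_def S" and R: "sym_pos_def R"
    and Psi: "sym_neg_def (Psi0 c c0 A B K P0 S R)"
  obtains \<gamma> \<delta> where "\<gamma> \<ge> 1" "\<delta> > 0"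
    "\<And>D t. classical_solution c c0 A B K D \<Longrightarrow> t \<ge> 0 \<Longrightarrow>
      (normH c (D t))\<^sup>2 \<le> \<gamma> * exp (- \<delta> * t) * (normH c (D 0))\<^sup>2"
proof (rule lyap_dissipation[OF c P0 S R Psi])
  fix \<delta> :: real assume \<delta>: "\<delta> > 0" and diss: "\<And>X f f' e Y. (\<And>i. AC (f i) (f' i)) \<Longrightarrow> (\<And>i. f' i \<in> L2) \<Longrightarrow>
      Y = N0 c A B K *v vjoin (vjoin X (means f)) e \<Longrightarrow>
      (\<chi> i. f i 0) = G0 c c0 A B K *v vjoin (vjoin X (means f)) e \<Longrightarrow>
      (\<chi> i. f i 1) = H0 c c0 A B K *v vjoin (vjoin X (means f)) e \<Longrightarrow>
      2 * (vjoin Y (c *\<^sub>R means f') \<bullet> (P0 *v vjoin X (means f)))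
        + c * (lyap_int S R f' f + lyap_int S R f f') \<le> - \<delta> * lyap P0 S R X f"
  obtain l where l: "l > 0"
    "\<And>X f. (\<And>i. f i \<in> L2) \<Longrightarrow> l * ((norm X)\<^sup>2 + sqnorms f) \<le> lyap P0 S R X f"
    using lyap_coercive[OF P0 S R] by blast
  obtain C where C: "C > 0"
    "\<And>X f. (\<And>i. f i \<in> L2) \<Longrightarrow> lyap P0 S R X f \<le> C * ((norm X)\<^sup>2 + sqnorms f)"
    using lyap_bounded[of P0 S R] by blast
  have "bounded_linear (\<lambda>x. (K *v x) $ 1)"
    using bounded_linear_compose[OF bounded_linear_vec_nth matrix_vector_mul_bounded_linear] .
  from bounded_linear.bounded[OF this]
  obtain k where "\<forall>x. norm ((K *v x) $ 1) \<le> norm x * k" ..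
  then have k: "\<bar>(K *v Y) $ 1\<bar> \<le> k * norm Y" for Y by (simp add: mult.commute)
  define m where "m = 1 + 2 * k\<^sup>2 + 1 / c\<^sup>2"
  have m: "m > 0" unfolding m_def by (simp add: add_pos_nonneg)
  show ?thesis
  \<comment> \<open>m passes from the norm to X and the Riemann coordinates, 1 / l from there to V;
    C bounds V at time 0, and 2 comes from \<open>sqnorms_le_normH\<close>. The maximum ensures
    \<gamma> \<ge> 1.\<close>
  proof (rule that[of "max 1 (m / l * C * 2)" \<delta>])
    fix D :: "real \<Rightarrow> 'n state" and t :: real
    assume D: "classical_solution c c0 A B K D" and t: "t \<ge> 0"
    define X u v where "X t = fst (D t)" and "u t = fst (snd (D t))" and "v t = snd (snd (D t))" for t
    define Y where "Y t = A *v X t + B *v vec (cont_rep (u t) 1)" for t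
    have Dt: "D t = (X t, u t, v t)" for t by (simp add: X_def u_def v_def)
    have dom: "(X t, u t, v t) \<in> dom_T c0 K" if "t \<ge> 0" for t
      using D that by (simp add: classical_solution_def flip: Dt)
    have der: "((\<lambda>s. normH c (X s - X t - (s - t) *\<^sub>R Y t,
        \<lambda>x. u s x - u t x - (s - t) * v t x,
        \<lambda>x. v s x - v t x - (s - t) * (c\<^sup>2 * wderiv (wderiv (u t)) x)) / \<bar>s - t\<bar>) \<longlongrightarrow> 0) (at t within {0..})"
      if "t \<ge> 0" for t
      using D that by (simp add: classical_solution_def H_deriv_def Dt op_T_def st_increment_simp Y_def)
    let ?V = "\<lambda>s. lyap P0 S R (X s) (chi c (u s) (v s))"
    have P0': "transpose P0 = P0" using P0 by (simp add: sym_pos_def_def)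
    have "?V t \<le> exp (- \<delta> * t) * ?V 0"
    proof (rule exponential_decay[OF t curve_lyap[OF c dom Y_def der _ P0']])
      fix t :: real assume "0 < t"
      then have t: "t \<ge> 0" by simp
      note bv = boundary_values[OF dom[OF t] c Y_def curve_trace[OF c dom Y_def der t]]
      show "2 * (vjoin (Y t) (c *\<^sub>R means (chi' c (u t) (v t))) \<bullet> (P0 *v vjoin (X t) (means (chi c (u t) (v t)))))
        + c * (lyap_int S R (chi' c (u t) (v t)) (chi c (u t) (v t)) + lyap_int S R (chi c (u t) (v t)) (chi' c (u t) (v t)))
        \<le> - \<delta> * ?V t"
        by (rule diss[OF chi_AC[OF dom[OF t]] chi'_L2[OF dom[OF t]] bv])
    qed
    also have "\<dots> \<le> exp (- \<delta> * t) * (C * (2 * (normH c (D 0))\<^sup>2))"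
    proof (rule mult_left_mono)
      have "?V 0 \<le> C * ((norm (X 0))\<^sup>2 + sqnorms (chi c (u 0) (v 0)))"
        by (rule C(2)) (rule chi_L2[OF dom], simp)
      also have "\<dots> \<le> C * (2 * (normH c (D 0))\<^sup>2)"
        unfolding Dt using C(1) by (intro mult_left_mono sqnorms_le_normH[OF dom]) auto
      finally show "?V 0 \<le> C * (2 * (normH c (D 0))\<^sup>2)" .
    qed simp
    finally have V: "?V t \<le> exp (- \<delta> * t) * (C * (2 * (normH c (D 0))\<^sup>2))" .
    have "(normH c (D t))\<^sup>2 \<le> m * ((norm (X t))\<^sup>2 + sqnorms (chi c (u t) (v t)))"
      unfolding Dt m_def by (rule normH_le_sqnorms[OF dom[OF t] c k])
    also have "\<dots> = m / l * (l * ((norm (X t))\<^sup>2 + sqnorms (chi c (u t) (v t))))"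
      using l(1) by simp
    also have "\<dots> \<le> m / l * ?V t"
      using m l(1) by (intro mult_left_mono l(2) chi_L2[OF dom[OF t]]) auto
    also have "\<dots> \<le> m / l * (exp (- \<delta> * t) * (C * (2 * (normH c (D 0))\<^sup>2)))"
      using m l(1) V by (intro mult_left_mono) auto
    also have "\<dots> = (m / l * C * 2) * (exp (- \<delta> * t) * (normH c (D 0))\<^sup>2)"
      by (simp add: mult_ac)
    also have "\<dots> \<le> max 1 (m / l * C * 2) * (exp (- \<delta> * t) * (normH c (D 0))\<^sup>2)"
      by (intro mult_right_mono) auto
    finally show "(normH c (D t))\<^sup>2 \<le> max 1 (m / l * C * 2) * exp (- \<delta> * t) * (normH c (D 0))\<^sup>2"
      by (simp add: mult.assoc)
  qed (use \<delta> in auto)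
qed

section \<open>Transfer of uniqueness and decay to mild solutions\<close>

section \<open>Equality of states up to null sets\<close>

text \<open>Equality in the Hilbert space. As a pointwise relation it is easier to propagate than a
  vanishing norm: \<open>wderiv\<close> and \<open>cont_rep\<close> return identical functions on
  arguments that agree almost everywhere.\<close>

definition st_eq :: "'n::finite state \<Rightarrow> 'n state \<Rightarrow> bool" where
  "st_eq = (\<lambda>(X, u, v) (Y, w, y). X = Y \<and> (AE x in I01. u x = w x) \<and> (AE x in I01. v x = y x))"

text \<open>An equation between predicates, so that the choice in \<open>wderiv\<close> yields
  literally the same function on both sides.\<close>

lemma weak_deriv_AE_cong:
  assumes "AE x in I01. f x = f' x"
  shows "weak_deriv f = weak_deriv f'"
proof -
  have *: "weak_deriv f' g" if "weak_deriv f g" "AE x in I01. f x = f' x" for f f' g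
  proof (rule weak_deriv_cong[OF that(1) _ _ that(2)])
    have f: "f \<in> L2" and g: "g \<in> L2" using that(1) by (rule weak_deriv_L2)+
    show "f' \<in> L2"
      by (rule L2_AE_cong[OF f measurable_I01_AE_cong[OF L2_measurable[OF f] that(2)] that(2)])
    show "g \<in> L2" by fact
  qed simp
  have "AE x in I01. f' x = f x" using assms by eventually_elim simp
  then show ?thesis using * assms by blast
qed

lemma wderiv_AE_cong: "AE x in I01. f x = f' x \<Longrightarrow> wderiv f = wderiv f'"
  unfolding wderiv_def by (drule weak_deriv_AE_cong) simp

lemma st_eq_refl [simp]: "st_eq z z"
  by (cases z) (simp add: st_eq_def)

lemma st_eq_sym: "st_eq z w \<Longrightarrow> st_eq w z"
  by (cases z; cases w) (auto simp: st_eq_def elim: eventually_mono)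

lemma st_eq_trans [trans]: "st_eq z w \<Longrightarrow> st_eq w y \<Longrightarrow> st_eq z y"
  by (cases z; cases w; cases y) (auto simp: st_eq_def elim: eventually_elim2)

lemma st_eq_diff: "st_eq z z' \<Longrightarrow> st_eq w w' \<Longrightarrow> st_eq (st_diff z w) (st_diff z' w')"
  by (cases z; cases w; cases z'; cases w') (auto simp: st_eq_def st_diff_simp elim: eventually_elim2)

lemma st_eq_add: "st_eq z z' \<Longrightarrow> st_eq w w' \<Longrightarrow> st_eq (st_add z w) (st_add z' w')"
  by (cases z; cases w; cases z'; cases w') (auto simp: st_eq_def st_add_def elim: eventually_elim2)

lemma st_eq_normH: "st_eq z w \<Longrightarrow> normH c z = normH c w"
proof (cases z; cases w)
  fix X u v Y w' y assume "st_eq z w" and z: "z = (X, u, v)" and w: "w = (Y, w', y)"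
  then have eq: "X = Y" "AE x in I01. u x = w' x" "AE x in I01. v x = y x" by (auto simp: st_eq_def)
  then show "normH c z = normH c w"
    unfolding z w eq(1) by (intro normH_AE_cong) (simp_all add: wderiv_AE_cong[OF eq(2)])
qed

lemma st_eq_op_T: "st_eq z w \<Longrightarrow> st_eq (op_T c A B z) (op_T c A B w)"
  by (cases z; cases w) (auto simp: st_eq_def op_T_def dest: wderiv_AE_cong cont_rep_AE_cong)

lemma H_space_iff: "(X, u, v) \<in> H_space \<longleftrightarrow> weak_deriv u (wderiv u) \<and> v \<in> L2"
  unfolding H_space_def by (simp add: Hsob_1_iff[unfolded One_nat_def] del: Hsob.simps(2))

lemma H_space_diff: "z \<in> H_space \<Longrightarrow> w \<in> H_space \<Longrightarrow> st_diff z w \<in> H_space"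
  by (cases z; cases w) (auto simp: H_space_iff st_diff_simp intro: weak_deriv_wderiv weak_deriv_diff L2_diff)

lemma H_space_scale: "z \<in> H_space \<Longrightarrow> st_scale r z \<in> H_space"
  by (cases z) (auto simp: H_space_iff st_scale_def intro: weak_deriv_wderiv weak_deriv_scale L2_scale)

lemma H_space_add: "z \<in> H_space \<Longrightarrow> w \<in> H_space \<Longrightarrow> st_add z w \<in> H_space"
  by (cases z; cases w) (auto simp: H_space_iff st_add_def intro: weak_deriv_wderiv weak_deriv_add L2_add)

lemma dom_T_H_space:
  assumes "z \<in> dom_T c0 K"
  shows "z \<in> H_space" "op_T c A B z \<in> H_space"
proof -
  obtain X u v where z: "z = (X, u, v)" by (cases z)
  note d = dom_TD[OF assms[unfolded z]]
  show "z \<in> H_space" "op_T c A B z \<in> H_space"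
    using d weak_deriv_L2[OF d(2)] weak_deriv_L2[OF d(3)] unfolding z by (auto simp: H_space_iff op_T_def L2_scale)
qed

lemma dom_T_iff: "(X, u, v) \<in> dom_T c0 K \<longleftrightarrow> weak_deriv u (wderiv u) \<and>
    weak_deriv (wderiv u) (wderiv (wderiv u)) \<and> weak_deriv v (wderiv v) \<and>
    cont_rep u 0 = (K *v X) $ 1 \<and> cont_rep (wderiv u) 1 = - c0 * cont_rep v 1"
  by (auto simp: dom_T_def Hsob_2_iff Hsob_1_iff simp del: Hsob.simps One_nat_def)

lemma cont_rep_diff:
  assumes "weak_deriv f f'" "weak_deriv g g'" "x \<in> {0..1}"
  shows "cont_rep (\<lambda>x. f x - g x) x = cont_rep f x - cont_rep g x"
proof (rule cont_rep_eq[OF _ _ assms(3)])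
  show "continuous_on {0..1} (\<lambda>x. cont_rep f x - cont_rep g x)"
    using assms by (intro continuous_intros AC_continuous_on[OF cont_rep_AC])
  show "AE x in I01. cont_rep f x - cont_rep g x = f x - g x"
    using weak_deriv_cont_rep(2)[OF assms(1)] weak_deriv_cont_rep(2)[OF assms(2)] by eventually_elim simp
qed

text \<open>\<open>op_T\<close> is linear only up to null sets, because \<open>wderiv\<close> is a
  choice.\<close>

lemma dom_T_diff:
  assumes "z \<in> dom_T c0 K" "w \<in> dom_T c0 K"
  shows "st_diff z w \<in> dom_T c0 K" "st_eq (op_T c A B (st_diff z w)) (st_diff (op_T c A B z) (op_T c A B w))"
proof -
  obtain X u v where z: "z = (X, u, v)" by (cases z)
  obtain Y w' y where w: "w = (Y, w', y)" by (cases w)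
  note d = dom_TD[OF assms(1)[unfolded z]] and e = dom_TD[OF assms(2)[unfolded w]]
  note ud = weak_deriv_diff[OF d(1) e(1)] and udd = weak_deriv_diff[OF d(2) e(2)] and vd = weak_deriv_diff[OF d(3) e(3)]
  have eq1: "AE x in I01. wderiv (\<lambda>x. u x - w' x) x = wderiv u x - wderiv w' x" by (rule wderiv_AE[OF ud])
  note eq2 = weak_deriv_AE_cong[OF eq1] wderiv_AE_cong[OF eq1] cont_rep_AE_cong[OF eq1]
  show "st_diff z w \<in> dom_T c0 K"
    unfolding z w st_diff_simp dom_T_iff eq2
    using weak_deriv_wderiv[OF ud] weak_deriv_wderiv[OF udd] weak_deriv_wderiv[OF vd]
      d(4,5) e(4,5)
    by (simp add: matrix_vector_mult_diff_distrib right_diff_distrib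
        cont_rep_diff[OF d(1) e(1)] cont_rep_diff[OF d(2) e(2)] cont_rep_diff[OF d(3) e(3)])
  have "AE x in I01. c\<^sup>2 * wderiv (\<lambda>x. wderiv u x - wderiv w' x) x = c\<^sup>2 * wderiv (wderiv u) x - c\<^sup>2 * wderiv (wderiv w') x"
    using wderiv_AE[OF udd] by eventually_elim (simp add: right_diff_distrib)
  moreover have "vec (cont_rep (\<lambda>x. u x - w' x) 1) = (vec (cont_rep u 1) - vec (cont_rep w' 1) :: real^1)"
    using cont_rep_diff[OF d(1) e(1), of 1] by (simp add: vec_eq_iff)
  ultimately show "st_eq (op_T c A B (st_diff z w)) (st_diff (op_T c A B z) (op_T c A B w))"
    unfolding z w st_diff_simp op_T_def prod.case st_eq_def eq2
    by (simp add: matrix_vector_mult_diff_distrib)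
qed

text \<open>\<open>normH\<close> is the Euclidean norm of the four component norms; their triangle
  inequalities combine with monotonicity and the triangle inequality of the Euclidean norm.\<close>

lemma normH_triangle:
  assumes "z \<in> H_space" "w \<in> H_space"
  shows "normH c (st_add z w) \<le> normH c z + normH c w"
proof -
  obtain X u v where z: "z = (X, u, v)" by (cases z)
  obtain Y w' y where w: "w = (Y, w', y)" by (cases w)
  have N: "normH c (X, u, v) = norm (norm X, normL2 u, \<bar>c\<bar> * normL2 (wderiv u), normL2 v)" for X :: "real^'n" and u v
    by (simp add: normH_def norm_Pair power_mult_distrib)
  have d: "weak_deriv u (wderiv u)" "v \<in> L2" "weak_deriv w' (wderiv w')" "y \<in> L2"
    using assms unfolding z w H_space_iff by auto
  have "normL2 (wderiv (\<lambda>x. u x + w' x)) = normL2 (\<lambda>x. wderiv u x + wderiv w' x)"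
    by (rule normL2_AE_cong[OF wderiv_AE[OF weak_deriv_add[OF d(1) d(3)]]])
  also have "\<dots> \<le> normL2 (wderiv u) + normL2 (wderiv w')"
    by (rule normL2_triangle[OF weak_deriv_L2(2)[OF d(1)] weak_deriv_L2(2)[OF d(3)]])
  finally have 1: "\<bar>c\<bar> * normL2 (wderiv (\<lambda>x. u x + w' x)) \<le> \<bar>c\<bar> * normL2 (wderiv u) + \<bar>c\<bar> * normL2 (wderiv w')"
    by (simp add: distrib_left[symmetric] mult_left_mono)
  have 2: "normL2 (\<lambda>x. u x + w' x) \<le> normL2 u + normL2 w'"
    by (rule normL2_triangle[OF weak_deriv_L2(1)[OF d(1)] weak_deriv_L2(1)[OF d(3)]])
  have 3: "normL2 (\<lambda>x. v x + y x) \<le> normL2 v + normL2 y" by (rule normL2_triangle[OF d(2) d(4)])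
  have mono: "norm (a1, a2, a3, a4) \<le> norm (b1, b2, b3, b4)"
    if "0 \<le> a1" "a1 \<le> b1" "0 \<le> a2" "a2 \<le> b2" "0 \<le> a3" "a3 \<le> b3" "0 \<le> a4" "a4 \<le> b4"
    for a1 a2 a3 a4 b1 b2 b3 b4 :: real
    using that by (simp add: norm_Pair add_mono power_mono)
  have "normH c (st_add z w) \<le> norm ((norm X, normL2 u, \<bar>c\<bar> * normL2 (wderiv u), normL2 v)
      + (norm Y, normL2 w', \<bar>c\<bar> * normL2 (wderiv w'), normL2 y))"
    unfolding z w st_add_def prod.case N add_Pair
    by (rule mono) (use 1 2 3 norm_triangle_ineq in auto)
  also have "\<dots> \<le> normH c z + normH c w"
    unfolding z w N by (rule norm_triangle_ineq)
  finally show ?thesis .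
qed

lemma normH_scale:
  assumes "z \<in> H_space"
  shows "normH c (st_scale r z) = \<bar>r\<bar> * normH c z"
proof -
  obtain X u v where z: "z = (X, u, v)" by (cases z)
  have d: "weak_deriv u (wderiv u)" using assms unfolding z H_space_iff by auto
  have "normL2 (wderiv (\<lambda>x. r * u x)) = normL2 (\<lambda>x. r * wderiv u x)"
    by (rule normL2_AE_cong[OF wderiv_AE[OF weak_deriv_scale[OF d]]])
  then have "(normH c (st_scale r z))\<^sup>2 = (\<bar>r\<bar> * normH c z)\<^sup>2"
    unfolding z st_scale_def prod.case power_mult_distrib normH_power2
    by (simp add: normL2_scale power_mult_distrib algebra_simps)
  then show ?thesis by (simp add: power2_eq_iff_nonneg)
qed

lemma normH_diff_le:
  assumes "z \<in> H_space" "w \<in> H_space"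
  shows "normH c (st_diff z w) \<le> normH c z + normH c w"
  using normH_triangle[OF assms(1) H_space_scale[OF assms(2), of "-1"], of c] normH_scale[OF assms(2), of c "-1"]
  by (simp add: st_diff_def)

lemma normH_diff_abs:
  assumes "z \<in> H_space" "w \<in> H_space"
  shows "\<bar>normH c z - normH c w\<bar> \<le> normH c (st_diff z w)"
proof -
  obtain X u v where z: "z = (X, u, v)" by (cases z)
  obtain Y w' y where w: "w = (Y, w', y)" by (cases w)
  have e: "st_add (st_diff z w) w = z" by (simp add: z w st_diff_simp st_add_def)
  have e': "st_diff z (st_diff z w) = w" by (simp add: z w st_diff_simp)
  show ?thesis
    using normH_triangle[OF H_space_diff[OF assms] assms(2), of c, unfolded e]
      normH_diff_le[OF assms(1) H_space_diff[OF assms], of c, unfolded e'] by simp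
qed

lemma normH_eq_0_iff:
  assumes "c > 0" "z \<in> H_space" "w \<in> H_space"
  shows "normH c (st_diff z w) = 0 \<longleftrightarrow> st_eq z w"
proof
  obtain X u v where z: "z = (X, u, v)" by (cases z)
  obtain Y w' y where w: "w = (Y, w', y)" by (cases w)
  have d: "(\<lambda>x. u x - w' x) \<in> L2" "(\<lambda>x. v x - y x) \<in> L2"
    using assms unfolding z w H_space_iff by (auto intro!: L2_diff dest: weak_deriv_L2)
  assume 0: "normH c (st_diff z w) = 0"
  have "norm (X - Y) = 0" "normL2 (\<lambda>x. u x - w' x) = 0" "normL2 (\<lambda>x. v x - y x) = 0"
    using 0 normH_components(1)[of "X - Y" c "\<lambda>x. u x - w' x" "\<lambda>x. v x - y x"]
      normH_components(2)[of "\<lambda>x. u x - w' x" c "X - Y" "\<lambda>x. v x - y x"]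
      normH_components(4)[of "\<lambda>x. v x - y x" c "X - Y" "\<lambda>x. u x - w' x"]
    by (auto simp: z w st_diff_simp intro: antisym)
  then show "st_eq z w"
    unfolding z w st_eq_def using d by (simp add: normL2_eq_0)
next
  assume "st_eq z w"
  then have "st_eq (st_diff z w) (st_diff w w)" by (rule st_eq_diff) simp
  from st_eq_normH[OF this, of c] have "normH c (st_diff z w) = normH c (st_diff w w)" .
  also have "st_diff w w = st_scale 0 w" by (cases w) (simp add: st_diff_simp st_scale_def)
  also have "normH c \<dots> = 0" using normH_scale[OF assms(3), of c 0] by simp
  finally show "normH c (st_diff z w) = 0" .
qed

text \<open>\<open>st_scale 0 z\<close> serves as the zero state.\<close>

lemma normH_0_st_eq:
  assumes "c > 0" "z \<in> H_space" "normH c z = 0"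
  shows "st_eq z (st_scale 0 z)"
proof -
  have "st_diff z (st_scale 0 z) = z" by (cases z) (simp add: st_diff_simp st_scale_def)
  then show ?thesis
    using normH_eq_0_iff[OF assms(1,2) H_space_scale[OF assms(2), of 0]] assms(3) by simp
qed

section \<open>Uniqueness and exponential stability of mild solutions\<close>

lemma H_deriv_diff:
  assumes P: "H_deriv c P p t" "\<And>s. s \<ge> 0 \<Longrightarrow> P s \<in> H_space" "p \<in> H_space"
    and Q: "H_deriv c Q q t" "\<And>s. s \<ge> 0 \<Longrightarrow> Q s \<in> H_space" "q \<in> H_space"
    and t: "t \<ge> 0" and d: "st_eq (st_diff p q) d"
  shows "H_deriv c (\<lambda>s. st_diff (P s) (Q s)) d t"
  unfolding H_deriv_def
proof (rule tendsto_zero_le)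
  let ?e = "\<lambda>P p s. st_diff (st_diff (P s) (P t)) (st_scale (s - t) p)"
  show "((\<lambda>s. normH c (?e P p s) / \<bar>s - t\<bar> + normH c (?e Q q s) / \<bar>s - t\<bar>) \<longlongrightarrow> 0) (at t within {0..})"
    using tendsto_add[OF P(1)[unfolded H_deriv_def] Q(1)[unfolded H_deriv_def]] by simp
  fix s :: real assume s: "s \<ge> 0" "s \<noteq> t"
  have "st_eq (?e (\<lambda>s. st_diff (P s) (Q s)) d s) (st_diff (?e P p s) (?e Q q s))"
  proof (cases "P s"; cases "P t"; cases p; cases "Q s"; cases "Q t"; cases q; cases d)
    fix X1 u1 v1 X2 u2 v2 X3 u3 v3 Y1 w1 y1 Y2 w2 y2 Y3 w3 y3 X4 u4 v4
    assume eqs: "P s = (X1, u1, v1)" "P t = (X2, u2, v2)" "p = (X3, u3, v3)"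
      "Q s = (Y1, w1, y1)" "Q t = (Y2, w2, y2)" "q = (Y3, w3, y3)" "d = (X4, u4, v4)"
    have X4: "X4 = X3 - Y3" and ae: "AE x in I01. u4 x = u3 x - w3 x" "AE x in I01. v4 x = v3 x - y3 x"
      using st_eq_sym[OF d] unfolding eqs st_diff_simp st_eq_def by auto
    show ?thesis
      unfolding eqs st_diff_simp st_scale_def st_eq_def prod.case
    proof (intro conjI)
      show "AE x in I01. u1 x - w1 x - (u2 x - w2 x) - (s - t) * u4 x
          = u1 x - u2 x - (s - t) * u3 x - (w1 x - w2 x - (s - t) * w3 x)"
        using ae(1)
      proof eventually_elim
        case (elim x)
        show ?case unfolding elim by (simp add: algebra_simps)
      qed
      show "AE x in I01. v1 x - y1 x - (v2 x - y2 x) - (s - t) * v4 x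
          = v1 x - v2 x - (s - t) * v3 x - (y1 x - y2 x - (s - t) * y3 x)"
        using ae(2)
      proof eventually_elim
        case (elim x)
        show ?case unfolding elim by (simp add: algebra_simps)
      qed
    qed (simp add: X4 algebra_simps)
  qed
  then have "normH c (?e (\<lambda>s. st_diff (P s) (Q s)) d s) = normH c (st_diff (?e P p s) (?e Q q s))"
    by (rule st_eq_normH)
  also have "\<dots> \<le> normH c (?e P p s) + normH c (?e Q q s)"
    by (intro normH_diff_le H_space_diff H_space_scale P(2,3) Q(2,3) s t)
  finally show "\<bar>normH c (?e (\<lambda>s. st_diff (P s) (Q s)) d s) / \<bar>s - t\<bar>\<bar>
      \<le> normH c (?e P p s) / \<bar>s - t\<bar> + normH c (?e Q q s) / \<bar>s - t\<bar>"
    by (simp add: divide_right_mono flip: add_divide_distrib)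
qed

text \<open>A forward shift maps nonnegative times to nonnegative times, so the one-sided filters
  are compatible.\<close>

lemma H_deriv_shift:
  assumes "H_deriv c D d (t + h)" "h \<ge> 0"
  shows "H_deriv c (\<lambda>s. D (s + h)) d t"
proof -
  have "filterlim (\<lambda>s. s + h) (at (t + h) within {0..}) (at t within {0..})"
    unfolding filterlim_at
    using within_nonneg[of t] assms(2) by (auto intro!: tendsto_intros elim!: eventually_mono)
  from filterlim_compose[OF assms(1)[unfolded H_deriv_def] this]
  show ?thesis by (simp add: H_deriv_def)
qed

lemma solutionE:
  assumes "solution c c0 A B K z0 z" and z0: "z0 \<in> dom_T c0 K" and c: "c > 0"
  obtains Z where "\<And>t. t \<ge> 0 \<Longrightarrow> z t \<in> H_space" "\<And>t. t \<ge> 0 \<Longrightarrow> Z t \<in> dom_T c0 K" "normH c (Z 0) = 0"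
    "\<And>t. t \<ge> 0 \<Longrightarrow> H_deriv c Z (z t) t" "\<And>t. t \<ge> 0 \<Longrightarrow> st_eq (z t) (st_add z0 (op_T c A B (Z t)))"
proof -
  obtain Z where z: "\<And>t. t \<ge> 0 \<Longrightarrow> z t \<in> H_space" and p: "H_primitive c z Z"
    and Z: "\<And>t. t \<ge> 0 \<Longrightarrow> Z t \<in> dom_T c0 K"
    and eq: "\<And>t. t \<ge> 0 \<Longrightarrow> normH c (st_diff (z t) (st_add z0 (op_T c A B (Z t)))) = 0"
    using assms(1) unfolding solution_def by blast
  show ?thesis
  proof (rule that[OF z Z])
    show "normH c (Z 0) = 0" using p by (simp add: H_primitive_def)
    show "H_deriv c Z (z t) t" if "t \<ge> 0" for t using p that by (simp add: H_primitive_def H_deriv_def)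
    show "st_eq (z t) (st_add z0 (op_T c A B (Z t)))" if "t \<ge> 0" for t
      using eq[OF that] normH_eq_0_iff[OF c z[OF that] H_space_add[OF dom_T_H_space(1)[OF z0] dom_T_H_space(2)[OF Z[OF that]]]]
      by simp
  qed
qed

text \<open>P and Q solve the affine equation P' = z0 + T P with the same z0, which cancels in the
  difference. Applied to two primitives for uniqueness, and to a primitive and its time shift for
  decay.\<close>

lemma classical_solution_diff:
  assumes P: "\<And>t. t \<ge> 0 \<Longrightarrow> P t \<in> dom_T c0 K" "\<And>t. t \<ge> 0 \<Longrightarrow> H_deriv c P (p t) t"
    "\<And>t. t \<ge> 0 \<Longrightarrow> p t \<in> H_space" "\<And>t. t \<ge> 0 \<Longrightarrow> st_eq (p t) (st_add z0 (op_T c A B (P t)))"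
    and Q: "\<And>t. t \<ge> 0 \<Longrightarrow> Q t \<in> dom_T c0 K" "\<And>t. t \<ge> 0 \<Longrightarrow> H_deriv c Q (q t) t"
    "\<And>t. t \<ge> 0 \<Longrightarrow> q t \<in> H_space" "\<And>t. t \<ge> 0 \<Longrightarrow> st_eq (q t) (st_add z0 (op_T c A B (Q t)))"
  shows "classical_solution c c0 A B K (\<lambda>t. st_diff (P t) (Q t))"
  unfolding classical_solution_def
proof (intro allI impI conjI)
  fix t :: real assume t: "t \<ge> 0"
  show "st_diff (P t) (Q t) \<in> dom_T c0 K" by (rule dom_T_diff(1)[OF P(1)[OF t] Q(1)[OF t]])
  show "H_deriv c (\<lambda>t. st_diff (P t) (Q t)) (op_T c A B (st_diff (P t) (Q t))) t"
  proof (rule H_deriv_diff[OF P(2)[OF t] _ P(3)[OF t] Q(2)[OF t] _ Q(3)[OF t] t])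
    have cancel: "st_diff (st_add z0 a) (st_add z0 b) = st_diff a b" for a b
      by (cases z0; cases a; cases b) (simp add: st_add_def st_diff_simp)
    have "st_eq (st_diff (p t) (q t)) (st_diff (op_T c A B (P t)) (op_T c A B (Q t)))"
      using st_eq_diff[OF P(4)[OF t] Q(4)[OF t]] unfolding cancel .
    then show "st_eq (st_diff (p t) (q t)) (op_T c A B (st_diff (P t) (Q t)))"
      using dom_T_diff(2)[OF P(1)[OF t] Q(1)[OF t]] st_eq_sym st_eq_trans by blast
  qed (use dom_T_H_space(1) P(1) Q(1) in blast)+
qed

lemma op_T_zero: "st_eq (op_T c A B (st_scale 0 z)) (st_scale 0 z)"
proof -
  obtain X u v where z: "z = (X, u, v)" by (cases z)
  have L: "(\<lambda>x. 0) \<in> L2" by (rule L2_const)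
  have w: "weak_deriv (\<lambda>x. 0) (\<lambda>x. 0)" by (rule weak_derivI[OF AC_const[of 0] L L]) simp
  have 0: "AE x in I01. wderiv (\<lambda>x. 0) x = 0" by (rule wderiv_AE[OF w])
  have "cont_rep (\<lambda>x. 0) 1 = 0" using cont_rep_eq[of "\<lambda>x. 0" "\<lambda>x. 0" 1] by simp
  then show ?thesis
    using 0 wderiv_AE_cong[OF 0]
    by (simp add: z st_scale_def op_T_def st_eq_def)
qed

text \<open>Z1 is the primitive at time 0, the zero class, on which T vanishes.\<close>

lemma solution_initial:
  assumes "c > 0" "z0 \<in> dom_T c0 K" "Z1 \<in> dom_T c0 K" "normH c Z1 = 0" "st_eq z (st_add z0 (op_T c A B Z1))"
  shows "normH c z = normH c z0"
proof -
  have "st_eq (op_T c A B Z1) (st_scale 0 Z1)"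
    using st_eq_op_T[OF normH_0_st_eq[OF assms(1) dom_T_H_space(1)[OF assms(3)] assms(4)]] op_T_zero st_eq_trans by blast
  then have "st_eq (st_add z0 (op_T c A B Z1)) (st_add z0 (st_scale 0 Z1))" by (intro st_eq_add) simp
  also have "st_add z0 (st_scale 0 Z1) = z0" by (cases z0; cases Z1) (simp add: st_add_def st_scale_def)
  finally show ?thesis using assms(5) st_eq_normH st_eq_trans by blast
qed

text \<open>The difference of the primitives vanishes at 0, hence always by the decay estimate; z =
  z0 + T Z then turns equal primitives into equal solutions.\<close>

lemma solution_unique:
  assumes decay: "\<And>D t. classical_solution c c0 A B K D \<Longrightarrow> t \<ge> 0 \<Longrightarrow>
      (normH c (D t))\<^sup>2 \<le> C t * (normH c (D 0))\<^sup>2"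
    and c: "c > 0" and z0: "z0 \<in> dom_T c0 K"
    and z: "solution c c0 A B K z0 z" and z': "solution c c0 A B K z0 z'" and t: "t \<ge> 0"
  shows "normH c (st_diff (z t) (z' t)) = 0"
proof -
  obtain Z where Z: "\<And>t. t \<ge> 0 \<Longrightarrow> z t \<in> H_space" "\<And>t. t \<ge> 0 \<Longrightarrow> Z t \<in> dom_T c0 K" "normH c (Z 0) = 0"
    "\<And>t. t \<ge> 0 \<Longrightarrow> H_deriv c Z (z t) t" "\<And>t. t \<ge> 0 \<Longrightarrow> st_eq (z t) (st_add z0 (op_T c A B (Z t)))"
    by (rule solutionE[OF z z0 c]) (rule that)
  obtain Z' where Z': "\<And>t. t \<ge> 0 \<Longrightarrow> z' t \<in> H_space" "\<And>t. t \<ge> 0 \<Longrightarrow> Z' t \<in> dom_T c0 K" "normH c (Z' 0) = 0"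
    "\<And>t. t \<ge> 0 \<Longrightarrow> H_deriv c Z' (z' t) t" "\<And>t. t \<ge> 0 \<Longrightarrow> st_eq (z' t) (st_add z0 (op_T c A B (Z' t)))"
    by (rule solutionE[OF z' z0 c]) (rule that)
  let ?D = "\<lambda>t. st_diff (Z t) (Z' t)"
  have "normH c (?D 0) \<le> 0"
    using normH_diff_le[OF dom_T_H_space(1)[OF Z(2)[of 0]] dom_T_H_space(1)[OF Z'(2)[of 0]], of c] Z(3) Z'(3) by simp
  then have "normH c (?D 0) = 0" by (simp add: antisym)
  moreover have "classical_solution c c0 A B K ?D"
    by (rule classical_solution_diff[OF Z(2,4,1,5) Z'(2,4,1,5)])
  ultimately have "(normH c (?D t))\<^sup>2 \<le> 0" using decay[of ?D t] t by simp
  then have "normH c (?D t) = 0" by simp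
  then have "st_eq (Z t) (Z' t)"
    using normH_eq_0_iff[OF c dom_T_H_space(1)[OF Z(2)[OF t]] dom_T_H_space(1)[OF Z'(2)[OF t]]] by simp
  then have "st_eq (st_add z0 (op_T c A B (Z t))) (st_add z0 (op_T c A B (Z' t)))"
    by (intro st_eq_add st_eq_op_T) simp
  then have "st_eq (z t) (z' t)"
    using Z(5)[OF t] Z'(5)[OF t] st_eq_sym st_eq_trans by blast
  then show ?thesis using normH_eq_0_iff[OF c Z(1)[OF t] Z'(1)[OF t]] by simp
qed

text \<open>The increments of Z over a time step h obey the decay estimate with a factor
  \<open>C t\<close> independent of h. Both sides are quadratic, so dividing by h^2 and letting h
  tend to 0 replaces the increments by the derivative z.\<close>

lemma solution_decay:
  assumes decay: "\<And>D t. classical_solution c c0 A B K D \<Longrightarrow> t \<ge> 0 \<Longrightarrow>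
      (normH c (D t))\<^sup>2 \<le> C t * (normH c (D 0))\<^sup>2"
    and c: "c > 0" and z0: "z0 \<in> dom_T c0 K"
    and z: "solution c c0 A B K z0 z" and t: "t \<ge> 0"
  shows "(normH c (z t))\<^sup>2 \<le> C t * (normH c z0)\<^sup>2"
proof -
  obtain Z where Z: "\<And>t. t \<ge> 0 \<Longrightarrow> z t \<in> H_space" "\<And>t. t \<ge> 0 \<Longrightarrow> Z t \<in> dom_T c0 K" "normH c (Z 0) = 0"
    "\<And>t. t \<ge> 0 \<Longrightarrow> H_deriv c Z (z t) t" "\<And>t. t \<ge> 0 \<Longrightarrow> st_eq (z t) (st_add z0 (op_T c A B (Z t)))"
    by (rule solutionE[OF z z0 c]) (rule that)
  let ?D = "\<lambda>h t. st_diff (Z (t + h)) (Z t)"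
  have lim: "((\<lambda>h. normH c (?D h t) / h) \<longlongrightarrow> normH c (z t)) (at_right 0)" if t: "t \<ge> 0" for t
  proof -
    have "filterlim (\<lambda>h. t + h) (at t within {0..}) (at_right 0)"
      unfolding filterlim_at using t
      by (auto intro!: tendsto_eq_intros simp: eventually_at_filter)
    from filterlim_compose[OF Z(4)[OF t, unfolded H_deriv_def] this]
    have l0: "((\<lambda>h. normH c (st_diff (?D h t) (st_scale h (z t))) / \<bar>h\<bar>) \<longlongrightarrow> 0) (at_right 0)" by simp
    have "((\<lambda>h. normH c (?D h t) / h - normH c (z t)) \<longlongrightarrow> 0) (at_right 0)"
    proof (rule Lim_null_comparison[OF _ l0])
      have "norm (normH c (?D h t) / h - normH c (z t)) \<le> normH c (st_diff (?D h t) (st_scale h (z t))) / \<bar>h\<bar>"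
        if h: "h > 0" for h
      proof -
        have "?D h t \<in> H_space" using t h by (intro H_space_diff dom_T_H_space(1)[OF Z(2)]) auto
        from normH_diff_abs[OF this H_space_scale[OF Z(1)[OF t], of h], of c]
        have "\<bar>normH c (?D h t) - h * normH c (z t)\<bar> / h \<le> normH c (st_diff (?D h t) (st_scale h (z t))) / h"
          using h by (simp add: normH_scale[OF Z(1)[OF t]] divide_right_mono)
        moreover have "\<bar>normH c (?D h t) / h - normH c (z t)\<bar> = \<bar>normH c (?D h t) - h * normH c (z t)\<bar> / h"
        proof -
          have "normH c (?D h t) / h - normH c (z t) = (normH c (?D h t) - h * normH c (z t)) / h"
            using h by (simp add: diff_divide_distrib)
          then show ?thesis using h by simp
        qed
        ultimately show ?thesis using h by simp
      qed
      then show "\<forall>\<^sub>F h in at_right 0. norm (normH c (?D h t) / h - normH c (z t))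
          \<le> normH c (st_diff (?D h t) (st_scale h (z t))) / \<bar>h\<bar>"
        by (auto simp: eventually_at_filter)
    qed
    then show ?thesis by (simp add: Lim_null[symmetric])
  qed
  have "(normH c (z t))\<^sup>2 \<le> C t * (normH c (z 0))\<^sup>2"
  proof (rule tendsto_le)
    show "((\<lambda>h. (normH c (?D h t) / h)\<^sup>2) \<longlongrightarrow> (normH c (z t))\<^sup>2) (at_right 0)"
      by (intro tendsto_power lim t)
    show "((\<lambda>h. C t * (normH c (?D h 0) / h)\<^sup>2) \<longlongrightarrow> C t * (normH c (z 0))\<^sup>2) (at_right 0)"
      by (intro tendsto_intros tendsto_power lim) simp
    have "(normH c (?D h t) / h)\<^sup>2 \<le> C t * (normH c (?D h 0) / h)\<^sup>2" if h: "h > 0" for h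
    proof -
      have "classical_solution c c0 A B K (?D h)"
        by (rule classical_solution_diff[where p="\<lambda>t. z (t + h)" and q=z])
          (use h in \<open>auto intro!: Z H_deriv_shift\<close>)
      from decay[OF this t] show ?thesis
        by (simp add: power_divide divide_right_mono)
    qed
    then show "\<forall>\<^sub>F h in at_right 0. (normH c (?D h t) / h)\<^sup>2 \<le> C t * (normH c (?D h 0) / h)\<^sup>2"
      by (auto simp: eventually_at_filter)
  qed simp
  also have "normH c (z 0) = normH c z0"
    by (rule solution_initial[OF c z0 Z(2) Z(3) Z(5)]) simp_all
  finally show ?thesis .
qed

section \<open>Existence: ordinary differential equations, delay system, travelling waves\<close>

section \<open>Linear differential equations with continuous forcing\<close>

text \<open>A two-sided antiderivative on the whole line, normalised at 0; taken by choice rather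
  than as an integral, so that negative arguments need no sign convention.\<close>

definition anti :: "(real \<Rightarrow> 'a::euclidean_space) \<Rightarrow> real \<Rightarrow> 'a" where
  "anti g = (SOME G. G 0 = 0 \<and> (\<forall>x. (G has_vector_derivative g x) (at x)))"

lemma anti:
  assumes "continuous_on UNIV g"
  shows anti_0: "anti g 0 = 0" and anti_deriv: "(anti g has_vector_derivative g x) (at x)"
proof -
  obtain G where "G 0 = 0" "\<And>x. (G has_vector_derivative g x) (at x)"
    using antiderivative_UNIV[OF assms] by blast
  then have "\<exists>G. G 0 = 0 \<and> (\<forall>x. (G has_vector_derivative g x) (at x))" by blast
  then have "anti g 0 = 0 \<and> (\<forall>x. (anti g has_vector_derivative g x) (at x))"
    unfolding anti_def by (rule someI_ex)
  then show "anti g 0 = 0" "(anti g has_vector_derivative g x) (at x)" by auto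
qed

lemma has_vector_derivative_continuous_on_UNIV:
  assumes "\<And>x. (G has_vector_derivative g x) (at x)"
  shows "continuous_on UNIV G"
  using assms by (auto simp: continuous_on_eq_continuous_at intro: has_vector_derivative_continuous)

lemma continuous_on_anti:
  "continuous_on UNIV g \<Longrightarrow> continuous_on UNIV (anti g)"
  by (rule has_vector_derivative_continuous_on_UNIV[OF anti_deriv])

text \<open>One step of the factorial estimate for Picard iteration. Negative s is reduced to
  positive s by reflecting the function.\<close>

lemma power_bound_antiderivative:
  fixes G g :: "real \<Rightarrow> 'a::euclidean_space"
  assumes G: "G 0 = 0" "\<And>x. (G has_vector_derivative g x) (at x)"
    and g: "\<And>r. \<bar>r\<bar> \<le> T \<Longrightarrow> norm (g r) \<le> D * \<bar>r\<bar> ^ k" and s: "\<bar>s\<bar> \<le> T"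
  shows "norm (G s) \<le> D * \<bar>s\<bar> ^ Suc k / Suc k"
proof -
  have pos: "norm (G s) \<le> D * s ^ Suc k / Suc k"
    if s: "0 < s" "s \<le> T" and G: "G 0 = 0" "\<And>x. (G has_vector_derivative g x) (at x)"
      and g: "\<And>r. \<bar>r\<bar> \<le> T \<Longrightarrow> norm (g r) \<le> D * \<bar>r\<bar> ^ k" for s and G g :: "real \<Rightarrow> 'a"
  proof -
    let ?\<phi> = "\<lambda>r. D * r ^ Suc k / Suc k"
    have d: "(?\<phi> has_vector_derivative D * r ^ k) (at r)" for r
      unfolding has_real_derivative_iff_has_vector_derivative[symmetric]
      by (rule derivative_eq_intros refl | simp)+
    have "norm (G s - G 0) \<le> ?\<phi> s - ?\<phi> 0"
    proof (rule differentiable_bound_general[OF s(1)])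
      show "continuous_on {0..s} G"
        using has_vector_derivative_continuous_on_UNIV[OF G(2)] continuous_on_subset by blast
      show "continuous_on {0..s} ?\<phi>" by (intro continuous_intros) auto
      show "norm (g r) \<le> D * r ^ k" if "0 < r" "r < s" for r using g[of r] that s by simp
    qed (use G d in auto)
    then show ?thesis using G by simp
  qed
  consider "s = 0" | "s > 0" | "s < 0" by linarith
  then show ?thesis
  proof cases
    case 1
    then show ?thesis using G by simp
  next
    case 2
    then show ?thesis using pos[OF 2 _ G g] s by simp
  next
    case 3
    have "((\<lambda>x. G (- x)) has_vector_derivative (- g (- x))) (at x)" for x
    proof -
      have "((\<lambda>x. - x :: real) has_vector_derivative (- 1)) (at x)"
        by (auto intro!: derivative_eq_intros)
      from vector_diff_chain_at[OF this G(2)[of "- x"]] show ?thesis by (simp add: o_def)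
    qed
    moreover have "norm (- g (- r)) \<le> D * \<bar>r\<bar> ^ k" if "\<bar>r\<bar> \<le> T" for r using g[of "- r"] that by simp
    ultimately show ?thesis
      using pos[of "- s" "\<lambda>x. G (- x)" "\<lambda>x. - g (- x)"] 3 s G(1) by simp
  qed
qed

text \<open>The terms of the Neumann series rather than successive approximations: term k is M^k
  applied to the k-fold iterated integral of h, and the sum over k solves the integral
  equation.\<close>

primrec picard :: "real^'n^'n \<Rightarrow> (real \<Rightarrow> real^'n) \<Rightarrow> nat \<Rightarrow> real \<Rightarrow> real^'n::finite" where
  "picard M h 0 = h"
| "picard M h (Suc k) = anti (\<lambda>s. M *v picard M h k s)"

lemma continuous_on_matrix_vector_mult:
  "continuous_on S f \<Longrightarrow> continuous_on S (\<lambda>x. M *v f x)" for M :: "real^'n::finite^'m::finite"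
  by (rule bounded_linear.continuous_on[OF matrix_vector_mul_bounded_linear])

lemma continuous_on_picard: "continuous_on UNIV h \<Longrightarrow> continuous_on UNIV (picard M h k)"
  by (induction k) (auto intro!: continuous_on_anti continuous_on_matrix_vector_mult)

text \<open>Sums the Neumann series for h = X0 + anti f. On [-T,T] term k is at most C (N T)^k / k!,
  so the series converges and may be differentiated term by term; the derivatives of the terms
  reproduce M times the sum, and h contributes f.\<close>

lemma linear_ode_exists:
  fixes M :: "real^'n::finite^'n" and f :: "real \<Rightarrow> real^'n"
  assumes f: "continuous_on UNIV f"
  shows "\<exists>X. X 0 = X0 \<and> (\<forall>s. (X has_vector_derivative M *v X s + f s) (at s))"
proof -
  define h where "h s = X0 + anti f s" for s
  have hd: "(h has_vector_derivative f s) (at s)" for s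
    unfolding h_def by (auto intro!: derivative_eq_intros anti_deriv[OF f])
  have hc: "continuous_on UNIV h" by (rule has_vector_derivative_continuous_on_UNIV[OF hd])
  let ?p = "picard M h"
  have pc: "continuous_on UNIV (\<lambda>s. M *v ?p k s)" for k
    by (intro continuous_on_matrix_vector_mult continuous_on_picard hc)
  have pd: "(?p (Suc k) has_vector_derivative M *v ?p k s) (at s)" for k s
    using anti_deriv[OF pc] by simp
  have p0: "?p (Suc k) 0 = 0" for k using anti_0[OF pc] by simp
  obtain N where N: "N > 0" "\<And>y. norm (M *v y) \<le> norm y * N"
    using bounded_linear.pos_bounded[OF matrix_vector_mul_bounded_linear[of M]] by blast
  have bound: "\<exists>C\<ge>0. \<forall>k s. \<bar>s\<bar> \<le> T \<longrightarrow> norm (?p k s) \<le> C * (N * T) ^ k / fact k" for T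
  proof -
    have "bounded (h ` {-T..T})"
      using compact_imp_bounded[OF compact_continuous_image[OF continuous_on_subset[OF hc] compact_Icc]] by simp
    then obtain C where C: "\<forall>y\<in>h ` {-T..T}. norm y \<le> C" by (auto simp: bounded_iff)
    have b: "norm (?p k s) \<le> (max C 0 * N ^ k / fact k) * \<bar>s\<bar> ^ k" if "\<bar>s\<bar> \<le> T" for k s
      using that
    proof (induction k arbitrary: s)
      case 0
      then have "norm (h s) \<le> C" using C by (simp add: abs_le_iff)
      then show ?case by simp
    next
      case (Suc k)
      have "norm (?p (Suc k) s) \<le> (N * (max C 0 * N ^ k / fact k)) * \<bar>s\<bar> ^ Suc k / Suc k"
      proof (rule power_bound_antiderivative[OF p0 pd _ Suc.prems])
        fix r assume r: "\<bar>r\<bar> \<le> T"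
        have "norm (M *v ?p k r) \<le> norm (?p k r) * N" by (rule N(2))
        also have "\<dots> \<le> (max C 0 * N ^ k / fact k * \<bar>r\<bar> ^ k) * N"
          using N(1) by (intro mult_right_mono Suc.IH r) simp
        finally show "norm (M *v ?p k r) \<le> (N * (max C 0 * N ^ k / fact k)) * \<bar>r\<bar> ^ k"
          by (simp add: mult_ac)
      qed
      also have "\<dots> = (max C 0 * N ^ Suc k / fact (Suc k)) * \<bar>s\<bar> ^ Suc k"
        by (simp add: mult_ac del: of_nat_Suc)
      finally show ?case .
    qed
    show ?thesis
    proof (intro exI[of _ "max C 0"] conjI allI impI)
      fix k and s :: real assume s: "\<bar>s\<bar> \<le> T"
      have "(max C 0 * N ^ k / fact k) * \<bar>s\<bar> ^ k \<le> (max C 0 * N ^ k / fact k) * T ^ k"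
        using N(1) s by (intro mult_left_mono power_mono) auto
      with b[OF s, of k] show "norm (?p k s) \<le> max C 0 * (N * T) ^ k / fact k"
        by (simp add: power_mult_distrib mult_ac)
    qed simp
  qed
  have sexp: "summable (\<lambda>k. C * (a ^ k) / fact k)" for C a :: real
    using summable_mult[OF summable_exp[of a], of C] by (simp add: divide_inverse mult_ac)
  have summ: "summable (\<lambda>k. ?p k s $ i)" for s i
  proof -
    obtain C where "\<forall>k r. \<bar>r\<bar> \<le> \<bar>s\<bar> \<longrightarrow> norm (?p k r) \<le> C * (N * \<bar>s\<bar>) ^ k / fact k"
      using bound[of "\<bar>s\<bar>"] by blast
    then have "norm (?p k s $ i) \<le> C * (N * \<bar>s\<bar>) ^ k / fact k" for k
      using component_le_norm_cart[of "?p k s" i] order_trans by fastforce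
    then show ?thesis by (intro summable_comparison_test'[OF sexp]) 
  qed
  define X where "X s = (\<chi> i. \<Sum>k. ?p k s $ i)" for s
  have "X 0 = X0"
  proof -
    have "(\<Sum>k. ?p k 0 $ i) = X0 $ i" for i
      using suminf_split_head[OF summ[of 0 i]] p0 anti_0[OF f] by (simp add: h_def del: picard.simps(2))
    then show ?thesis by (simp add: X_def vec_eq_iff)
  qed
  moreover have "(X has_vector_derivative M *v X s + f s) (at s)" for s
  proof -
    have "((\<lambda>r. X r $ i) has_vector_derivative (M *v X s + f s) $ i) (at s)" for i
    proof -
      \<comment> \<open>One more than |s|, so that s is interior to the interval of uniform
        convergence.\<close>
      let ?T = "\<bar>s\<bar> + 1"
      let ?S = "{-?T..?T}"
      obtain C where C: "C \<ge> 0" "\<And>k r. \<bar>r\<bar> \<le> ?T \<Longrightarrow> norm (?p k r) \<le> C * (N * ?T) ^ k / fact k"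
        using bound[of ?T] by blast
      have Mi: "norm ((M *v ?p k r) $ i) \<le> (C * N) * (N * ?T) ^ k / fact k" if "r \<in> ?S" for k r
      proof -
        have "norm ((M *v ?p k r) $ i) \<le> norm (M *v ?p k r)"
          by (simp add: component_le_norm_cart)
        also have "\<dots> \<le> norm (?p k r) * N" by (rule N(2))
        also have "\<dots> \<le> (C * (N * ?T) ^ k / fact k) * N"
          using that N(1) by (intro mult_right_mono C) auto
        finally show ?thesis by (simp add: mult_ac)
      qed
      have d: "((\<lambda>r. ?p (Suc k) r $ i) has_field_derivative (M *v ?p k r) $ i) (at r within ?S)" for k r
        using bounded_linear.has_vector_derivative[OF bounded_linear_vec_nth pd[of k r]]
        by (auto simp: has_real_derivative_iff_has_vector_derivative simp del: picard.simps
            intro: has_vector_derivative_at_within)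
      have u: "uniformly_convergent_on ?S (\<lambda>n r. \<Sum>k<n. (M *v ?p k r) $ i)"
        by (rule Weierstrass_m_test'[OF Mi sexp])
      have z: "summable (\<lambda>k. ?p (Suc k) 0 $ i)" unfolding p0 by simp
      have "convex ?S" "0 \<in> ?S" "s \<in> interior ?S" by (auto simp: abs_if)
      from has_field_derivative_series'(2)[OF this(1) d u this(2) z this(3)]
      have "((\<lambda>r. \<Sum>k. ?p (Suc k) r $ i) has_field_derivative (\<Sum>k. (M *v ?p k s) $ i)) (at s)" .
      then have "((\<lambda>r. h r $ i + (\<Sum>k. ?p (Suc k) r $ i)) has_real_derivative
          f s $ i + (\<Sum>k. (M *v ?p k s) $ i)) (at s)"
        using bounded_linear.has_vector_derivative[OF bounded_linear_vec_nth hd[of s], of i]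
        by (intro DERIV_add) (simp_all add: has_real_derivative_iff_has_vector_derivative)
      moreover have "h r $ i + (\<Sum>k. ?p (Suc k) r $ i) = X r $ i" for r
        using suminf_split_head[OF summ[of r i]] by (simp add: X_def del: picard.simps(2))
      moreover have "(\<Sum>k. (M *v ?p k s) $ i) = (M *v X s) $ i"
      proof -
        have "(\<Sum>k. (M *v ?p k s) $ i) = (\<Sum>k. \<Sum>j\<in>UNIV. M $ i $ j * ?p k s $ j)"
          by (simp add: matrix_vector_mult_def)
        also have "\<dots> = (\<Sum>j\<in>UNIV. \<Sum>k. M $ i $ j * ?p k s $ j)"
          by (rule suminf_sum) (intro summable_mult summ)
        also have "\<dots> = (M *v X s) $ i"
          using suminf_mult[OF summ] by (simp add: matrix_vector_mult_def X_def)
        finally show ?thesis .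
      qed
      ultimately show ?thesis
        by (simp add: has_real_derivative_iff_has_vector_derivative add.commute)
    qed
    then show ?thesis
      unfolding has_vector_derivative_def
      by (subst has_derivative_componentwise_within) (auto simp: Basis_vec_def inner_axis)
  qed
  ultimately show ?thesis by blast
qed

text \<open>Gronwall for |X - Y|^2, which grows at rate at most 2 C while the forcings agree.
  Agreement is asked only before t, and this causality is what the method of steps relies
  on.\<close>

lemma linear_ode_causal:
  fixes M :: "real^'n::finite^'n"
  assumes X: "X 0 = X0" "\<And>s. (X has_vector_derivative M *v X s + f s) (at s)"
    and Y: "Y 0 = X0" "\<And>s. (Y has_vector_derivative M *v Y s + g s) (at s)"
    and eq: "\<And>s. 0 < s \<Longrightarrow> s < t \<Longrightarrow> f s = g s" and t: "t \<ge> 0"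
  shows "X t = Y t"
proof -
  obtain C where C: "C > 0" "\<And>x y. \<bar>x \<bullet> (M *v y)\<bar> \<le> C * (norm x * norm y)"
    using inner_matrix_bound[of M] by blast
  let ?W = "\<lambda>s. X s - Y s"
  have W: "(?W has_vector_derivative M *v ?W s + (f s - g s)) (at s)" for s
    by (auto intro!: derivative_eq_intros X Y simp: matrix_vector_mult_diff_distrib)
  have d: "((\<lambda>s. ?W s \<bullet> ?W s) has_real_derivative 2 * (?W s \<bullet> (M *v ?W s + (f s - g s)))) (at s)" for s
    using bounded_bilinear.has_vector_derivative[OF bounded_bilinear_inner W W, of s]
    by (simp add: has_real_derivative_iff_has_vector_derivative inner_commute)
  have "?W t \<bullet> ?W t \<le> exp (- (- 2 * C) * t) * (?W 0 \<bullet> ?W 0)"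
  proof (rule exponential_decay[OF t has_field_derivative_at_within[OF d]])
    fix s assume s: "0 < s" "s < t"
    show "2 * (?W s \<bullet> (M *v ?W s + (f s - g s))) \<le> - (- 2 * C) * (?W s \<bullet> ?W s)"
      using C(2)[of "?W s" "?W s"] eq[OF s] by (simp add: dot_square_norm power2_eq_square)
  qed
  then have "?W t \<bullet> ?W t \<le> 0" using X(1) Y(1) by simp
  then have "?W t \<bullet> ?W t = 0" using inner_ge_zero[of "?W t"] by linarith
  then show ?thesis by (simp only: inner_eq_zero_iff right_minus_eq)
qed

section \<open>Functions that are continuously differentiable off the integers\<close>

text \<open>The derivative must exist near s and not only at s, so that it agrees with
  \<open>der\<close> on a neighbourhood and passes its continuity on.\<close>

definition C1_at :: "(real \<Rightarrow> real) \<Rightarrow> real \<Rightarrow> bool" where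
  "C1_at f s \<longleftrightarrow> (\<exists>d. (\<forall>\<^sub>F r in nhds s. (f has_real_derivative d r) (at r)) \<and> isCont d s)"

text \<open>If \<open>v\<^sup>0(0)\<close> is not the initial velocity of \<open>K X\<close>, then the derivatives of the travelling waves
  have jumps, which the reflections carry to all integers.\<close>

definition PC1 :: "(real \<Rightarrow> real) \<Rightarrow> bool" where
  "PC1 f \<longleftrightarrow> (\<forall>M. \<exists>L. L-lipschitz_on {-M..M} f) \<and> (\<forall>s. s \<notin> \<int> \<longrightarrow> C1_at f s)"

lemma C1_at_transform:
  assumes "C1_at f s" "\<forall>\<^sub>F r in nhds s. f r = g r"
  shows "C1_at g s"
proof -
  obtain d where d: "\<forall>\<^sub>F r in nhds s. (f has_real_derivative d r) (at r)" "isCont d s"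
    using assms(1) by (auto simp: C1_at_def)
  have "\<forall>\<^sub>F r in nhds s. \<forall>\<^sub>F r' in nhds r. f r' = g r'"
    using assms(2) by (simp add: eventually_eventually)
  with d(1) have "\<forall>\<^sub>F r in nhds s. (g has_real_derivative d r) (at r)"
  proof eventually_elim
    case (elim r)
    then show ?case using DERIV_cong_ev[of r r f g "d r" "d r"] by simp
  qed
  with d(2) show ?thesis by (auto simp: C1_at_def)
qed

lemma C1_at_add:
  assumes "C1_at f s" "C1_at g s"
  shows "C1_at (\<lambda>r. f r + g r) s"
proof -
  obtain d e where d: "\<forall>\<^sub>F r in nhds s. (f has_real_derivative d r) (at r)" "isCont d s"
    and e: "\<forall>\<^sub>F r in nhds s. (g has_real_derivative e r) (at r)" "isCont e s"
    using assms by (auto simp: C1_at_def)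
  from d(1) e(1) have "\<forall>\<^sub>F r in nhds s. ((\<lambda>r. f r + g r) has_real_derivative d r + e r) (at r)"
    by eventually_elim (rule DERIV_add)
  moreover have "isCont (\<lambda>r. d r + e r) s" using d(2) e(2) by simp
  ultimately show ?thesis unfolding C1_at_def by (intro exI conjI)
qed

lemma C1_at_affine:
  assumes "C1_at f s"
  shows "C1_at (\<lambda>r. k * f r + l) s"
proof -
  obtain d where "\<forall>\<^sub>F r in nhds s. (f has_real_derivative d r) (at r)" "isCont d s"
    using assms by (auto simp: C1_at_def)
  then have "\<forall>\<^sub>F r in nhds s. ((\<lambda>r. k * f r + l) has_real_derivative k * d r) (at r)" "isCont (\<lambda>r. k * d r) s"
    by (auto elim!: eventually_mono intro!: derivative_eq_intros)
  then show ?thesis unfolding C1_at_def by (intro exI conjI)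
qed

lemma C1_at_shift:
  assumes "C1_at f (s + k)"
  shows "C1_at (\<lambda>r. f (r + k)) s"
proof -
  obtain d where d: "\<forall>\<^sub>F r in nhds (s + k). (f has_real_derivative d r) (at r)" "isCont d (s + k)"
    using assms by (auto simp: C1_at_def)
  have "filterlim (\<lambda>r. r + k) (nhds (s + k)) (nhds s)"
    by (intro tendsto_add filterlim_ident tendsto_const)
  from eventually_compose_filterlim[OF d(1) this]
  have "\<forall>\<^sub>F r in nhds s. ((\<lambda>r. f (r + k)) has_real_derivative d (r + k)) (at r)"
    by (simp add: DERIV_shift)
  moreover have "isCont (\<lambda>r. d (r + k)) s"
    by (rule isCont_o2[where f="\<lambda>r. r + k" and g=d and a=s]) (use d(2) in simp_all)
  ultimately show ?thesis unfolding C1_at_def by (intro exI conjI)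
qed

lemma PC1_C1_at: "PC1 f \<Longrightarrow> s \<notin> \<int> \<Longrightarrow> C1_at f s"
  by (simp add: PC1_def)

lemma PC1_lipschitz:
  assumes "PC1 f"
  obtains L where "L \<ge> 0" "\<And>x y. \<bar>x\<bar> \<le> M \<Longrightarrow> \<bar>y\<bar> \<le> M \<Longrightarrow> \<bar>f x - f y\<bar> \<le> L * \<bar>x - y\<bar>"
proof -
  obtain L where L: "L-lipschitz_on {-M..M} f" using assms by (auto simp: PC1_def)
  show ?thesis
  proof (rule that)
    show "L \<ge> 0" using L by (rule lipschitz_on_nonneg)
    show "\<bar>f x - f y\<bar> \<le> L * \<bar>x - y\<bar>" if "\<bar>x\<bar> \<le> M" "\<bar>y\<bar> \<le> M" for x y
      using lipschitz_onD[OF L, of x y] that by (auto simp: dist_real_def abs_le_iff)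
  qed
qed

lemma PC1_continuous_on: "PC1 f \<Longrightarrow> continuous_on UNIV f"
proof -
  assume f: "PC1 f"
  have "isCont f x" for x
  proof -
    obtain L where "L-lipschitz_on {-(\<bar>x\<bar> + 1)..\<bar>x\<bar> + 1} f" using f unfolding PC1_def by blast
    then have "continuous_on {-(\<bar>x\<bar> + 1)..\<bar>x\<bar> + 1} f" by (rule lipschitz_on_continuous_on)
    then show ?thesis by (rule continuous_on_interior) (auto simp: abs_if)
  qed
  then show ?thesis by (simp add: continuous_on_eq_continuous_at)
qed

lemma PC1_C1:
  assumes d: "\<And>x. (f has_real_derivative f' x) (at x)" and c: "continuous_on UNIV f'"
  shows "PC1 f"
  unfolding PC1_def
proof (intro conjI allI impI)
  fix M :: real
  obtain C where C: "\<And>x. x \<in> {-M..M} \<Longrightarrow> \<bar>f' x\<bar> \<le> C"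
    using continuous_on_Icc_bound[OF continuous_on_subset[OF c], of "-M" M] by auto
  have "(max C 0)-lipschitz_on {-M..M} f"
  proof (rule lipschitz_onI)
    fix x y assume xy: "x \<in> {-M..M}" "y \<in> {-M..M}"
    have "norm (f x - f y) \<le> max C 0 * norm (x - y)"
      by (rule field_differentiable_bound[of "{-M..M}" f f'])
        (use xy C d in \<open>auto intro: has_field_derivative_at_within le_max_iff_disj[THEN iffD2]\<close>)
    then show "dist (f x) (f y) \<le> max C 0 * dist x y" by (simp add: dist_norm)
  qed simp
  then show "\<exists>L. L-lipschitz_on {-M..M} f" ..
next
  fix s :: real
  show "C1_at f s"
    unfolding C1_at_def using d c by (intro exI[of _ f']) (auto simp: continuous_on_eq_continuous_at)
qed

lemma PC1_add:
  assumes f: "PC1 f" and g: "PC1 g"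
  shows "PC1 (\<lambda>s. f s + g s)"
  unfolding PC1_def
proof (intro conjI allI impI)
  fix M :: real
  obtain L L' where "L-lipschitz_on {-M..M} f" "L'-lipschitz_on {-M..M} g"
    using f g unfolding PC1_def by blast
  then show "\<exists>L. L-lipschitz_on {-M..M} (\<lambda>s. f s + g s)" using lipschitz_on_add by blast
next
  show "C1_at (\<lambda>s. f s + g s) s" if "s \<notin> \<int>" for s
    using f g that by (intro C1_at_add) (auto simp: PC1_def)
qed

lemma PC1_affine:
  assumes f: "PC1 f"
  shows "PC1 (\<lambda>s. k * f s + l)"
  unfolding PC1_def
proof (intro conjI allI impI)
  fix M :: real
  obtain L where L: "L-lipschitz_on {-M..M} f"
    using f unfolding PC1_def by blast
  have "(\<bar>k\<bar> * L)-lipschitz_on {-M..M} (\<lambda>s. k * f s + l)"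
  proof (rule lipschitz_onI)
    fix x y assume "x \<in> {-M..M}" "y \<in> {-M..M}"
    from mult_left_mono[OF lipschitz_onD[OF L this], of "\<bar>k\<bar>"]
    show "dist (k * f x + l) (k * f y + l) \<le> \<bar>k\<bar> * L * dist x y"
      by (simp add: dist_real_def mult.assoc flip: abs_mult right_diff_distrib)
  qed (use lipschitz_on_nonneg[OF L] in simp)
  then show "\<exists>L. L-lipschitz_on {-M..M} (\<lambda>s. k * f s + l)" ..
next
  show "C1_at (\<lambda>s. k * f s + l) s" if "s \<notin> \<int>" for s
    using f that by (intro C1_at_affine) (auto simp: PC1_def)
qed

lemma PC1_shift:
  assumes f: "PC1 f" and k: "k \<in> \<int>"
  shows "PC1 (\<lambda>s. f (s + k))"
  unfolding PC1_def
proof (intro conjI allI impI)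
  fix M :: real
  obtain L where L: "L-lipschitz_on {-(M + \<bar>k\<bar>)..M + \<bar>k\<bar>} f"
    using f unfolding PC1_def by blast
  have "L-lipschitz_on {-M..M} (\<lambda>s. f (s + k))"
  proof (rule lipschitz_onI)
    fix x y assume "x \<in> {-M..M}" "y \<in> {-M..M}"
    then have "x + k \<in> {-(M + \<bar>k\<bar>)..M + \<bar>k\<bar>}" "y + k \<in> {-(M + \<bar>k\<bar>)..M + \<bar>k\<bar>}" by auto
    from lipschitz_onD[OF L this] show "dist (f (x + k)) (f (y + k)) \<le> L * dist x y"
      by (simp add: dist_real_def)
  qed (rule lipschitz_on_nonneg[OF L])
  then show "\<exists>L. L-lipschitz_on {-M..M} (\<lambda>s. f (s + k))" ..
next
  show "C1_at (\<lambda>s. f (s + k)) s" if "s \<notin> \<int>" for s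
  proof -
    have "s + k \<notin> \<int>" using that k Ints_diff[of "s + k" k] by auto
    then show ?thesis using f by (intro C1_at_shift) (auto simp: PC1_def)
  qed
qed

text \<open>Continuity at the junction is enough: a kink there is permitted because k is an
  integer.\<close>

lemma PC1_glue:
  assumes f: "PC1 f" and g: "PC1 g" and k: "k \<in> \<int>" and fg: "f k = g k"
  shows "PC1 (\<lambda>s. if s \<le> k then f s else g s)"
  unfolding PC1_def
proof (intro conjI allI impI)
  fix M :: real
  let ?M = "max M \<bar>k\<bar>"
  obtain L L' where L: "L-lipschitz_on {-?M..?M} f" and L': "L'-lipschitz_on {-?M..?M} g"
    using f g unfolding PC1_def by blast
  have "{-?M..k} \<subseteq> {-?M..?M}" "{k..?M} \<subseteq> {-?M..?M}" by auto
  then have "L-lipschitz_on {-?M..k} f" "L'-lipschitz_on {k..?M} g"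
    using L L' lipschitz_on_subset by blast+
  then have "(max L L')-lipschitz_on {-?M..?M} (\<lambda>s. if s \<le> k then f s else g s)"
    by (rule lipschitz_on_concat_max[where f=f and g=g and b=k]) (rule fg)
  then have "(max L L')-lipschitz_on {-M..M} (\<lambda>s. if s \<le> k then f s else g s)"
    by (rule lipschitz_on_subset) auto
  then show "\<exists>L. L-lipschitz_on {-M..M} (\<lambda>s. if s \<le> k then f s else g s)" ..
next
  fix s :: real assume s: "s \<notin> \<int>"
  then have "s \<noteq> k" using k by auto
  then consider "s < k" | "k < s" by linarith
  then show "C1_at (\<lambda>s. if s \<le> k then f s else g s) s"
  proof cases
    case 1
    have "\<forall>\<^sub>F r in nhds s. r < k" using 1 by (rule eventually_nhds_in_open[of "{..<k}", simplified])
    then have "\<forall>\<^sub>F r in nhds s. f r = (if r \<le> k then f r else g r)" by eventually_elim simp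
    with PC1_C1_at[OF f s] show ?thesis by (rule C1_at_transform)
  next
    case 2
    have "\<forall>\<^sub>F r in nhds s. k < r" using 2 by (rule eventually_nhds_in_open[of "{k<..}", simplified])
    then have "\<forall>\<^sub>F r in nhds s. g r = (if r \<le> k then f r else g r)" by eventually_elim simp
    with PC1_C1_at[OF g s] show ?thesis by (rule C1_at_transform)
  qed
qed

text \<open>For functions assembled by the method of steps, which are known only through good
  extensions from half-lines.\<close>

lemma PC1_local:
  assumes "\<And>n::nat. \<exists>g. PC1 g \<and> (\<forall>s\<le>real n. f s = g s)"
  shows "PC1 f"
  unfolding PC1_def
proof (intro conjI allI impI)
  fix M :: real
  obtain n :: nat where n: "M \<le> n" using real_arch_simple by blast
  obtain g where "PC1 g \<and> (\<forall>s\<le>real n. f s = g s)" using assms[of n] ..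
  then have g: "PC1 g" "\<And>s. s \<le> real n \<Longrightarrow> f s = g s" by simp_all
  obtain L where "L-lipschitz_on {-M..M} g" using g(1) unfolding PC1_def by blast
  then have "L-lipschitz_on {-M..M} f"
    by (rule lipschitz_on_transform) (use g(2) n in auto)
  then show "\<exists>L. L-lipschitz_on {-M..M} f" ..
next
  fix s :: real assume s: "s \<notin> \<int>"
  obtain n :: nat where n: "s < n" using reals_Archimedean2 by blast
  obtain g where "PC1 g \<and> (\<forall>s\<le>real n. f s = g s)" using assms[of n] ..
  then have g: "PC1 g" "\<And>s. s \<le> real n \<Longrightarrow> f s = g s" by simp_all
  have "\<forall>\<^sub>F r in nhds s. r < n" using n by (rule eventually_nhds_in_open[of "{..<real n}", simplified])
  then have "\<forall>\<^sub>F r in nhds s. g r = f r" by eventually_elim (simp add: g(2))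
  with PC1_C1_at[OF g(1) s] show "C1_at f s" by (rule C1_at_transform)
qed

section \<open>The delay system for the travelling waves\<close>

text \<open>Method of steps: \<open>b\<close> on \<open>(-\<infinity>, n + 1]\<close> is determined by its values on \<open>(-\<infinity>, n]\<close>, so the
  iterates of the right-hand side stabilise.\<close>

lemma delay_system_exists:
  fixes M :: "real^'n::finite^'n" and N X0 :: "real^'n" and k :: "real^'n \<Rightarrow> real"
  assumes k: "bounded_linear k" and a0: "PC1 a0" and b0: "PC1 b0"
    and compat: "a0 0 + b0 0 = k X0" and \<kappa>: "\<kappa> = a0 1 - \<rho> * b0 (- 1)"
  obtains a b X where "PC1 a" "PC1 b" "\<And>s. s \<le> 1 \<Longrightarrow> a s = a0 s" "\<And>s. s \<le> 0 \<Longrightarrow> b s = b0 s"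
    "\<And>s. s \<ge> 0 \<Longrightarrow> a (s + 1) = \<rho> * b (s - 1) + \<kappa>" "\<And>s. s \<ge> 0 \<Longrightarrow> a s + b s = k (X s)" "X 0 = X0"
    "\<And>s. (X has_vector_derivative M *v X s + ((1 + \<rho>) * b (s - 1) + \<kappa>) *\<^sub>R N) (at s)"
proof -
  define F where "F b s = ((1 + \<rho>) * b (s - 1) + \<kappa>) *\<^sub>R N" for b :: "real \<Rightarrow> real" and s
  define Xs where "Xs b = (SOME X. X 0 = X0 \<and> (\<forall>s. (X has_vector_derivative M *v X s + F b s) (at s)))" for b
  \<comment> \<open>The reflection at x = 1, a(s + 1) = \<rho> b(s - 1) + \<kappa>, solved for a at
    arguments beyond 1.\<close>
  define as where "as b s = (if s \<le> 1 then a0 s else \<rho> * b (s - 2) + \<kappa>)" for b :: "real \<Rightarrow> real" and s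
  \<comment> \<open>The reflection at x = 0, a + b = k X, solved for b at positive times.\<close>
  define \<Phi> where "\<Phi> b s = (if s \<le> 0 then b0 s else k (Xs b s) - as b s)" for b s
  have Fc: "continuous_on UNIV (F b)" if "PC1 b" for b
  proof -
    have "continuous_on UNIV (\<lambda>s. b (s - 1))"
      by (rule continuous_on_compose2[OF PC1_continuous_on[OF that]]) (auto intro!: continuous_intros)
    then show ?thesis unfolding F_def by (intro continuous_intros)
  qed
  have Xs: "Xs b 0 = X0" "(Xs b has_vector_derivative M *v Xs b s + F b s) (at s)" if "PC1 b" for b s
  proof -
    have "Xs b 0 = X0 \<and> (\<forall>s. (Xs b has_vector_derivative M *v Xs b s + F b s) (at s))"
      unfolding Xs_def by (rule someI_ex[OF linear_ode_exists[OF Fc[OF that]]])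
    then show "Xs b 0 = X0" "(Xs b has_vector_derivative M *v Xs b s + F b s) (at s)" by auto
  qed
  have kX: "PC1 (\<lambda>s. k (Xs b s))" if b: "PC1 b" for b
  proof (rule PC1_C1)
    show "((\<lambda>s. k (Xs b s)) has_real_derivative k (M *v Xs b s + F b s)) (at s)" for s
      using bounded_linear.has_vector_derivative[OF k Xs(2)[OF b]]
      by (simp add: has_real_derivative_iff_has_vector_derivative)
    have "continuous_on UNIV (Xs b)" by (rule has_vector_derivative_continuous_on_UNIV[OF Xs(2)[OF b]])
    then show "continuous_on UNIV (\<lambda>s. k (M *v Xs b s + F b s))"
      by (intro bounded_linear.continuous_on[OF k] continuous_on_add continuous_on_matrix_vector_mult Fc b)
  qed
  have as: "PC1 (as b)" if b: "PC1 b" and bb: "\<And>s. s \<le> 0 \<Longrightarrow> b s = b0 s" for b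
    unfolding as_def
  \<comment> \<open>\<kappa> is the constant that makes a continuous at 1; the delayed argument
    there is -1, where b equals b0.\<close>
  proof (rule PC1_glue[OF a0])
    show "PC1 (\<lambda>s. \<rho> * b (s - 2) + \<kappa>)"
      using PC1_affine[OF PC1_shift[OF b, of "-2"]] by simp
  qed (simp_all add: \<kappa> bb)
  have inv: "PC1 (\<Phi> b)" if b: "PC1 b" and bb: "\<And>s. s \<le> 0 \<Longrightarrow> b s = b0 s" for b
    unfolding \<Phi>_def
  proof (rule PC1_glue[OF b0])
    show "PC1 (\<lambda>s. k (Xs b s) - as b s)"
      using PC1_add[OF kX[OF b] PC1_affine[OF as[OF b bb], of "-1" 0]] by simp
    show "b0 0 = k (Xs b 0) - as b 0" using compat by (simp add: Xs[OF b] as_def)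
  qed simp
  \<comment> \<open>The right-hand side at s uses b only up to s - 1: the forcing before time s
    involves b delayed by 1, and a involves b(s - 2). Agreement therefore gains one unit per
    application.\<close>
  have causal: "\<Phi> b s = \<Phi> b' s" if b: "PC1 b" "PC1 b'" and eq: "\<And>r. r \<le> t \<Longrightarrow> b r = b' r" and s: "s \<le> t + 1"
    for b b' s t
  proof (cases "s \<le> 0")
    case False
    have "Xs b s = Xs b' s"
      by (rule linear_ode_causal[OF Xs[OF b(1)] Xs[OF b(2)]]) (use False s eq in \<open>auto simp: F_def\<close>)
    moreover have "as b s = as b' s" using s eq by (simp add: as_def)
    ultimately show ?thesis by (simp add: \<Phi>_def)
  qed (simp add: \<Phi>_def)
  define bn where "bn n = (\<Phi> ^^ n) b0" for n
  have bn_Suc: "bn (Suc n) = \<Phi> (bn n)" for n by (simp add: bn_def)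
  have bn: "PC1 (bn n) \<and> (\<forall>s\<le>0. bn n s = b0 s)" for n
  proof (induction n)
    case (Suc n)
    then have "PC1 (\<Phi> (bn n))" using inv[of "bn n"] by simp
    moreover have "\<Phi> (bn n) s = b0 s" if "s \<le> 0" for s using that by (simp add: \<Phi>_def)
    ultimately show ?case unfolding bn_Suc by simp
  qed (simp add: bn_def b0)
  have step: "bn (Suc n) s = bn n s" if "s \<le> real n" for n s
    using that
  proof (induction n arbitrary: s)
    case 0
    then show ?case by (simp add: bn_def \<Phi>_def)
  next
    case (Suc n)
    show ?case unfolding bn_Suc[of "Suc n"] bn_Suc[of n]
      by (rule causal[where t="real n"]) (use bn[of n] bn[of "Suc n"] Suc bn_Suc in auto)
  qed
  have stable: "bn (n + m) s = bn n s" if "s \<le> real n" for n m s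
  proof (induction m)
    case (Suc m)
    then show ?case using step[of s "n + m"] that by simp
  qed simp
  \<comment> \<open>On (-\<infinity>, n] the iterates are stationary from index n on, so the value
    at s is read off at the first index that covers s.\<close>
  define b where "b s = bn (nat \<lceil>s\<rceil>) s" for s
  have b_eq: "b s = bn n s" if "s \<le> real n" for n s
  proof -
    have "nat \<lceil>s\<rceil> \<le> n" using that by (simp add: ceiling_le_iff)
    then obtain m where m: "n = nat \<lceil>s\<rceil> + m" using le_Suc_ex by blast
    have "s \<le> real (nat \<lceil>s\<rceil>)" by linarith
    from stable[OF this, of m] show ?thesis by (simp add: b_def m)
  qed
  have PC1_b: "PC1 b"
    by (rule PC1_local) (use b_eq bn in blast)
  have b0_eq: "b s = b0 s" if "s \<le> 0" for s
    using b_eq[of s 0] bn[of 0] that by simp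
  have fixp: "\<Phi> b s = b s" for s
  proof -
    obtain n :: nat where n: "s \<le> real n" using real_arch_simple by blast
    have "\<Phi> b s = \<Phi> (bn n) s"
      by (rule causal[where t="real n"]) (use PC1_b bn b_eq n in auto)
    also have "\<dots> = bn n s" using step[OF n] by (simp add: bn_Suc)
    finally show ?thesis using b_eq[OF n] by simp
  qed
  show ?thesis
  proof (rule that[of "as b" b "Xs b"])
    show "PC1 (as b)" by (rule as[OF PC1_b b0_eq])
    show "as b (s + 1) = \<rho> * b (s - 1) + \<kappa>" if "s \<ge> 0" for s
    proof (cases "s = 0")
      case True
      then show ?thesis by (simp add: as_def \<kappa> b0_eq)
    next
      case False
      then show ?thesis using that by (simp add: as_def)
    qed
    show "as b s + b s = k (Xs b s)" if "s \<ge> 0" for s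
    proof (cases "s = 0")
      case True
      then show ?thesis using compat by (simp add: as_def b0_eq Xs[OF PC1_b])
    next
      case False
      then have "\<Phi> b s = k (Xs b s) - as b s" using that by (simp add: \<Phi>_def)
      then show ?thesis by (simp add: fixp)
    qed
    show "(Xs b has_vector_derivative M *v Xs b s + ((1 + \<rho>) * b (s - 1) + \<kappa>) *\<^sub>R N) (at s)" for s
      using Xs(2)[OF PC1_b] by (simp add: F_def)
  qed (simp_all add: PC1_b b0_eq as_def Xs[OF PC1_b])
qed

section \<open>Translates of piecewise smooth functions\<close>

text \<open>\<open>deriv\<close> is arbitrary at a kink. The value 0 at all integers keeps
  \<open>der f\<close> locally bounded and measurable, and translates meet the integers only on null
  sets of x.\<close>

definition der :: "(real \<Rightarrow> real) \<Rightarrow> real \<Rightarrow> real" where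
  "der f s = (if s \<in> \<int> then 0 else deriv f s)"

lemma eventually_not_Ints: "s \<notin> \<int> \<Longrightarrow> \<forall>\<^sub>F r in nhds s. r \<notin> (\<int> :: real set)"
  using eventually_nhds_in_open[of "- \<int>" s] closed_Ints by (simp add: closed_def)

lemma
  assumes "PC1 f" "s \<notin> \<int>"
  shows der_deriv: "(f has_real_derivative der f s) (at s)" and der_isCont: "isCont (der f) s"
proof -
  obtain d where d: "\<forall>\<^sub>F r in nhds s. (f has_real_derivative d r) (at r)" "isCont d s"
    using PC1_C1_at[OF assms] by (auto simp: C1_at_def)
  have ev: "\<forall>\<^sub>F r in nhds s. der f r = d r"
    using d(1) eventually_not_Ints[OF assms(2)] by eventually_elim (simp add: der_def DERIV_imp_deriv)
  have "(f has_real_derivative d s) (at s)" "der f s = d s"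
    using eventually_nhds_x_imp_x[OF d(1)] eventually_nhds_x_imp_x[OF ev] .
  then show "(f has_real_derivative der f s) (at s)" by simp
  show "isCont (der f) s" using isCont_cong[OF ev] d(2) by simp
qed

lemma der_bounded:
  assumes "PC1 f"
  obtains C where "\<And>s. \<bar>s\<bar> \<le> M \<Longrightarrow> \<bar>der f s\<bar> \<le> C"
proof -
  obtain L where L: "L \<ge> 0" "\<And>x y. \<bar>x\<bar> \<le> M + 1 \<Longrightarrow> \<bar>y\<bar> \<le> M + 1 \<Longrightarrow> \<bar>f x - f y\<bar> \<le> L * \<bar>x - y\<bar>"
    using PC1_lipschitz[OF assms, of "M + 1"] by blast
  have "\<bar>der f s\<bar> \<le> L" if s: "\<bar>s\<bar> \<le> M" for s
  proof (cases "s \<in> \<int>")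
    case False
    have "((\<lambda>r. \<bar>(f r - f s) / (r - s)\<bar>) \<longlongrightarrow> \<bar>der f s\<bar>) (at s)"
      using der_deriv[OF assms False] by (intro tendsto_rabs) (simp add: has_field_derivative_iff)
    moreover have "\<forall>\<^sub>F r in at s. \<bar>(f r - f s) / (r - s)\<bar> \<le> L"
    proof -
      have "\<forall>\<^sub>F r in at s. r \<in> ball s 1 \<and> r \<noteq> s"
        by (intro eventually_conj eventually_at_in_open' eventually_neq_at_within) auto
      then show ?thesis
      proof eventually_elim
        case (elim r)
        then have "\<bar>f r - f s\<bar> \<le> L * \<bar>r - s\<bar>" using s by (intro L(2)) (auto simp: dist_real_def)
        then show ?case using elim by (simp add: abs_divide pos_divide_le_eq)
      qed
    qed
    ultimately show ?thesis by (intro tendsto_upperbound) auto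
  qed (simp add: der_def L)
  then show ?thesis by (rule that)
qed

lemma countable_Ints_real: "countable (\<int> :: real set)"
  by (simp add: Ints_def)

lemma der_measurable: "PC1 f \<Longrightarrow> der f \<in> borel_measurable borel"
  using borel_measurable_continuous_countable_exceptions[OF countable_Ints_real, of "der f"]
  by (simp add: continuous_at_imp_continuous_on der_isCont)

lemma AE_not_Ints:
  assumes "\<epsilon> \<noteq> (0::real)"
  shows "AE x in I01. \<sigma> + \<epsilon> * x \<notin> \<int>"
proof -
  let ?S = "(\<lambda>y. (y - \<sigma>) / \<epsilon>) ` \<int>"
  have "countable ?S" using countable_Ints_real by simp
  then have "?S \<in> null_sets lebesgue" by (intro null_sets_completionI countable_imp_null_set_lborel)
  then have "AE x in lebesgue. x \<notin> ?S" by (rule AE_not_in)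
  then have "AE x in I01. x \<notin> ?S" by (subst AE_restrict_space_iff) auto
  then show ?thesis
  proof eventually_elim
    case (elim x)
    moreover have "x = ((\<sigma> + \<epsilon> * x) - \<sigma>) / \<epsilon>" using assms by simp
    ultimately show ?case by blast
  qed
qed

lemma translate_measurable:
  fixes \<sigma> \<epsilon> :: real
  assumes "g \<in> borel_measurable borel"
  shows "(\<lambda>x. g (\<sigma> + \<epsilon> * x)) \<in> borel_measurable I01"
  by (intro borel_measurable_I01 measurable_compose[OF _ assms]) simp

lemma translate_bound:
  fixes \<sigma> \<epsilon> x :: real
  assumes "\<bar>\<epsilon>\<bar> = 1" "x \<in> {0..1}"
  shows "\<bar>\<sigma> + \<epsilon> * x\<bar> \<le> \<bar>\<sigma>\<bar> + 1"
  using assms by (intro order_trans[OF abs_triangle_ineq]) (simp add: abs_mult)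

lemma translate_der_L2:
  assumes "PC1 f" "\<bar>\<epsilon>\<bar> = 1"
  shows "(\<lambda>x. der f (\<sigma> + \<epsilon> * x)) \<in> L2"
proof -
  obtain C where C: "\<And>s. \<bar>s\<bar> \<le> \<bar>\<sigma>\<bar> + 1 \<Longrightarrow> \<bar>der f s\<bar> \<le> C"
    using der_bounded[OF assms(1), of "\<bar>\<sigma>\<bar> + 1"] by blast
  show ?thesis
    by (rule L2_bounded[of _ C]) (use C translate_bound[OF assms(2)] translate_measurable[OF der_measurable[OF assms(1)]] in auto)
qed

lemma translate_AC:
  assumes f: "PC1 f" and \<epsilon>: "\<bar>\<epsilon>\<bar> = 1"
  shows "AC (\<lambda>x. f (\<sigma> + \<epsilon> * x)) (\<lambda>x. \<epsilon> * der f (\<sigma> + \<epsilon> * x))"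
proof -
  obtain C where C: "\<And>s. \<bar>s\<bar> \<le> \<bar>\<sigma>\<bar> + 1 \<Longrightarrow> \<bar>der f s\<bar> \<le> C"
    using der_bounded[OF f, of "\<bar>\<sigma>\<bar> + 1"] by blast
  let ?S = "{x \<in> {0..1}. \<sigma> + \<epsilon> * x \<in> \<int>}"
  have "\<epsilon> \<noteq> 0" using \<epsilon> by auto
  show ?thesis
  proof (rule AC_bounded_derivative[of ?S _ _ C])
    have "(\<lambda>x. \<sigma> + \<epsilon> * x) ` ?S \<subseteq> {k \<in> \<int>. \<bar>k\<bar> \<le> \<bar>\<sigma>\<bar> + 1}"
      using translate_bound[OF \<epsilon>] by auto
    then have "finite ((\<lambda>x. \<sigma> + \<epsilon> * x) ` ?S)"
      using finite_int_segment[of "- (\<bar>\<sigma>\<bar> + 1)" "\<bar>\<sigma>\<bar> + 1"]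
      by (elim finite_subset[rotated]) (auto simp: abs_le_iff)
    moreover have "inj_on (\<lambda>x. \<sigma> + \<epsilon> * x) ?S" using \<open>\<epsilon> \<noteq> 0\<close> by (intro inj_onI) simp
    ultimately show "finite ?S" by (rule finite_imageD)
    show "continuous_on {0..1} (\<lambda>x. f (\<sigma> + \<epsilon> * x))"
      by (rule continuous_on_compose2[OF PC1_continuous_on[OF f]]) (auto intro!: continuous_intros)
    show "((\<lambda>x. f (\<sigma> + \<epsilon> * x)) has_real_derivative \<epsilon> * der f (\<sigma> + \<epsilon> * x)) (at x)" if "x \<in> {0<..<1} - ?S" for x
    proof -
      have n: "\<sigma> + \<epsilon> * x \<notin> \<int>" using that by auto
      have "((\<lambda>x. \<sigma> + \<epsilon> * x) has_real_derivative \<epsilon>) (at x)" by (auto intro!: derivative_eq_intros)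
      from DERIV_chain2[OF der_deriv[OF f n] this] show ?thesis by (simp add: mult.commute)
    qed
    show "(\<lambda>x. \<epsilon> * der f (\<sigma> + \<epsilon> * x)) \<in> borel_measurable I01"
      using translate_measurable[OF der_measurable[OF f]] by simp
    show "\<bar>\<epsilon> * der f (\<sigma> + \<epsilon> * x)\<bar> \<le> C" if "x \<in> {0..1}" for x
      using C[OF translate_bound[OF \<epsilon> that]] \<epsilon> by (simp add: abs_mult)
  qed
qed

text \<open>Dominated convergence along sequences tending to t; dropping the first N terms ensures
  |s - t| < 1, where the bound holds.\<close>

lemma normL2_tendsto_0:
  fixes G :: "real \<Rightarrow> real \<Rightarrow> real" and t :: real
  assumes m: "\<And>s. s \<ge> 0 \<Longrightarrow> G s \<in> borel_measurable I01"
    and bound: "\<And>s x. s \<ge> 0 \<Longrightarrow> s \<noteq> t \<Longrightarrow> \<bar>s - t\<bar> < 1 \<Longrightarrow> x \<in> {0..1} \<Longrightarrow> \<bar>G s x\<bar> \<le> C"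
    and lim: "AE x in I01. ((\<lambda>s. G s x) \<longlongrightarrow> 0) (at t within {0..})"
  shows "((\<lambda>s. normL2 (G s)) \<longlongrightarrow> 0) (at t within {0..})"
proof -
  have "((\<lambda>s. \<integral>x. (G s x)\<^sup>2 \<partial>I01) \<longlongrightarrow> 0) (at t within {0..})"
    unfolding tendsto_at_iff_sequentially
  proof (intro allI impI)
    fix X :: "nat \<Rightarrow> real" assume X: "\<forall>i. X i \<in> {0..} - {t}" "X \<longlonglongrightarrow> t"
    obtain N where N: "\<And>n. n \<ge> N \<Longrightarrow> \<bar>X n - t\<bar> < 1"
      using LIMSEQ_D[OF X(2), of 1] by auto
    have "(\<lambda>n. \<integral>x. (G (X (n + N)) x)\<^sup>2 \<partial>I01) \<longlonglongrightarrow> (\<integral>x. 0\<^sup>2 \<partial>I01)"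
    proof (rule integral_dominated_convergence[where w="\<lambda>x. C\<^sup>2"])
      interpret finite_measure I01 by (rule finite_measure_I01)
      show "integrable I01 (\<lambda>x. C\<^sup>2)" by simp
      show "(\<lambda>x. (G (X (n + N)) x)\<^sup>2) \<in> borel_measurable I01" for n
        using m[of "X (n + N)"] X(1) by simp
      show "AE x in I01. norm ((G (X (n + N)) x)\<^sup>2) \<le> C\<^sup>2" for n
      proof (rule AE_I2)
        fix x assume "x \<in> space I01"
        then have "\<bar>G (X (n + N)) x\<bar> \<le> C" using X(1) N[of "n + N"] by (intro bound) auto
        from power_mono[OF this, of 2] show "norm ((G (X (n + N)) x)\<^sup>2) \<le> C\<^sup>2" by simp
      qed
      show "AE x in I01. (\<lambda>n. (G (X (n + N)) x)\<^sup>2) \<longlonglongrightarrow> 0\<^sup>2"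
        using lim
      proof eventually_elim
        case (elim x)
        then have "(\<lambda>n. G (X n) x) \<longlonglongrightarrow> 0"
          using X unfolding tendsto_at_iff_sequentially by (auto simp: comp_def)
        from LIMSEQ_ignore_initial_segment[OF this, of N] show ?case by (intro tendsto_power)
      qed
    qed simp
    then have "(\<lambda>n. \<integral>x. (G (X (n + N)) x)\<^sup>2 \<partial>I01) \<longlonglongrightarrow> 0" by simp
    then show "((\<lambda>s. \<integral>x. (G s x)\<^sup>2 \<partial>I01) \<circ> X) \<longlonglongrightarrow> 0"
      unfolding comp_def by (rule LIMSEQ_offset)
  qed
  from tendsto_real_sqrt[OF this] show ?thesis by (simp add: normL2_def)
qed

lemma translate_arg_bound:
  fixes c s t \<epsilon> x :: real
  assumes \<epsilon>: "\<bar>\<epsilon>\<bar> = 1" and x: "x \<in> {0..1}" and s: "\<bar>s - t\<bar> \<le> 1"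
  shows "\<bar>c * s + \<epsilon> * x\<bar> \<le> \<bar>c\<bar> * (\<bar>t\<bar> + 1) + 1"
proof -
  have "\<bar>c * s\<bar> \<le> \<bar>c\<bar> * (\<bar>t\<bar> + 1)" unfolding abs_mult using s by (intro mult_left_mono) auto
  then show ?thesis using translate_bound[OF \<epsilon> x, of "c * s"] by simp
qed

text \<open>\<open>der f\<close> can be discontinuous only at integers, so for almost every x the
  point c t + \<epsilon> x is one of continuity, and dominated convergence applies.\<close>

lemma translate_der_tendsto:
  assumes f: "PC1 f" and \<epsilon>: "\<bar>\<epsilon>\<bar> = 1"
  shows "((\<lambda>s. normL2 (\<lambda>x. der f (c * s + \<epsilon> * x) - der f (c * t + \<epsilon> * x))) \<longlongrightarrow> 0) (at t within {0..})"
proof -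
  let ?M = "\<bar>c\<bar> * (\<bar>t\<bar> + 1) + 1"
  obtain C where C: "\<And>s. \<bar>s\<bar> \<le> ?M \<Longrightarrow> \<bar>der f s\<bar> \<le> C" using der_bounded[OF f, of ?M] by blast
  have "\<epsilon> \<noteq> 0" using \<epsilon> by auto
  show ?thesis
  proof (rule normL2_tendsto_0)
    show "(\<lambda>x. der f (c * s + \<epsilon> * x) - der f (c * t + \<epsilon> * x)) \<in> borel_measurable I01" for s
      by (intro borel_measurable_diff translate_measurable der_measurable f)
    show "\<bar>der f (c * s + \<epsilon> * x) - der f (c * t + \<epsilon> * x)\<bar> \<le> C + C" if "\<bar>s - t\<bar> < 1" "x \<in> {0..1}" for s x
      using C[OF translate_arg_bound[OF \<epsilon> that(2), of s t c]] C[OF translate_arg_bound[OF \<epsilon> that(2), of t t c]] that(1) by simp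
    show "AE x in I01. ((\<lambda>s. der f (c * s + \<epsilon> * x) - der f (c * t + \<epsilon> * x)) \<longlongrightarrow> 0) (at t within {0..})"
      using AE_not_Ints[OF \<open>\<epsilon> \<noteq> 0\<close>, of "c * t"]
    proof eventually_elim
      case (elim x)
      have "((\<lambda>s. der f (c * s + \<epsilon> * x)) \<longlongrightarrow> der f (c * t + \<epsilon> * x)) (at t within {0..})"
        by (rule isCont_tendsto_compose[OF der_isCont[OF f elim]]) (intro tendsto_intros)
      from tendsto_diff[OF this tendsto_const[of "der f (c * t + \<epsilon> * x)"]] show ?case by simp
    qed
  qed
qed

text \<open>The difference quotients are bounded by a Lipschitz constant and converge for almost
  every x, namely where c t + \<epsilon> x is not an integer. Kinks of f therefore do no harm to
  differentiability in L2.\<close>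

lemma translate_L2_deriv:
  assumes f: "PC1 f" and \<epsilon>: "\<bar>\<epsilon>\<bar> = 1"
  shows "L2_deriv (\<lambda>s x. f (c * s + \<epsilon> * x)) (\<lambda>x. c * der f (c * t + \<epsilon> * x)) t"
proof -
  let ?M = "\<bar>c\<bar> * (\<bar>t\<bar> + 1) + 1"
  obtain C where C: "\<And>s. \<bar>s\<bar> \<le> ?M \<Longrightarrow> \<bar>der f s\<bar> \<le> C" using der_bounded[OF f, of ?M] by blast
  obtain L where "L \<ge> 0" and L: "\<And>x y. \<bar>x\<bar> \<le> ?M \<Longrightarrow> \<bar>y\<bar> \<le> ?M \<Longrightarrow> \<bar>f x - f y\<bar> \<le> L * \<bar>x - y\<bar>"
    using PC1_lipschitz[OF f, of ?M] by blast
  have "\<epsilon> \<noteq> 0" using \<epsilon> by auto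
  have fm: "f \<in> borel_measurable borel"
    using PC1_continuous_on[OF f] by (rule borel_measurable_continuous_onI)
  let ?G = "\<lambda>s x. 1 / (s - t) * (f (c * s + \<epsilon> * x) - f (c * t + \<epsilon> * x) - (s - t) * (c * der f (c * t + \<epsilon> * x)))"
  have "((\<lambda>s. normL2 (?G s)) \<longlongrightarrow> 0) (at t within {0..})"
  proof (rule normL2_tendsto_0)
    show "?G s \<in> borel_measurable I01" for s
      by (intro borel_measurable_times borel_measurable_diff translate_measurable der_measurable f fm) auto
    show "\<bar>?G s x\<bar> \<le> L * \<bar>c\<bar> + \<bar>c\<bar> * C" if s: "s \<noteq> t" "\<bar>s - t\<bar> < 1" and x: "x \<in> {0..1}" for s x
    proof -
      have "\<bar>f (c * s + \<epsilon> * x) - f (c * t + \<epsilon> * x)\<bar> \<le> L * \<bar>c * s + \<epsilon> * x - (c * t + \<epsilon> * x)\<bar>"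
        using s by (intro L translate_arg_bound \<epsilon> x) auto
      also have "c * s + \<epsilon> * x - (c * t + \<epsilon> * x) = c * (s - t)" by (simp add: algebra_simps)
      finally have 1: "\<bar>f (c * s + \<epsilon> * x) - f (c * t + \<epsilon> * x)\<bar> \<le> L * \<bar>c\<bar> * \<bar>s - t\<bar>" by (simp add: abs_mult mult.assoc)
      have 2: "\<bar>c * der f (c * t + \<epsilon> * x)\<bar> \<le> \<bar>c\<bar> * C"
        unfolding abs_mult by (intro mult_left_mono C translate_arg_bound \<epsilon> x) auto
      have "?G s x = (f (c * s + \<epsilon> * x) - f (c * t + \<epsilon> * x)) / (s - t) - c * der f (c * t + \<epsilon> * x)"
        using s by (simp add: diff_divide_distrib)
      moreover have "\<bar>(f (c * s + \<epsilon> * x) - f (c * t + \<epsilon> * x)) / (s - t)\<bar> \<le> L * \<bar>c\<bar>"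
        using 1 s by (simp add: abs_divide pos_divide_le_eq)
      moreover have "\<bar>p - q\<bar> \<le> a + b" if "\<bar>p\<bar> \<le> a" "\<bar>q\<bar> \<le> b" for p q a b :: real
        using that by linarith
      ultimately show ?thesis using 2 by presburger
    qed
    show "AE x in I01. ((\<lambda>s. ?G s x) \<longlongrightarrow> 0) (at t within {0..})"
      using AE_not_Ints[OF \<open>\<epsilon> \<noteq> 0\<close>, of "c * t"]
    proof eventually_elim
      case (elim x)
      have "((\<lambda>s. c * s + \<epsilon> * x) has_real_derivative c) (at t within {0..})"
        by (auto intro!: derivative_eq_intros)
      from DERIV_chain2[OF der_deriv[OF f elim] this]
      have "((\<lambda>s. (f (c * s + \<epsilon> * x) - f (c * t + \<epsilon> * x)) / (s - t)) \<longlongrightarrow> c * der f (c * t + \<epsilon> * x)) (at t within {0..})"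
        by (simp add: has_field_derivative_iff mult.commute)
      from tendsto_diff[OF this tendsto_const[of "c * der f (c * t + \<epsilon> * x)"]]
      have "((\<lambda>s. (f (c * s + \<epsilon> * x) - f (c * t + \<epsilon> * x)) / (s - t) - c * der f (c * t + \<epsilon> * x)) \<longlongrightarrow> 0) (at t within {0..})"
        by simp
      then show ?case
      proof (rule Lim_transform_eventually)
        show "\<forall>\<^sub>F s in at t within {0..}.
            (f (c * s + \<epsilon> * x) - f (c * t + \<epsilon> * x)) / (s - t) - c * der f (c * t + \<epsilon> * x) = ?G s x"
          using within_nonneg[of t] by eventually_elim (simp add: diff_divide_distrib)
      qed
    qed
  qed
  then show ?thesis
    unfolding L2_deriv_def normL2_scale by (simp add: mult.commute)
qed

lemma L2_deriv_tendsto: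
  assumes "L2_deriv f f' t" "t \<ge> 0" and f: "\<And>s. s \<ge> 0 \<Longrightarrow> f s \<in> L2" "f' \<in> L2"
  shows "((\<lambda>s. normL2 (\<lambda>x. f s x - f t x)) \<longlongrightarrow> 0) (at t within {0..})"
proof (rule tendsto_zero_le)
  let ?e = "\<lambda>s. normL2 (\<lambda>x. f s x - f t x - (s - t) * f' x)"
  have "((\<lambda>s. \<bar>s - t\<bar>) \<longlongrightarrow> \<bar>t - t\<bar>) (at t within {0..})" by (intro tendsto_intros)
  then have "((\<lambda>s. \<bar>s - t\<bar> * (normL2 f' + ?e s / \<bar>s - t\<bar>)) \<longlongrightarrow> 0 * (normL2 f' + 0)) (at t within {0..})"
    using assms(1) by (intro tendsto_intros) (simp_all add: L2_deriv_def)
  then show "((\<lambda>s. \<bar>s - t\<bar> * (normL2 f' + ?e s / \<bar>s - t\<bar>)) \<longlongrightarrow> 0) (at t within {0..})" by simp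
  fix s :: real assume s: "s \<ge> 0" "s \<noteq> t"
  have "normL2 (\<lambda>x. f s x - f t x) = normL2 (\<lambda>x. (s - t) * f' x + (f s x - f t x - (s - t) * f' x))" by simp
  also have "\<dots> \<le> normL2 (\<lambda>x. (s - t) * f' x) + ?e s"
    by (intro normL2_triangle L2_scale L2_diff f s assms(2))
  finally show "\<bar>normL2 (\<lambda>x. f s x - f t x)\<bar> \<le> \<bar>s - t\<bar> * (normL2 f' + ?e s / \<bar>s - t\<bar>)"
    using s by (simp add: normL2_scale distrib_left)
qed

lemma eq_of_derivatives_eq:
  fixes F G :: "real \<Rightarrow> 'a::real_normed_vector"
  assumes F: "\<And>s. s \<ge> 0 \<Longrightarrow> (F has_vector_derivative F' s) (at s)"
    and G: "\<And>s. s \<ge> 0 \<Longrightarrow> (G has_vector_derivative F' s) (at s)"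
    and 0: "F 0 = G 0" and s: "s \<ge> 0"
  shows "F s = G s"
proof -
  have "((\<lambda>s. F s - G s) has_derivative (\<lambda>h. 0)) (at r within {0..})" if "r \<in> {0..}" for r
    using has_vector_derivative_diff[OF F G, of r] that
    by (auto simp: has_vector_derivative_def intro: has_derivative_at_withinI)
  from has_derivative_zero_unique[OF convex_real_interval(1)[of 0] this, of 0 s]
  show ?thesis using 0 s by simp
qed

section \<open>Superpositions of travelling waves\<close>

definition wave :: "(real \<Rightarrow> real) \<Rightarrow> (real \<Rightarrow> real) \<Rightarrow> real \<Rightarrow> real \<Rightarrow> real \<Rightarrow> real" where
  "wave a b c t x = a (c * t + x) + b (c * t - x)"

definition wave_x :: "(real \<Rightarrow> real) \<Rightarrow> (real \<Rightarrow> real) \<Rightarrow> real \<Rightarrow> real \<Rightarrow> real \<Rightarrow> real" where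
  "wave_x a b c t x = der a (c * t + x) - der b (c * t - x)"

definition wave_t :: "(real \<Rightarrow> real) \<Rightarrow> (real \<Rightarrow> real) \<Rightarrow> real \<Rightarrow> real \<Rightarrow> real \<Rightarrow> real" where
  "wave_t a b c t x = c * (der a (c * t + x) + der b (c * t - x))"

lemma AC_weak_deriv: "AC F f \<Longrightarrow> f \<in> L2 \<Longrightarrow> weak_deriv F f"
  by (rule weak_derivI[OF _ AC_L2]) auto

context
  fixes a b :: "real \<Rightarrow> real"
  assumes a: "PC1 a" and b: "PC1 b"
begin

lemma der_wave_L2: "(\<lambda>x. der a (\<sigma> + x)) \<in> L2" "(\<lambda>x. der b (\<sigma> - x)) \<in> L2"
  using translate_der_L2[OF a, of 1 \<sigma>] translate_der_L2[OF b, of "-1" \<sigma>] by simp_all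

lemma wave_x_L2: "wave_x a b c t \<in> L2"
  unfolding wave_x_def[abs_def] by (intro L2_diff der_wave_L2)

lemma wave_t_L2: "wave_t a b c t \<in> L2"
  unfolding wave_t_def[abs_def] by (intro L2_scale L2_add der_wave_L2)

lemma wave_AC: "AC (wave a b c t) (wave_x a b c t)"
  using AC_add[OF translate_AC[OF a, of 1 "c * t"] translate_AC[OF b, of "-1" "c * t"]]
  by (simp add: wave_def[abs_def] wave_x_def[abs_def])

lemma wave_weak_deriv: "weak_deriv (wave a b c t) (wave_x a b c t)"
  by (rule AC_weak_deriv[OF wave_AC wave_x_L2])

lemma wave_L2: "wave a b c t \<in> L2"
  by (rule AC_L2[OF wave_AC])

lemma wave_L2_deriv:
  assumes t: "t \<ge> 0"
  shows "L2_deriv (wave a b c) (wave_t a b c t) t"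
proof -
  have L: "(\<lambda>x. a (\<sigma> + x)) \<in> L2" "(\<lambda>x. b (\<sigma> - x)) \<in> L2" for \<sigma>
    using translate_AC[OF a, of 1 \<sigma>] translate_AC[OF b, of "-1" \<sigma>] by (auto dest: AC_L2)
  have "L2_deriv (\<lambda>s x. a (c * s + x) + b (c * s - x)) (\<lambda>x. c * der a (c * t + x) + c * der b (c * t - x)) t"
    using translate_L2_deriv[OF a, of 1 c t] translate_L2_deriv[OF b, of "-1" c t]
    by (intro L2_deriv_add t L L2_scale der_wave_L2) simp_all
  then show ?thesis by (simp add: wave_def[abs_def] wave_t_def[abs_def] distrib_left)
qed

lemma
  shows wave_x_tendsto: "((\<lambda>s. normL2 (\<lambda>x. wave_x a b c s x - wave_x a b c t x)) \<longlongrightarrow> 0) (at t within {0..})"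
    and wave_t_tendsto: "((\<lambda>s. normL2 (\<lambda>x. wave_t a b c s x - wave_t a b c t x)) \<longlongrightarrow> 0) (at t within {0..})"
proof -
  let ?p = "\<lambda>s x. der a (c * s + x) - der a (c * t + x)" and ?q = "\<lambda>s x. der b (c * s - x) - der b (c * t - x)"
  have L: "?p s \<in> L2" "?q s \<in> L2" for s by (intro L2_diff der_wave_L2)+
  have lims: "((\<lambda>s. normL2 (?p s)) \<longlongrightarrow> 0) (at t within {0..})" "((\<lambda>s. normL2 (?q s)) \<longlongrightarrow> 0) (at t within {0..})"
    using translate_der_tendsto[OF a, of 1 c t] translate_der_tendsto[OF b, of "-1" c t] by simp_all
  have lim: "((\<lambda>s. normL2 (?p s) + normL2 (?q s)) \<longlongrightarrow> 0) (at t within {0..})"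
    using tendsto_add[OF lims] by simp
  have e1: "(\<lambda>x. wave_x a b c s x - wave_x a b c t x) = (\<lambda>x. ?p s x + (-1) * ?q s x)" for s
    by (auto simp: wave_x_def)
  have e2: "(\<lambda>x. wave_t a b c s x - wave_t a b c t x) = (\<lambda>x. c * (?p s x + ?q s x))" for s
    by (auto simp: wave_t_def algebra_simps)
  show "((\<lambda>s. normL2 (\<lambda>x. wave_x a b c s x - wave_x a b c t x)) \<longlongrightarrow> 0) (at t within {0..})"
    unfolding e1
  proof (rule tendsto_zero_le[OF lim])
    show "\<bar>normL2 (\<lambda>x. ?p s x + (-1) * ?q s x)\<bar> \<le> normL2 (?p s) + normL2 (?q s)" for s
      using normL2_triangle[OF L(1)[of s] L2_scale[OF L(2)[of s], of "-1"]] normL2_scale[of "-1" "?q s"] by simp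
  qed
  show "((\<lambda>s. normL2 (\<lambda>x. wave_t a b c s x - wave_t a b c t x)) \<longlongrightarrow> 0) (at t within {0..})"
    unfolding e2
  proof (rule tendsto_zero_le[OF tendsto_mult_right_zero[OF lim, of "\<bar>c\<bar>"]])
    show "\<bar>normL2 (\<lambda>x. c * (?p s x + ?q s x))\<bar> \<le> \<bar>c\<bar> * (normL2 (?p s) + normL2 (?q s))" for s
      unfolding normL2_scale using normL2_triangle[OF L(1)[of s] L(2)[of s]] by (simp add: abs_mult mult_left_mono)
  qed
qed

end

lemma der_minus: "PC1 b \<Longrightarrow> der (\<lambda>s. - b s) s = - der b s"
  using DERIV_imp_deriv[OF DERIV_minus[OF der_deriv[of b s]]] by (simp add: der_def)

text \<open>Changing the sign of b exchanges space and time derivatives up to the factor c. It is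
  needed because u_x of the primitive in time is a wave built from a and -b.\<close>

lemma wave_minus:
  assumes "PC1 b"
  shows "c * wave_x a (\<lambda>s. - b s) c t x = wave_t a b c t x"
    and "wave_t a (\<lambda>s. - b s) c t x = c * wave_x a b c t x"
  by (simp_all add: wave_x_def wave_t_def der_minus[OF assms])

lemma PC1_minus: "PC1 b \<Longrightarrow> PC1 (\<lambda>s. - b s)"
  using PC1_affine[of b "-1" 0] by simp

lemma
  assumes "continuous_on UNIV g"
  shows PC1_anti: "PC1 (anti g)" and der_anti: "s \<notin> \<int> \<Longrightarrow> der (anti g) s = g s"
proof -
  have d: "(anti g has_real_derivative g s) (at s)" for s
    using anti_deriv[OF assms] by (simp add: has_real_derivative_iff_has_vector_derivative)
  show "PC1 (anti g)" by (rule PC1_C1[OF d assms])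
  show "der (anti g) s = g s" if "s \<notin> \<int>" using that DERIV_imp_deriv[OF d] by (simp add: der_def)
qed

text \<open>Only almost everywhere, since \<open>der\<close> is 0 at the integers even where the
  antiderivative is smooth.\<close>

lemma
  assumes a: "continuous_on UNIV a" and b: "continuous_on UNIV b"
  shows wave_x_anti: "AE x in I01. wave_x (anti a) (anti b) c t x = wave a (\<lambda>s. - b s) c t x"
    and wave_t_anti: "AE x in I01. wave_t (anti a) (anti b) c t x = c * wave a b c t x"
proof -
  have n: "AE x in I01. c * t + x \<notin> \<int>" "AE x in I01. c * t - x \<notin> \<int>"
    using AE_not_Ints[of 1 "c * t"] AE_not_Ints[of "-1" "c * t"] by simp_all
  show "AE x in I01. wave_x (anti a) (anti b) c t x = wave a (\<lambda>s. - b s) c t x"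
    using n by eventually_elim (simp add: wave_x_def wave_def der_anti[OF a] der_anti[OF b])
  show "AE x in I01. wave_t (anti a) (anti b) c t x = c * wave a b c t x"
    using n by eventually_elim (simp add: wave_t_def wave_def der_anti[OF a] der_anti[OF b])
qed

lemma L2_deriv_minus_const:
  "L2_deriv f f' t \<Longrightarrow> L2_deriv (\<lambda>s x. f s x - k x) f' t"
  by (simp add: L2_deriv_def)

lemma normH_tendsto_0:
  assumes "((\<lambda>s. norm (X s)) \<longlongrightarrow> 0) F" "((\<lambda>s. normL2 (u s)) \<longlongrightarrow> 0) F"
    "((\<lambda>s. normL2 (wderiv (u s))) \<longlongrightarrow> 0) F" "((\<lambda>s. normL2 (v s)) \<longlongrightarrow> 0) F"
  shows "((\<lambda>s. normH c (X s, u s, v s)) \<longlongrightarrow> 0) F"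
proof (rule Lim_null_comparison)
  show "\<forall>\<^sub>F s in F. norm (normH c (X s, u s, v s)) \<le> norm (X s) + normL2 (u s) + \<bar>c\<bar> * normL2 (wderiv (u s)) + normL2 (v s)"
    by (intro always_eventually allI) (simp add: normH_le_sum)
  have "((\<lambda>s. norm (X s) + normL2 (u s) + \<bar>c\<bar> * normL2 (wderiv (u s)) + normL2 (v s)) \<longlongrightarrow> 0 + 0 + \<bar>c\<bar> * 0 + 0) F"
    by (intro tendsto_intros assms)
  then show "((\<lambda>s. norm (X s) + normL2 (u s) + \<bar>c\<bar> * normL2 (wderiv (u s)) + normL2 (v s)) \<longlongrightarrow> 0) F" by simp
qed

lemma matrix_mult_vec_1: "B *v vec y = y *\<^sub>R (B *v vec 1)" for B :: "real^1^'n::finite"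
  by (simp add: vec_eq_iff matrix_vector_mult_def)

section \<open>Existence of mild solutions\<close>

context
  fixes c c0 \<rho> \<kappa> :: real and A :: "real^'n::finite^'n" and B :: "real^1^'n" and K :: "real^'n^1"
    and a b :: "real \<Rightarrow> real" and X :: "real \<Rightarrow> real^'n" and X0 :: "real^'n" and u0 v0 :: "real \<Rightarrow> real"
  assumes c: "c > 0" and a: "PC1 a" and b: "PC1 b"
    and refl_1: "\<And>s. s \<ge> 0 \<Longrightarrow> a (s + 1) = \<rho> * b (s - 1) + \<kappa>"
    and \<rho>: "\<rho> - 1 = - (c * c0) * (\<rho> + 1)"
    and refl_0: "\<And>s. s \<ge> 0 \<Longrightarrow> a s + b s = (K *v X s) $ 1"
    and X0: "X 0 = X0" and Xc: "continuous_on UNIV X"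
    and Xd: "\<And>s. s \<ge> 0 \<Longrightarrow> (X has_vector_derivative (1 / c) *\<^sub>R (A *v X s + B *v vec (a (s + 1) + b (s - 1)))) (at s)"
    and u0: "AE x in I01. u0 x = wave a b c 0 x" and v0: "AE x in I01. v0 x = wave_t a b c 0 x"
    and z0: "(X0, u0, v0) \<in> dom_T c0 K"
begin

abbreviation (input) "pa \<equiv> anti a"
abbreviation (input) "pb \<equiv> anti b"
abbreviation (input) "nb \<equiv> \<lambda>s. - b s"

text \<open>The integral of \<open>wave a b c\<close> over [0,t] in closed form: integrating a(c s +
  x) in s gives the increment of \<open>anti a\<close> divided by c, so no integrals depending on a
  parameter arise. \<open>mild_v\<close> and \<open>mild_XI\<close> are the corresponding integrals
  of u_t and X.\<close>

definition mild_u :: "real \<Rightarrow> real \<Rightarrow> real" where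
  "mild_u t x = (1 / c) * (wave pa pb c t x - wave pa pb c 0 x)"

definition mild_ux :: "real \<Rightarrow> real \<Rightarrow> real" where
  "mild_ux t x = (1 / c) * (wave a nb c t x - wave a nb c 0 x)"

definition mild_uxx :: "real \<Rightarrow> real \<Rightarrow> real" where
  "mild_uxx t x = (1 / c) * (wave_x a nb c t x - wave_x a nb c 0 x)"

definition mild_v :: "real \<Rightarrow> real \<Rightarrow> real" where
  "mild_v t x = wave a b c t x - wave a b c 0 x"

definition mild_XI :: "real \<Rightarrow> real^'n" where
  "mild_XI t = (1 / c) *\<^sub>R anti X (c * t)"

text \<open>a, b and X run in the time s = c t, in which the waves have speed one; hence the
  argument c t of X and the factor 1 / c in its equation.\<close>

definition mild :: "real \<Rightarrow> 'n state" where
  "mild t = (X (c * t), wave a b c t, wave_t a b c t)"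

definition mild_primitive :: "real \<Rightarrow> 'n state" where
  "mild_primitive t = (mild_XI t, mild_u t, mild_v t)"

lemma ac: "continuous_on UNIV a" and bc: "continuous_on UNIV b"
  by (rule PC1_continuous_on[OF a], rule PC1_continuous_on[OF b])

lemma pa: "PC1 pa" and pb: "PC1 pb"
  by (rule PC1_anti[OF ac], rule PC1_anti[OF bc])

lemma nb: "PC1 nb"
  by (rule PC1_minus[OF b])

lemma mild_u_weak_deriv: "weak_deriv (mild_u t) (mild_ux t)"
proof -
  have "AC (mild_u t) (\<lambda>x. (1 / c) * (wave_x pa pb c t x - wave_x pa pb c 0 x))"
    unfolding mild_u_def[abs_def] by (intro AC_scale AC_diff wave_AC pa pb)
  moreover have "AE x in I01. (1 / c) * (wave_x pa pb c t x - wave_x pa pb c 0 x) = mild_ux t x"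
    using wave_x_anti[OF ac bc, of c t] wave_x_anti[OF ac bc, of c 0] by eventually_elim (simp add: mild_ux_def)
  ultimately have "AC (mild_u t) (mild_ux t)" by (rule AC_cong[OF _ refl])
  moreover have "mild_ux t \<in> L2" unfolding mild_ux_def[abs_def] by (intro L2_scale L2_diff wave_L2 a nb)
  ultimately show ?thesis by (rule AC_weak_deriv)
qed

lemma mild_ux_weak_deriv: "weak_deriv (mild_ux t) (mild_uxx t)"
  unfolding mild_ux_def[abs_def] mild_uxx_def[abs_def] by (intro weak_deriv_scale weak_deriv_diff wave_weak_deriv a nb)

lemma mild_v_weak_deriv: "weak_deriv (mild_v t) (\<lambda>x. wave_x a b c t x - wave_x a b c 0 x)"
  unfolding mild_v_def[abs_def] by (intro weak_deriv_diff wave_weak_deriv a b)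

lemma wderiv_mild_u: "AE x in I01. wderiv (mild_u t) x = mild_ux t x"
  by (rule wderiv_AE[OF mild_u_weak_deriv])

lemma wderiv_wderiv_mild_u: "AE x in I01. wderiv (wderiv (mild_u t)) x = mild_uxx t x"
  unfolding wderiv_AE_cong[OF wderiv_mild_u] by (rule wderiv_AE[OF mild_ux_weak_deriv])

lemma wave_continuous_on: "PC1 f \<Longrightarrow> PC1 g \<Longrightarrow> continuous_on {0..1} (wave f g c t)"
  by (rule AC_continuous_on[OF wave_AC])

lemma cont_rep_mild_u: "x \<in> {0..1} \<Longrightarrow> cont_rep (mild_u t) x = mild_u t x"
  by (rule cont_rep_eq) (auto simp: mild_u_def[abs_def] intro!: continuous_on_divide continuous_on_diff
      continuous_on_const wave_continuous_on pa pb less_imp_neq[OF c, symmetric])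

lemma cont_rep_wderiv_mild_u: "x \<in> {0..1} \<Longrightarrow> cont_rep (wderiv (mild_u t)) x = mild_ux t x"
  unfolding cont_rep_AE_cong[OF wderiv_mild_u]
  by (rule cont_rep_eq) (auto simp: mild_ux_def[abs_def] intro!: continuous_on_divide continuous_on_diff
      continuous_on_const wave_continuous_on a nb less_imp_neq[OF c, symmetric])

lemma cont_rep_mild_v: "x \<in> {0..1} \<Longrightarrow> cont_rep (mild_v t) x = mild_v t x"
  by (rule cont_rep_eq) (auto simp: mild_v_def[abs_def] intro!: continuous_intros wave_continuous_on a b)

text \<open>The condition \<open>refl_0\<close> integrated in time: the two antiderivatives vanish
  at 0 and share the derivative a + b.\<close>

lemma mild_u_0:
  assumes t: "t \<ge> 0"
  shows "mild_u t 0 = (K *v mild_XI t) $ 1"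
proof -
  have bl: "bounded_linear (\<lambda>x. (K *v x) $ 1)"
    using bounded_linear_compose[OF bounded_linear_vec_nth matrix_vector_mul_bounded_linear] .
  have "anti a (c * t) + anti b (c * t) = (K *v anti X (c * t)) $ 1"
  proof (rule eq_of_derivatives_eq[where s="c * t" and F="\<lambda>s. anti a s + anti b s" and G="\<lambda>s. (K *v anti X s) $ 1"])
    show "((\<lambda>s. anti a s + anti b s) has_vector_derivative a s + b s) (at s)" for s
      by (intro has_vector_derivative_add anti_deriv ac bc)
    show "((\<lambda>s. (K *v anti X s) $ 1) has_vector_derivative a s + b s) (at s)" if "s \<ge> 0" for s
      unfolding refl_0[OF that] by (rule bounded_linear.has_vector_derivative[OF bl anti_deriv[OF Xc]])
  qed (use t c in \<open>auto simp: anti_0[OF ac] anti_0[OF bc] anti_0[OF Xc]\<close>)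
  then show ?thesis
    using linear_simps(5)[OF bl] by (simp add: mild_u_def mild_XI_def wave_def anti_0[OF ac] anti_0[OF bc])
qed

text \<open>Subtracting the reflection law at times 0 and c t removes \<kappa>. The increment of a
  is then \<rho> times that of b, which is the damping condition because \<rho> - 1 = - c c0 (\<rho>
  + 1).\<close>

lemma mild_ux_1:
  assumes t: "t \<ge> 0"
  shows "mild_ux t 1 = - c0 * mild_v t 1"
proof -
  let ?d = "b (c * t - 1) - b (0 - 1)"
  have 1: "a (c * t + 1) - a (0 + 1) = \<rho> * ?d"
    using refl_1[of "c * t"] refl_1[of 0] t c by (simp add: algebra_simps)
  have "c * mild_ux t 1 = (\<rho> - 1) * ?d"
    using 1 c by (simp add: mild_ux_def wave_def algebra_simps)
  also have "\<dots> = c * (- c0 * ((\<rho> + 1) * ?d))" unfolding \<rho> by (simp add: mult_ac)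
  also have "(\<rho> + 1) * ?d = mild_v t 1"
    using 1 by (simp add: mild_v_def wave_def algebra_simps)
  finally have "c * mild_ux t 1 = c * (- c0 * mild_v t 1)" .
  moreover have "c \<noteq> 0" using c by simp
  ultimately show ?thesis by (metis mult_left_cancel)
qed

lemma mild_XI_eq:
  assumes t: "t \<ge> 0"
  shows "X (c * t) = X0 + (A *v mild_XI t + B *v vec (mild_u t 1))"
proof -
  \<comment> \<open>The right-hand side in closed form; at s = 0 all increments vanish and X0
    remains.\<close>
  let ?R = "\<lambda>s. X0 + (1 / c) *\<^sub>R (A *v anti X s + (anti a (s + 1) - anti a 1 + (anti b (s - 1) - anti b (- 1))) *\<^sub>R (B *v vec 1))"
  have sh: "((\<lambda>s. anti g (s + l)) has_real_derivative g (s + l)) (at s)" if "continuous_on UNIV g" for g l s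
    using anti_deriv[OF that, of "s + l"] by (simp add: has_real_derivative_iff_has_vector_derivative[symmetric] DERIV_shift)
  have "X (c * t) = ?R (c * t)"
  proof (rule eq_of_derivatives_eq[where F=X and G="?R"])
    show "(X has_vector_derivative (1 / c) *\<^sub>R (A *v X s + B *v vec (a (s + 1) + b (s - 1)))) (at s)" if "s \<ge> 0" for s
      by (rule Xd[OF that])
    show "(?R has_vector_derivative (1 / c) *\<^sub>R (A *v X s + B *v vec (a (s + 1) + b (s - 1)))) (at s)" for s
    proof -
      have 1: "((\<lambda>s. A *v anti X s) has_vector_derivative A *v X s) (at s)"
        by (rule bounded_linear.has_vector_derivative[OF matrix_vector_mul_bounded_linear anti_deriv[OF Xc]])
      have "((\<lambda>s. anti a (s + 1) - anti a 1 + (anti b (s - 1) - anti b (- 1))) has_real_derivative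
          a (s + 1) + b (s - 1)) (at s)"
        using sh[OF ac, of 1 s] sh[OF bc, of "-1" s] by (auto intro!: derivative_eq_intros)
      then have 2: "((\<lambda>s. (anti a (s + 1) - anti a 1 + (anti b (s - 1) - anti b (- 1))) *\<^sub>R (B *v vec 1))
          has_vector_derivative (a (s + 1) + b (s - 1)) *\<^sub>R (B *v vec 1)) (at s)"
        using has_vector_derivative_scaleR[OF _ has_vector_derivative_const[of "B *v vec 1"]] by simp
      show ?thesis
        unfolding matrix_mult_vec_1[of B "a (s + 1) + b (s - 1)"]
        using has_vector_derivative_add[OF has_vector_derivative_const[of X0]
            bounded_linear.has_vector_derivative[OF bounded_linear_scaleR_right has_vector_derivative_add[OF 1 2], of "1 / c"]]
        by simp
    qed
  qed (use t c in \<open>auto simp: X0 anti_0[OF Xc]\<close>)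
  also have "\<dots> = X0 + (A *v mild_XI t + B *v vec (mild_u t 1))"
    unfolding matrix_mult_vec_1[of B "mild_u t 1"]
    by (simp add: mild_XI_def mild_u_def wave_def matrix_vector_mult_scaleR scaleR_add_right algebra_simps)
  finally show ?thesis .
qed

text \<open>Integration in time gains one derivative: u_x of the primitive is a wave in a and -b
  themselves, hence Lipschitz in x, although u_x of \<open>mild\<close> may jump.\<close>

lemma mild_primitive_dom:
  assumes t: "t \<ge> 0"
  shows "mild_primitive t \<in> dom_T c0 K"
proof -
  note eq = weak_deriv_AE_cong[OF wderiv_mild_u]
  show ?thesis
    unfolding mild_primitive_def dom_T_iff eq
    using weak_deriv_wderiv[OF mild_u_weak_deriv] mild_ux_weak_deriv[THEN weak_deriv_wderiv] weak_deriv_wderiv[OF mild_v_weak_deriv]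
    by (simp add: cont_rep_mild_u cont_rep_wderiv_mild_u cont_rep_mild_v mild_u_0[OF t] mild_ux_1[OF t] wderiv_AE_cong[OF wderiv_mild_u])
qed

lemma mild_H_space: "mild t \<in> H_space"
  unfolding mild_def H_space_iff using weak_deriv_wderiv[OF wave_weak_deriv[OF a b]] wave_t_L2[OF a b] by simp

lemma mild_continuous: "H_continuous c mild"
  unfolding H_continuous_def
proof (intro allI impI)
  fix t :: real assume t: "t \<ge> 0"
  have "continuous_on UNIV (\<lambda>s. X (c * s))"
    by (rule continuous_on_compose2[OF Xc]) (auto intro!: continuous_intros)
  then have "((\<lambda>s. X (c * s)) \<longlongrightarrow> X (c * t)) (at t within {0..})"
    using continuous_on_subset[of UNIV _ "{0..}"] t by (auto simp: continuous_on_def)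
  then have 1: "((\<lambda>s. norm (X (c * s) - X (c * t))) \<longlongrightarrow> 0) (at t within {0..})"
    by (intro tendsto_norm_zero) (simp add: LIM_zero_iff)
  have 2: "((\<lambda>s. normL2 (\<lambda>x. wave a b c s x - wave a b c t x)) \<longlongrightarrow> 0) (at t within {0..})"
    by (rule L2_deriv_tendsto[OF wave_L2_deriv[OF a b t] t wave_L2[OF a b] wave_t_L2[OF a b]])
  have "normL2 (wderiv (\<lambda>x. wave a b c s x - wave a b c t x)) = normL2 (\<lambda>x. wave_x a b c s x - wave_x a b c t x)" for s
    by (rule normL2_AE_cong[OF wderiv_AE]) (intro weak_deriv_diff wave_weak_deriv a b)
  then have 3: "((\<lambda>s. normL2 (wderiv (\<lambda>x. wave a b c s x - wave a b c t x))) \<longlongrightarrow> 0) (at t within {0..})"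
    using wave_x_tendsto[OF a b, of c t] by simp
  show "((\<lambda>s. normH c (st_diff (mild s) (mild t))) \<longlongrightarrow> 0) (at t within {0..})"
    unfolding mild_def st_diff_simp by (rule normH_tendsto_0[OF 1 2 3 wave_t_tendsto[OF a b]])
qed

lemma mild_H_deriv:
  assumes t: "t \<ge> 0"
  shows "H_deriv c mild_primitive (mild t) t"
proof -
  have "(mild_XI has_vector_derivative X (c * t)) (at t within {0..})"
  proof -
    have "((\<lambda>t. c * t) has_vector_derivative c) (at t)" by (auto intro!: derivative_eq_intros)
    from vector_diff_chain_at[OF this anti_deriv[OF Xc]]
    have "((\<lambda>t. anti X (c * t)) has_vector_derivative c *\<^sub>R X (c * t)) (at t)" by (simp add: o_def)
    from bounded_linear.has_vector_derivative[OF bounded_linear_scaleR_right this, of "1 / c"]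
    show ?thesis using c unfolding mild_XI_def by (auto intro: has_vector_derivative_at_within)
  qed
  then have "((\<lambda>s. norm (mild_XI s - mild_XI t - (s - t) *\<^sub>R X (c * t)) / norm (s - t)) \<longlongrightarrow> 0) (at t within {0..})"
    unfolding has_vector_derivative_def has_derivative_iff_norm by (simp add: divide_inverse)
  then have 1: "((\<lambda>s. norm (mild_XI s - mild_XI t - (s - t) *\<^sub>R X (c * t)) / \<bar>s - t\<bar>) \<longlongrightarrow> 0) (at t within {0..})"
    by simp
  have "L2_deriv mild_u (\<lambda>x. (1 / c) * wave_t pa pb c t x) t"
    unfolding mild_u_def[abs_def] by (intro L2_deriv_scale L2_deriv_minus_const wave_L2_deriv pa pb t)
  then have 2: "L2_deriv mild_u (wave a b c t) t"
  proof (rule L2_deriv_cong[OF _ t])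
    show "AE x in I01. 1 / c * wave_t pa pb c t x = wave a b c t x"
      using wave_t_anti[OF ac bc, of c t] by eventually_elim (use c in simp)
  qed simp
  have "L2_deriv mild_ux (\<lambda>x. (1 / c) * wave_t a nb c t x) t"
    unfolding mild_ux_def[abs_def] by (intro L2_deriv_scale L2_deriv_minus_const wave_L2_deriv a nb t)
  then have 3: "L2_deriv mild_ux (wave_x a b c t) t"
    using c by (simp add: wave_minus[OF b])
  have 4: "L2_deriv mild_v (wave_t a b c t) t"
    unfolding mild_v_def[abs_def] by (intro L2_deriv_minus_const wave_L2_deriv a b t)
  have e: "normL2 (wderiv (\<lambda>x. mild_u s x - mild_u t x - (s - t) * wave a b c t x))
      = normL2 (\<lambda>x. mild_ux s x - mild_ux t x - (s - t) * wave_x a b c t x)" for s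
    by (rule normL2_AE_cong[OF wderiv_AE]) (intro weak_deriv_diff weak_deriv_scale wave_weak_deriv mild_u_weak_deriv a b)
  show ?thesis
    unfolding H_deriv_def mild_def mild_primitive_def st_increment_simp
  proof (rule tendsto_zero_le)
    let ?n1 = "\<lambda>s. norm (mild_XI s - mild_XI t - (s - t) *\<^sub>R X (c * t))"
    let ?n2 = "\<lambda>s. normL2 (\<lambda>x. mild_u s x - mild_u t x - (s - t) * wave a b c t x)"
    let ?n3 = "\<lambda>s. normL2 (\<lambda>x. mild_ux s x - mild_ux t x - (s - t) * wave_x a b c t x)"
    let ?n4 = "\<lambda>s. normL2 (\<lambda>x. mild_v s x - mild_v t x - (s - t) * wave_t a b c t x)"
    have "((\<lambda>s. ?n1 s / \<bar>s - t\<bar> + ?n2 s / \<bar>s - t\<bar> + \<bar>c\<bar> * (?n3 s / \<bar>s - t\<bar>) + ?n4 s / \<bar>s - t\<bar>) \<longlongrightarrow> 0 + 0 + \<bar>c\<bar> * 0 + 0)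
        (at t within {0..})"
      using 1 2 3 4 unfolding L2_deriv_def by (intro tendsto_intros)
    then show "((\<lambda>s. ?n1 s / \<bar>s - t\<bar> + ?n2 s / \<bar>s - t\<bar> + \<bar>c\<bar> * (?n3 s / \<bar>s - t\<bar>) + ?n4 s / \<bar>s - t\<bar>) \<longlongrightarrow> 0) (at t within {0..})"
      by simp
    fix s :: real
    let ?z = "normH c (mild_XI s - mild_XI t - (s - t) *\<^sub>R X (c * t), \<lambda>x. mild_u s x - mild_u t x - (s - t) * wave a b c t x,
        \<lambda>x. mild_v s x - mild_v t x - (s - t) * wave_t a b c t x)"
    have "?z \<le> ?n1 s + ?n2 s + \<bar>c\<bar> * ?n3 s + ?n4 s"
      by (rule order_trans[OF normH_le_sum]) (simp add: e)
    then have "?z / \<bar>s - t\<bar> \<le> (?n1 s + ?n2 s + \<bar>c\<bar> * ?n3 s + ?n4 s) / \<bar>s - t\<bar>"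
      by (intro divide_right_mono) auto
    then show "\<bar>?z / \<bar>s - t\<bar>\<bar> \<le> ?n1 s / \<bar>s - t\<bar> + ?n2 s / \<bar>s - t\<bar> + \<bar>c\<bar> * (?n3 s / \<bar>s - t\<bar>) + ?n4 s / \<bar>s - t\<bar>"
      by (simp add: add_divide_distrib)
  qed
qed

lemma mild_equation:
  assumes t: "t \<ge> 0"
  shows "st_eq (mild t) (st_add (X0, u0, v0) (op_T c A B (mild_primitive t)))"
proof -
  have 1: "AE x in I01. wave a b c t x = u0 x + mild_v t x"
    using u0 by eventually_elim (simp add: mild_v_def)
  have 2: "AE x in I01. wave_t a b c t x = v0 x + c\<^sup>2 * wderiv (wderiv (mild_u t)) x"
    using v0 wderiv_wderiv_mild_u[of t]
  proof eventually_elim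
    case (elim x)
    \<comment> \<open>c u_x for the pair a, -b is u_t for the pair a, b, so this is the increment of
      u_t.\<close>
    have "c\<^sup>2 * mild_uxx t x = c * wave_x a nb c t x - c * wave_x a nb c 0 x"
      using c by (simp add: mild_uxx_def power2_eq_square algebra_simps)
    then show ?case using elim by (simp add: wave_minus[OF b])
  qed
  show ?thesis
    using 1 2 mild_XI_eq[OF t] cont_rep_mild_u[of 1 t] by (simp add: mild_def mild_primitive_def op_T_def st_add_def st_eq_def)
qed

lemma mild_solution: "solution c c0 A B K (X0, u0, v0) mild"
  unfolding solution_def H_primitive_def
proof (intro conjI allI impI exI[of _ mild_primitive])
  fix t :: real assume t: "t \<ge> 0"
  show "mild t \<in> H_space" by (rule mild_H_space)
  show "mild_primitive t \<in> H_space" by (rule dom_T_H_space(1)[OF mild_primitive_dom[OF t]])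
  show "mild_primitive t \<in> dom_T c0 K" by (rule mild_primitive_dom[OF t])
  show "((\<lambda>s. normH c (st_diff (st_diff (mild_primitive s) (mild_primitive t)) (st_scale (s - t) (mild t))) / \<bar>s - t\<bar>)
      \<longlongrightarrow> 0) (at t within {0..})"
    using mild_H_deriv[OF t] by (simp add: H_deriv_def)
  show "normH c (st_diff (mild t) (st_add (X0, u0, v0) (op_T c A B (mild_primitive t)))) = 0"
    using normH_eq_0_iff[OF c mild_H_space H_space_add[OF dom_T_H_space(1)[OF z0] dom_T_H_space(2)[OF mild_primitive_dom[OF t]]]]
      mild_equation[OF t] by simp
next
  show "H_continuous c mild" by (rule mild_continuous)
  have "mild_primitive 0 = st_scale 0 (mild_primitive 0)"
    by (simp add: mild_primitive_def st_scale_def mild_XI_def mild_u_def[abs_def] mild_v_def[abs_def] anti_0[OF Xc])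
  then show "normH c (mild_primitive 0) = 0"
    using normH_scale[OF dom_T_H_space(1)[OF mild_primitive_dom[of 0]], of c 0] by simp
qed

end

text \<open>D'Alembert's formula: a(x) + b(-x) = u0 and c (a'(x) + b'(-x)) = v0 give a' = (u0' + v0
  / c) / 2 and b'(-x) = - (u0' - v0 / c) / 2 on [0,1]. The delay system continues a beyond 1 and b
  beyond 0.\<close>

lemma solution_exists:
  fixes A :: "real^'n::finite^'n" and B :: "real^1^'n" and K :: "real^'n^1"
  assumes c: "c > 0" and c0: "c0 > 0" and z0: "z0 \<in> dom_T c0 K"
  shows "\<exists>z. solution c c0 A B K z0 z"
proof -
  obtain X0 u0 v0 where z0_eq: "z0 = (X0, u0, v0)" by (cases z0)
  note d = dom_TD[OF z0[unfolded z0_eq]]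
  \<comment> \<open>Constant continuation of the data outside [0,1], so that the initial waves are
    C1 on the whole line.\<close>
  let ?cl = "\<lambda>s::real. max 0 (min 1 s)"
  define r where "r s = cont_rep (wderiv u0) (?cl s)" for s
  define w where "w s = cont_rep v0 (?cl s)" for s
  have rc: "continuous_on UNIV r" unfolding r_def
    by (rule continuous_on_compose2[OF AC_continuous_on[OF cont_rep_AC[OF d(2)]]]) (auto intro!: continuous_intros)
  have wc: "continuous_on UNIV w" unfolding w_def
    by (rule continuous_on_compose2[OF AC_continuous_on[OF cont_rep_AC[OF d(3)]]]) (auto intro!: continuous_intros)
  define f1 where "f1 s = (1 / 2) * (r s + (1 / c) * w s)" for s
  define f2 where "f2 s = (1 / 2) * (r s - (1 / c) * w s)" for s
  have f1c: "continuous_on UNIV f1" and f2c: "continuous_on UNIV f2"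
    unfolding f1_def f2_def
    by (intro continuous_on_mult_left continuous_on_add continuous_on_diff rc wc)+
  define k where "k x = (K *v x) $ 1" for x
  have bl: "bounded_linear k"
    unfolding k_def using bounded_linear_compose[OF bounded_linear_vec_nth matrix_vector_mul_bounded_linear] .
  \<comment> \<open>The constant makes a + b at 0 equal to K X0, which is u0(0) because the initial
    state lies in the domain.\<close>
  define b0 where "b0 s = k X0 + anti f2 (- s)" for s
  have a0d: "(anti f1 has_real_derivative f1 s) (at s)" for s
    using anti_deriv[OF f1c] by (simp add: has_real_derivative_iff_has_vector_derivative)
  have b0d: "(b0 has_real_derivative - f2 (- s)) (at s)" for s
  proof -
    have "(anti f2 has_real_derivative f2 (- s)) (at (- s))"
      using anti_deriv[OF f2c] by (simp add: has_real_derivative_iff_has_vector_derivative)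
    then have "((\<lambda>s. anti f2 (- s)) has_real_derivative - f2 (- s)) (at s)"
      by (simp add: DERIV_mirror)
    then show ?thesis unfolding b0_def by (auto intro!: derivative_eq_intros)
  qed
  have a0: "PC1 (anti f1)" by (rule PC1_C1[OF a0d f1c])
  have b0: "PC1 b0"
    by (rule PC1_C1[OF b0d]) (auto intro!: continuous_intros continuous_on_compose2[OF f2c])
  \<comment> \<open>Reflection coefficient of the damped end: the ratio of the reflected a' to the
    incoming b' forced by u_x(1) = - c0 u_t(1).\<close>
  define \<rho> where "\<rho> = (1 - c * c0) / (1 + c * c0)"
  have "1 + c * c0 > 0" using c c0 by (simp add: add_pos_pos)
  then have \<rho>: "\<rho> - 1 = - (c * c0) * (\<rho> + 1)" by (simp add: \<rho>_def field_simps)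
  have compat: "anti f1 0 + b0 0 = k X0" by (simp add: b0_def anti_0[OF f1c] anti_0[OF f2c])
  define \<kappa> where "\<kappa> = anti f1 1 - \<rho> * b0 (- 1)"
  obtain a b X where a: "PC1 a" and b: "PC1 b" and aa0: "\<And>s. s \<le> 1 \<Longrightarrow> a s = anti f1 s"
    and bb0: "\<And>s. s \<le> 0 \<Longrightarrow> b s = b0 s" and refl_1: "\<And>s. s \<ge> 0 \<Longrightarrow> a (s + 1) = \<rho> * b (s - 1) + \<kappa>"
    and refl_0: "\<And>s. s \<ge> 0 \<Longrightarrow> a s + b s = k (X s)" and X0: "X 0 = X0"
    and Xd: "\<And>s. (X has_vector_derivative ((1 / c) *\<^sub>R A) *v X s
        + ((1 + \<rho>) * b (s - 1) + \<kappa>) *\<^sub>R ((1 / c) *\<^sub>R (B *v vec 1))) (at s)"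
    using delay_system_exists[OF bl a0 b0 compat \<kappa>_def] by blast
  have Xc: "continuous_on UNIV X" by (rule has_vector_derivative_continuous_on_UNIV[OF Xd])
  have Xd': "(X has_vector_derivative (1 / c) *\<^sub>R (A *v X s + B *v vec (a (s + 1) + b (s - 1)))) (at s)"
    if s: "s \<ge> 0" for s
  proof -
    have "(1 + \<rho>) * b (s - 1) + \<kappa> = a (s + 1) + b (s - 1)"
      using refl_1[OF s] by (simp add: algebra_simps)
    then have "((1 / c) *\<^sub>R A) *v X s + ((1 + \<rho>) * b (s - 1) + \<kappa>) *\<^sub>R ((1 / c) *\<^sub>R (B *v vec 1))
        = (1 / c) *\<^sub>R (A *v X s + B *v vec (a (s + 1) + b (s - 1)))"
      unfolding matrix_mult_vec_1[of B "a (s + 1) + b (s - 1)"]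
      by (simp add: scaleR_add_right mult.commute flip: scaleR_matrix_vector_assoc)
    with Xd[of s] show ?thesis by simp
  qed
  have u0_AE: "AE x in I01. u0 x = wave a b c 0 x"
  proof -
    have F: "AC (\<lambda>x. anti f1 x + b0 (- x)) r"
    proof (rule AC_C1[OF _ continuous_on_subset[OF rc]])
      show "((\<lambda>x. anti f1 x + b0 (- x)) has_real_derivative r x) (at x)" for x
      proof -
        have "((\<lambda>x. b0 (- x)) has_real_derivative f2 x) (at x)"
          using b0d[of "- x"] by (simp add: DERIV_mirror)
        from DERIV_add[OF a0d[of x] this] show ?thesis by (simp add: f1_def f2_def algebra_simps)
      qed
    qed simp
    have "AE x in I01. r x = wderiv u0 x"
      using weak_deriv_cont_rep(2)[OF d(2)] AE_I01_interval by eventually_elim (simp add: r_def)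
    then have F': "AC (\<lambda>x. anti f1 x + b0 (- x)) (wderiv u0)" by (rule AC_cong[OF F refl])
    have eq: "cont_rep u0 x = anti f1 x + b0 (- x)" if "x \<in> {0..1}" for x
      using AC_eq[OF F' that] AC_eq[OF cont_rep_AC[OF d(1)] that] compat d(4) by (simp add: k_def)
    show ?thesis
      using weak_deriv_cont_rep(2)[OF d(1)] AE_I01_interval
    proof eventually_elim
      case (elim x)
      then show ?case using eq[of x] by (simp add: wave_def aa0 bb0)
    qed
  qed
  have v0_AE: "AE x in I01. v0 x = wave_t a b c 0 x"
  proof -
    have n: "AE x in I01. 0 + 1 * x \<notin> \<int>" by (rule AE_not_Ints) simp
    show ?thesis
      using weak_deriv_cont_rep(2)[OF d(3)] AE_I01_interval n
    proof eventually_elim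
      case (elim x)
      \<comment> \<open>Interior points are not integers, so \<open>der\<close> is a true derivative
        there, and a, b coincide nearby with the initial waves.\<close>
      then have x: "0 < x" "x < 1" "x \<notin> \<int>" "- x \<notin> \<int>"
        using Ints_0 Ints_1 by (auto simp: less_le)
      have "(a has_real_derivative f1 x) (at x)"
        by (rule has_field_derivative_transform_within_open[OF a0d[of x], of "{..<1}"]) (use x aa0 in auto)
      then have 1: "der a x = f1 x" using x by (simp add: der_def DERIV_imp_deriv)
      have "(b0 has_real_derivative - f2 x) (at (- x))" using b0d[of "- x"] by simp
      then have "(b has_real_derivative - f2 x) (at (- x))"
        by (rule has_field_derivative_transform_within_open[where S="{..<0}"]) (use x bb0 in auto)
      then have 2: "der b (- x) = - f2 x" using x by (simp add: der_def DERIV_imp_deriv)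
      have "v0 x = w x" using elim by (simp add: w_def)
      also have "\<dots> = c * (der a x + der b (- x))" unfolding 1 2 f1_def f2_def using c by (simp add: field_simps)
      finally show ?case by (simp add: wave_t_def)
    qed
  qed
  have "solution c c0 A B K (X0, u0, v0) (mild c a b X)"
    by (rule mild_solution[OF c a b refl_1 \<rho> refl_0[unfolded k_def] X0 Xc Xd' u0_AE v0_AE z0[unfolded z0_eq]])
  then show ?thesis unfolding z0_eq by blast
qed

theorem theorem1:
  fixes A :: "real^'n^'n" and B :: "real^1^'n" and K :: "real^'n^1"
    and c c0 :: real
    and P0 :: "real^('n + 2)^('n + 2)" and S R :: "real^2^2"
  assumes "c > 0" and "c0 > 0"
    and "sym_pos_def P0" and "sym_pos_def S" and "sym_pos_def R"
    and "sym_neg_def (Psi0 c c0 A B K P0 S R)"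
  shows "(\<forall>z0 \<in> dom_T c0 K.
            (\<exists>z. solution c c0 A B K z0 z) \<and>
            (\<forall>z z'. solution c c0 A B K z0 z \<and> solution c c0 A B K z0 z' \<longrightarrow>
               (\<forall>t\<ge>0. normH c (st_diff (z t) (z' t)) = 0))) \<and>
         (\<exists>\<gamma>\<ge>1. \<exists>\<delta>>0. \<forall>z0 \<in> dom_T c0 K. \<forall>z. solution c c0 A B K z0 z \<longrightarrow>
            (\<forall>t>0. (normH c (z t))\<^sup>2 \<le> \<gamma> * exp (- \<delta> * t) * (normH c z0)\<^sup>2))"
proof (rule classical_decay[OF assms(1,3-6)])
  fix \<gamma> \<delta> :: real
  assume "\<gamma> \<ge> 1" "\<delta> > 0"
    and decay: "\<And>D t. classical_solution c c0 A B K D \<Longrightarrow> t \<ge> 0 \<Longrightarrow>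
      (normH c (D t))\<^sup>2 \<le> \<gamma> * exp (- \<delta> * t) * (normH c (D 0))\<^sup>2"
  \<comment> \<open>The factor \<open>C t\<close> of the transfer lemmas is \<gamma> exp(- \<delta>
    t), with constants fixed before the initial state.\<close>
  have "\<forall>z0 \<in> dom_T c0 K. \<forall>z. solution c c0 A B K z0 z \<longrightarrow>
      (\<forall>t>0. (normH c (z t))\<^sup>2 \<le> \<gamma> * exp (- \<delta> * t) * (normH c z0)\<^sup>2)"
    using solution_decay[OF decay assms(1)] by simp
  moreover have "\<forall>z0 \<in> dom_T c0 K. (\<exists>z. solution c c0 A B K z0 z) \<and>
      (\<forall>z z'. solution c c0 A B K z0 z \<and> solution c c0 A B K z0 z' \<longrightarrow>
        (\<forall>t\<ge>0. normH c (st_diff (z t) (z' t)) = 0))"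
    using solution_exists[OF assms(1,2)] solution_unique[OF decay assms(1)] by blast
  ultimately show ?thesis using \<open>\<gamma> \<ge> 1\<close> \<open>\<delta> > 0\<close> by blast
qed

end
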